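(* Let $K\subset L'\subset M'$ be finite extensions. Let $M'/K$ be obtained by general normal magnification from $M/K$ through $J'/K$ and let $L'/K$ be obtained by general normal magnification from $L/K$ through $J/K$, where $L\subset M$ and $J\subset J'$. Then (1) $\rho_K(M',L')=\rho_K(M,L)\cdot\rho_K(J',J)$ and $\lambda_K(M',L')=\lambda_K(M,L)\cdot\lambda_K(J',J)$. (2) $\tau_K(M',L')=\tau_K(M,L)\cdot\tau_K(J',J)$ and $\alpha_K(M',L')=\alpha_K(M,L)\cdot\alpha_K(J',J)$. (3) $\gamma_K(M',L')=\gamma_K(M,L)\cdot\gamma_K(J',J)$, $\Gamma_K(M',L')=\Gamma_K(M,L)\cdot\Gamma_K(J',J)$ and $\iota_K(M',L')=\iota_K(M,L)\cdot\iota_K(J',J)$.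
   Context: $K$ is any field (not necessarily perfect) with a fixed algebraic closure $\bar K$; all extensions are finite and contained in $\bar K$. A tilde denotes normal closure over $K$ in $\bar K$; for an extension $E/K$, $E_S$ and $E_I$ denote its maximal separable and maximal purely inseparable subextensions. A finite extension $M/K$ is obtained by general normal magnification from a subextension $L/K$ through a finite extension $J/K$ if $[L:K]>1$, $\tilde L$ and $\tilde J$ are linearly disjoint over $K$, and $LJ=M$. For extensions $E/K$ and $T/K$, let $E_1,\dots,E_a$ be all the distinct subfields of $T$ isomorphic to $E$ over $K$. Let $r_K(E)=|\mathrm{Aut}(E/K)|$ and $l_K(E)=[E:E_S]\cdot r_K(E)$. Define: root capacity $\rho_K(T,E)=a\cdot r_K(E)$; multiroot capacity $\lambda_K(T,E)=a\cdot l_K(E)$; intersection indicium $\tau_K(T,E)=[\bigcap_i (E_i)_S:K]$; intersection normal indicium $\alpha_K(T,E)=[\bigcap_i E_i:K]$; compositum indicium $\gamma_K(T,E)=[\prod_i (E_i)_S:K]$; compositum normal indicium $\Gamma_K(T,E)=[\prod_i E_i:K]$; $\iota_K(T,E)=[(\prod_i E_i)_I:K]$ ($\prod$ is the compositum of fields). If $a=0$, the quantities $\tau,\alpha,\gamma,\Gamma,\iota$ are defined to be $0$. *)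

theory Defs
  imports "HOL-Algebra.Algebraic_Closure" "HOL-Algebra.Generated_Fields"
begin

text \<open>
  All fields are subfields of a fixed ambient field \<open>R\<close>, which in the main theorem is an algebraic
  closure of \<open>K\<close>. An extension \<open>E/K\<close> is given by the carrier set of \<open>E\<close>, and its degree is
  \<open>(dim over K) E\<close>. The roots and the multiplicities of minimal polynomials below are therefore
  always counted in the algebraic closure.
\<close>

definition (in ring) finite_ext :: "'a set \<Rightarrow> 'a set \<Rightarrow> bool"
  where "finite_ext K E \<longleftrightarrow> subfield E R \<and> K \<subseteq> E \<and> (finite_dimension over K) E"

definition (in ring) separable_ext :: "'a set \<Rightarrow> 'a set \<Rightarrow> bool"
  where "separable_ext K E \<longleftrightarrow> subfield E R \<and> K \<subseteq> E \<and>
    (\<forall>x\<in>E. (algebraic over K) x \<and> (\<forall>y. count (roots (Irr K x)) y \<le> 1))"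

definition (in ring) purely_inseparable_ext :: "'a set \<Rightarrow> 'a set \<Rightarrow> bool"
  where "purely_inseparable_ext K E \<longleftrightarrow> subfield E R \<and> K \<subseteq> E \<and>
    (\<forall>x\<in>E. (algebraic over K) x \<and> set_mset (roots (Irr K x)) = {x})"

text \<open>Splitting is required over \<open>E\<close>, hence the roots are those in the ring with carrier \<open>E\<close>.\<close>
definition (in ring) normal_ext :: "'a set \<Rightarrow> 'a set \<Rightarrow> bool"
  where "normal_ext K E \<longleftrightarrow> subfield E R \<and> K \<subseteq> E \<and> (\<forall>x\<in>E. (algebraic over K) x) \<and>
    (\<forall>p \<in> carrier (K[X]). pirreducible K p \<and> (\<exists>x\<in>E. eval p x = \<zero>)
       \<longrightarrow> ring.splitted (R\<lparr>carrier := E\<rparr>) p)"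

text \<open>
  The maximal separable and maximal purely inseparable subextensions (\<open>E\<^sub>S\<close> and \<open>E\<^sub>I\<close>) and the
  normal closure are taken with respect to inclusion, which is the order on sets.
\<close>
definition (in ring) max_separable :: "'a set \<Rightarrow> 'a set \<Rightarrow> 'a set"
  where "max_separable K E = (GREATEST F. F \<subseteq> E \<and> separable_ext K F)"

definition (in ring) max_purely_inseparable :: "'a set \<Rightarrow> 'a set \<Rightarrow> 'a set"
  where "max_purely_inseparable K E = (GREATEST F. F \<subseteq> E \<and> purely_inseparable_ext K F)"

definition (in ring) normal_closure :: "'a set \<Rightarrow> 'a set \<Rightarrow> 'a set"
  where "normal_closure K E = (LEAST N. E \<subseteq> N \<and> normal_ext K N)"

definition (in ring) compositum :: "'a set set \<Rightarrow> 'a set"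
  where "compositum \<F> = generate_field R (\<Union>\<F>)"

definition (in ring) linearly_disjoint :: "'a set \<Rightarrow> 'a set \<Rightarrow> 'a set \<Rightarrow> bool"
  where "linearly_disjoint K A B \<longleftrightarrow>
    (\<forall>Us. set Us \<subseteq> A \<and> (independent over K) Us \<longrightarrow> (independent over B) Us)"

text \<open>\<open>M/K\<close> is obtained by general normal magnification from \<open>L/K\<close> through \<open>J/K\<close>.\<close>
definition (in ring) general_normal_magnification ::
    "'a set \<Rightarrow> 'a set \<Rightarrow> 'a set \<Rightarrow> 'a set \<Rightarrow> bool"
  where "general_normal_magnification K M L J \<longleftrightarrow>
    finite_ext K M \<and> finite_ext K L \<and> L \<subseteq> M \<and> finite_ext K J \<and>
    (dim over K) L > 1 \<and>
    linearly_disjoint K (normal_closure K L) (normal_closure K J) \<and>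
    compositum {L, J} = M"

text \<open>Isomorphisms are taken extensional on \<open>E\<close>, so that they can be counted.\<close>
definition (in ring) K_isos :: "'a set \<Rightarrow> 'a set \<Rightarrow> 'a set \<Rightarrow> ('a \<Rightarrow> 'a) set"
  where "K_isos K E F =
    {h \<in> extensional E. h \<in> ring_iso (R\<lparr>carrier := E\<rparr>) (R\<lparr>carrier := F\<rparr>) \<and> (\<forall>k\<in>K. h k = k)}"

text \<open>The distinct subfields \<open>E\<^sub>1, \<dots>, E\<^sub>a\<close> of \<open>T\<close> that are isomorphic to \<open>E\<close> over \<open>K\<close>.\<close>
definition (in ring) iso_subfields :: "'a set \<Rightarrow> 'a set \<Rightarrow> 'a set \<Rightarrow> 'a set set"
  where "iso_subfields K T E = {F. subfield F R \<and> F \<subseteq> T \<and> K_isos K E F \<noteq> {}}"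

text \<open>
  \<open>aut_number\<close> and \<open>multi_aut_number\<close> are \<open>r\<^sub>K(E)\<close> and \<open>l\<^sub>K(E)\<close>. The seven quantities that follow them are,
  in this order, \<open>\<rho>, \<lambda>, \<tau>, \<alpha>, \<gamma>, \<Gamma>, \<iota>\<close>; the last five are set to \<open>0\<close> if \<open>a = 0\<close>.
\<close>
definition (in ring) aut_number :: "'a set \<Rightarrow> 'a set \<Rightarrow> nat"
  where "aut_number K E = card (K_isos K E E)"

definition (in ring) multi_aut_number :: "'a set \<Rightarrow> 'a set \<Rightarrow> nat"
  where "multi_aut_number K E = (dim over (max_separable K E)) E * aut_number K E"

definition (in ring) root_capacity :: "'a set \<Rightarrow> 'a set \<Rightarrow> 'a set \<Rightarrow> nat"
  where "root_capacity K T E = card (iso_subfields K T E) * aut_number K E"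

definition (in ring) multiroot_capacity :: "'a set \<Rightarrow> 'a set \<Rightarrow> 'a set \<Rightarrow> nat"
  where "multiroot_capacity K T E = card (iso_subfields K T E) * multi_aut_number K E"

definition (in ring) intersection_indicium :: "'a set \<Rightarrow> 'a set \<Rightarrow> 'a set \<Rightarrow> nat"
  where "intersection_indicium K T E =
    (if iso_subfields K T E = {} then 0
     else (dim over K) (\<Inter>F\<in>iso_subfields K T E. max_separable K F))"

definition (in ring) intersection_normal_indicium :: "'a set \<Rightarrow> 'a set \<Rightarrow> 'a set \<Rightarrow> nat"
  where "intersection_normal_indicium K T E =
    (if iso_subfields K T E = {} then 0 else (dim over K) (\<Inter>(iso_subfields K T E)))"

definition (in ring) compositum_indicium :: "'a set \<Rightarrow> 'a set \<Rightarrow> 'a set \<Rightarrow> nat"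
  where "compositum_indicium K T E =
    (if iso_subfields K T E = {} then 0
     else (dim over K) (compositum (max_separable K ` iso_subfields K T E)))"

definition (in ring) compositum_normal_indicium :: "'a set \<Rightarrow> 'a set \<Rightarrow> 'a set \<Rightarrow> nat"
  where "compositum_normal_indicium K T E =
    (if iso_subfields K T E = {} then 0 else (dim over K) (compositum (iso_subfields K T E)))"

definition (in ring) inseparable_compositum_indicium :: "'a set \<Rightarrow> 'a set \<Rightarrow> 'a set \<Rightarrow> nat"
  where "inseparable_compositum_indicium K T E =
    (if iso_subfields K T E = {} then 0
     else (dim over K) (max_purely_inseparable K (compositum (iso_subfields K T E))))"

end

theory Submission
  imports Defs "HOL-Computational_Algebra.Primes"
begin

text \<open>
  Let \<open>N\<^sub>1\<close> and \<open>N\<^sub>2\<close> be the normal closures of \<open>M\<close> and \<open>J'\<close>. Since they are linearly disjoint, \<open>AB\<close>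
  behaves like the tensor product of \<open>A\<close> and \<open>B\<close> for \<open>A \<subseteq> N\<^sub>1\<close> and \<open>B \<subseteq> N\<^sub>2\<close>: degrees multiply, intersections
  are formed factorwise, and a pair of embeddings extends uniquely. Conversely an embedding of \<open>LJ\<close> into
  \<open>MJ'\<close> maps \<open>L\<close> into \<open>MJ' \<inter> N\<^sub>1 = M\<close> and \<open>J\<close> into \<open>MJ' \<inter> N\<^sub>2 = J'\<close>, because \<open>N\<^sub>1\<close> and \<open>N\<^sub>2\<close> are normal. Hence
  the conjugates of \<open>LJ\<close> in \<open>MJ'\<close> are exactly the products of those of \<open>L\<close> and \<open>J\<close>.

  It remains to split \<open>(AB)\<^sub>S\<close> and \<open>(AB)\<^sub>I\<close>. Some Frobenius power \<open>x\<^sup>q\<close> of \<open>x \<in> AB\<close> lies in \<open>A\<^sub>S B\<^sub>S\<close>, and a separable \<open>x\<close>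
  lies in \<open>K(x\<^sup>q)\<close>. For the inseparable part \<open>N = N\<^sub>S N\<^sub>I\<close> for normal \<open>N\<close> gives \<open>N\<^sub>1 N\<^sub>2 = S I\<close> with
  \<open>S = (N\<^sub>1)\<^sub>S (N\<^sub>2)\<^sub>S\<close> and \<open>I = (N\<^sub>1)\<^sub>I (N\<^sub>2)\<^sub>I\<close>; as separable and purely inseparable elements are linearly disjoint,
  \<open>(AB)\<^sub>I\<close> lies in \<open>AB \<inter> I = A\<^sub>I B\<^sub>I\<close>.
\<close>

section \<open>Composita as sums of products\<close>


text \<open>A priori an embedding of LJ into MJ' could move L out of M, but it cannot leave the
  normal closure; this is why disjointness is imposed on the normal closures. The ambient field is
  algebraic over \<open>K\<close>, so every ring above \<open>K\<close> is a field: a compositum is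
  just the set of sums of products, and its elements can be handled by linear algebra. The
  characteristic is left open: q stands for any exponent whose powers are additive, so q = 1 covers
  characteristic 0. The technical core is that q-th powers of \<open>K\<close>-independent separable
  elements stay independent. It yields that separable elements form a field, that they are linearly
  disjoint from the purely inseparable ones, and that \<open>N = N\<^sub>S N\<^sub>I\<close> for
  normal N. Powers settle the separable part of AB, but they push a purely inseparable element into
  \<open>K\<close> and so lose all information about it; hence the detour through the normal
  closures for the last quantity.\<close>

context ring
begin

lemma independent_mono:
  assumes "subfield K R" "subfield F R" "K \<subseteq> F" "independent F Us"
  shows "independent K Us"
  using trivial_combine_imp_independent[OF assms(1) independent_in_carrier[OF assms(4)]]
    independent_imp_trivial_combine[OF assms(2,4)] assms(3)
  by (meson order_trans)

lemma Span_mono_field: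
  assumes "subfield K R" "subfield F R" "K \<subseteq> F" "set Us \<subseteq> carrier R"
  shows "Span K Us \<subseteq> Span F Us"
  using Span_eq_combine_set[OF assms(1,4)] Span_eq_combine_set[OF assms(2,4)] assms(3) by blast

text \<open>Dependent vectors are dropped one at a time. The clause on equal lengths records that
  nothing was dropped; it turns a spanning list of the right length into a basis.\<close>

lemma Span_reduce:
  assumes K: "subfield K R" and "set Us \<subseteq> carrier R"
  shows "\<exists>Vs. independent K Vs \<and> Span K Vs = Span K Us \<and> length Vs \<le> length Us \<and>
    (length Vs = length Us \<longrightarrow> Vs = Us)"
  using assms(2)
proof (induction Us)
  case Nil
  show ?case by (rule exI[of _ "[]"]) simp
next
  case (Cons u Us)
  then obtain Vs where Vs: "independent K Vs" "Span K Vs = Span K Us" "length Vs \<le> length Us"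
      "length Vs = length Us \<longrightarrow> Vs = Us"
    by auto
  show ?case
  proof (cases "u \<in> Span K Us")
    case True
    then have "Span K (u # Us) = Span K Us"
      using mono_Span_subset[OF K, of "u # Us" Us] mono_Span[OF K, of Us u] Span_base_incl[OF K, of Us]
        Cons.prems by auto
    then show ?thesis using Vs by (intro exI[of _ Vs]) auto
  next
    case False
    then show ?thesis
      using Vs Cons.prems by (intro exI[of _ "u # Vs"]) (auto intro: li_Cons)
  qed
qed

lemma independent_of_spanning_length:
  assumes K: "subfield K R" and "set Us \<subseteq> carrier R" and "dimension (length Us) K (Span K Us)"
  shows "independent K Us"
proof -
  obtain Vs where Vs: "independent K Vs" "Span K Vs = Span K Us" "length Vs = length Us \<longrightarrow> Vs = Us"
    using Span_reduce[OF assms(1,2)] by blast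
  then have "length Vs = length Us"
    using dimension_is_inj[OF K dimensionI[OF K Vs(1,2)] assms(3)] by simp
  then show ?thesis using Vs by simp
qed

lemma subfield_is_subalgebra:
  assumes "subfield F R" "K \<subseteq> F"
  shows "subalgebra K F R"
  using assms subring.axioms(1)[OF subfieldE(1)[OF assms(1)]] subringE(6)[OF subfieldE(1)[OF assms(1)]]
  unfolding subalgebra_def subalgebra_axioms_def by auto

lemma Span_in_subfield:
  assumes "subfield K R" "subfield F R" "K \<subseteq> F" "set Us \<subseteq> F"
  shows "Span K Us \<subseteq> F"
  using subalgebra_Span_incl[OF assms(1) subfield_is_subalgebra[OF assms(2,3)] assms(4)] .

text \<open>Finite sums of products, built by one summand per step, so that statements reduce by
  induction to single products. For subrings of a commutative ring this is the ring that they
  generate.\<close>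

inductive_set prods :: "'a set \<Rightarrow> 'a set \<Rightarrow> 'a set" for A B where
  zero: "\<zero> \<in> prods A B"
| step: "\<lbrakk> a \<in> A; b \<in> B; z \<in> prods A B \<rbrakk> \<Longrightarrow> a \<otimes> b \<oplus> z \<in> prods A B"

lemma prods_mono: "A \<subseteq> A' \<Longrightarrow> B \<subseteq> B' \<Longrightarrow> prods A B \<subseteq> prods A' B'"
proof
  fix z assume s: "A \<subseteq> A'" "B \<subseteq> B'" and "z \<in> prods A B"
  from this(3) show "z \<in> prods A' B'"
    by induction (use s in \<open>auto intro: prods.intros\<close>)
qed

lemma prods_in_carrier:
  assumes "A \<subseteq> carrier R" "B \<subseteq> carrier R"
  shows "prods A B \<subseteq> carrier R"
proof
  fix z assume "z \<in> prods A B"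
  then show "z \<in> carrier R"
    by induction (use assms in auto)
qed

lemma prods_add:
  assumes "A \<subseteq> carrier R" "B \<subseteq> carrier R" "x \<in> prods A B" "y \<in> prods A B"
  shows "x \<oplus> y \<in> prods A B"
  using assms(3)
proof induction
  case zero
  then show ?case using assms(4) subsetD[OF prods_in_carrier[OF assms(1,2)] assms(4)] by simp
next
  case (step a b z)
  have "a \<in> carrier R" "b \<in> carrier R" "z \<in> carrier R" "y \<in> carrier R"
    using step assms prods_in_carrier by blast+
  then have "a \<otimes> b \<oplus> z \<oplus> y = a \<otimes> b \<oplus> (z \<oplus> y)" by (simp add: a_assoc)
  then show ?case using step by (simp add: prods.step)
qed

lemma prods_single:
  assumes "A \<subseteq> carrier R" "B \<subseteq> carrier R" "a \<in> A" "b \<in> B"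
  shows "a \<otimes> b \<in> prods A B"
  using prods.step[OF assms(3,4) prods.zero] r_zero m_closed subsetD[OF assms(1,3)] subsetD[OF assms(2,4)] by simp

lemma combine_in_prods:
  assumes "set as \<subseteq> A" "set bs \<subseteq> B"
  shows "combine as bs \<in> prods A B"
  using assms by (induction as bs rule: combine.induct) (auto intro: prods.intros)

lemma Span_in_prods:
  assumes "subfield K R" "set bs \<subseteq> carrier R" "set bs \<subseteq> B"
  shows "Span K bs \<subseteq> prods K B"
  using Span_eq_combine_set[OF assms(1,2)] combine_in_prods[OF _ assms(3)] by auto

lemma prods_subset_subring:
  assumes "subring S R" "A \<subseteq> S" "B \<subseteq> S"
  shows "prods A B \<subseteq> S"
proof
  fix z assume "z \<in> prods A B"
  then show "z \<in> S"
  proof induction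
    case (step a b z)
    then show ?case using assms(2,3) subringE(6,7)[OF assms(1)] by blast
  qed (rule subringE(2)[OF assms(1)])
qed

lemma prods_subset_Span:
  assumes "subfield A R" "set Us \<subseteq> carrier R" "B \<subseteq> Span A Us"
  shows "prods A B \<subseteq> Span A Us"
proof
  fix z assume "z \<in> prods A B"
  then show "z \<in> Span A Us"
  proof induction
    case zero
    then show ?case using Span_subgroup_props(2)[OF assms(1,2)] .
  next
    case (step a b z)
    then show ?case
      using Span_smult_closed[OF assms(1,2)] Span_subgroup_props(3)[OF assms(1,2)] assms(3) by auto
  qed
qed

text \<open>Extension of scalars from \<open>K\<close> to \<open>A\<close>: the degree of a
  compositum over one factor can be read off a list that spans the other factor over
  \<open>K\<close>.\<close>

lemma prods_eq_Span:
  assumes "subfield K R" "subfield A R" "K \<subseteq> A" "set Us \<subseteq> carrier R"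
  shows "prods A (Span K Us) = Span A Us"
proof
  show "prods A (Span K Us) \<subseteq> Span A Us"
    using prods_subset_Span[OF assms(2,4) Span_mono_field[OF assms]] .
  show "Span A Us \<subseteq> prods A (Span K Us)"
    using Span_in_prods[OF assms(2,4) Span_base_incl[OF assms(1,4)]] .
qed

text \<open>Linear disjointness says something only about \<open>K\<close>-independent lists, so an
  element of the compositum is first brought into a form with such a list. Each new \<open>b\<close>
  is added to the list, which is then thinned out to a basis of the same span and therefore stays
  inside \<open>B\<close>.\<close>

lemma prods_expansion:
  assumes "subfield K R" "subfield A R" "K \<subseteq> A" "subfield B R" "K \<subseteq> B" "z \<in> prods A B"
  obtains Us where "independent K Us" "set Us \<subseteq> B" "z \<in> Span A Us"
proof -
  have "\<exists>Us. independent K Us \<and> set Us \<subseteq> B \<and> z \<in> Span A Us"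
    using assms(6)
  proof induction
    case zero
    show ?case by (rule exI[of _ "[]"]) simp
  next
    case (step a b z)
    then obtain Us where Us: "independent K Us" "set Us \<subseteq> B" "z \<in> Span A Us" by auto
    have Bc: "B \<subseteq> carrier R" using subfieldE(3)[OF assms(4)] .
    have bU: "set (b # Us) \<subseteq> carrier R" "set Us \<subseteq> carrier R" using step Us Bc by auto
    obtain Vs where Vs: "set Vs \<subseteq> carrier R" "independent K Vs" "Span K Vs = Span K (b # Us)"
      using filter_base[OF assms(1) bU(1)] .
    have VB: "set Vs \<subseteq> B"
      using Span_base_incl[OF assms(1) Vs(1)] Vs(3) Span_in_subfield[OF assms(1,4,5), of "b # Us"] step Us
      by auto
    have inc: "set (b # Us) \<subseteq> Span A Vs"
      using Span_base_incl[OF assms(1) bU(1)] Vs(3) Span_mono_field[OF assms(1-3) Vs(1)] by auto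
    then have "z \<in> Span A Vs"
      using mono_Span_subset[OF assms(2) _ Vs(1), of Us] Us(3) by auto
    moreover have "a \<otimes> b \<in> Span A Vs"
      using Span_smult_closed[OF assms(2) Vs(1)] step(1) inc by auto
    ultimately show ?case
      using Span_subgroup_props(3)[OF assms(2) Vs(1)] Vs(2) VB by blast
  qed
  then show thesis using that by blast
qed

end

context cring
begin

lemma prods_commute:
  assumes "A \<subseteq> carrier R" "B \<subseteq> carrier R"
  shows "prods A B = prods B A"
proof -
  have "prods C D \<subseteq> prods D C" if "C \<subseteq> carrier R" "D \<subseteq> carrier R" for C D
  proof
    fix z assume "z \<in> prods C D"
    then show "z \<in> prods D C"
    proof induction
      case (step a b z)
      then have "a \<otimes> b = b \<otimes> a" using that m_comm by blast
      then show ?case using step by (simp add: prods.step)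
    qed (rule prods.zero)
  qed
  then show ?thesis using assms by blast
qed

lemma prods_is_subring:
  assumes "subring A R" "subring B R"
  shows "subring (prods A B) R"
proof (rule subringI)
  have c: "A \<subseteq> carrier R" "B \<subseteq> carrier R" using assms subringE(1) by auto
  note pc = subsetD[OF prods_in_carrier[OF c]]
  show "prods A B \<subseteq> carrier R" using prods_in_carrier[OF c] .
  show "\<one> \<in> prods A B"
    using prods_single[OF c, of \<one> \<one>] subringE(3) assms by auto
  have sm: "(a \<otimes> b) \<otimes> z \<in> prods A B" if "a \<in> A" "b \<in> B" "z \<in> prods A B" for a b z
    using that(3)
  proof induction
    case zero
    have "(a \<otimes> b) \<otimes> \<zero> = \<zero>" using subsetD[OF c(1) that(1)] subsetD[OF c(2) that(2)] by simp
    then show ?case by (simp add: prods.zero)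
  next
    case (step a' b' z)
    have "a \<in> carrier R" "b \<in> carrier R" "a' \<in> carrier R" "b' \<in> carrier R" "z \<in> carrier R"
      using that step c pc by auto
    then have eq: "(a \<otimes> b) \<otimes> (a' \<otimes> b' \<oplus> z) = (a \<otimes> a') \<otimes> (b \<otimes> b') \<oplus> (a \<otimes> b) \<otimes> z"
      by algebra
    have "a \<otimes> a' \<in> A" "b \<otimes> b' \<in> B"
      using subringE(6)[OF assms(1) that(1) step(1)] subringE(6)[OF assms(2) that(2) step(2)] by auto
    then show ?case unfolding eq using prods.step step.IH by blast
  qed
  show mult: "x \<otimes> y \<in> prods A B" if "x \<in> prods A B" "y \<in> prods A B" for x y
    using that(1)
  proof induction
    case zero
    have "\<zero> \<otimes> y = \<zero>" using pc[OF that(2)] by simp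
    then show ?case by (simp add: prods.zero)
  next
    case (step a b z)
    have "a \<in> carrier R" "b \<in> carrier R" "z \<in> carrier R" "y \<in> carrier R"
      using that step c pc by auto
    then have "(a \<otimes> b \<oplus> z) \<otimes> y = (a \<otimes> b) \<otimes> y \<oplus> z \<otimes> y" by algebra
    then show ?case using prods_add[OF c sm[OF step(1,2) that(2)] step.IH] by simp
  qed
  show "x \<oplus> y \<in> prods A B" if "x \<in> prods A B" "y \<in> prods A B" for x y
    using prods_add[OF c that] .
  show "\<ominus> x \<in> prods A B" if "x \<in> prods A B" for x
  proof -
    have "\<ominus> \<one> \<otimes> \<one> \<in> prods A B"
      using prods_single[OF c subringE(5)[OF assms(1) subringE(3)[OF assms(1)]] subringE(3)[OF assms(2)]] .
    then have "(\<ominus> \<one> \<otimes> \<one>) \<otimes> x \<in> prods A B" using mult that by blast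
    moreover have "(\<ominus> \<one> \<otimes> \<one>) \<otimes> x = \<ominus> x" using pc[OF that] by (simp add: l_minus)
    ultimately show ?thesis by simp
  qed
qed

lemma prods_incl:
  assumes "subring A R" "subring B R"
  shows "A \<subseteq> prods A B" "B \<subseteq> prods A B"
proof -
  have c: "A \<subseteq> carrier R" "B \<subseteq> carrier R" "\<one> \<in> A" "\<one> \<in> B" using assms subringE by auto
  show "A \<subseteq> prods A B" using prods_single[OF c(1,2) _ c(4)] c by force
  show "B \<subseteq> prods A B" using prods_single[OF c(1,2) c(3)] c by force
qed

end

section \<open>Composita inside an algebraic closure\<close>

context algebraic_closure
begin

text \<open>Each \<open>k\<close> is algebraic over \<open>K\<close>, so the ring generated by
  \<open>k\<close> over \<open>K\<close> is a field and already contains the inverse. Later closure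
  proofs therefore check ring operations only.\<close>

lemma subring_over_is_subfield:
  assumes "subring S L" "K \<subseteq> S"
  shows "subfield S L"
proof (rule subfieldI'[OF assms(1)])
  fix k assume k: "k \<in> S - {\<zero>}"
  then have kc: "k \<in> carrier L" using subringE(1)[OF assms(1)] by auto
  have sf: "subfield (simple_extension K k) L"
    using simple_extension_is_subfield[OF subfield_axioms kc] algebraic_extension[OF kc] by simp
  have "k \<in> simple_extension K k" using simple_extension_mem[OF subfieldE(1)[OF subfield_axioms] kc] .
  then have "inv k \<in> simple_extension K k"
    using subfield_m_inv(1)[OF sf] k by auto
  then show "inv k \<in> S"
    using simple_extension_subring_incl[OF assms(1,2)] k by auto
qed

lemma prods_is_subfield:
  assumes "subfield A L" "subfield B L" "K \<subseteq> A"
  shows "subfield (prods A B) L"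
  using subring_over_is_subfield[OF prods_is_subring[OF subfieldE(1)[OF assms(1)] subfieldE(1)[OF assms(2)]]]
    prods_incl(1)[OF subfieldE(1)[OF assms(1)] subfieldE(1)[OF assms(2)]] assms(3) by auto

lemma compositum_eq_prods:
  assumes "subfield A L" "subfield B L" "K \<subseteq> A"
  shows "compositum {A, B} = prods A B"
proof -
  have c: "\<Union>{A, B} \<subseteq> carrier L" using subfieldE(3) assms by auto
  have "prods A B = generate_field L (\<Union>{A, B})"
  proof (rule generate_fieldI[OF c prods_is_subfield[OF assms]])
    show "\<Union>{A, B} \<subseteq> prods A B" using prods_incl[OF subfieldE(1)[OF assms(1)] subfieldE(1)[OF assms(2)]] by auto
    fix F assume "subfield F L" "\<Union>{A, B} \<subseteq> F"
    then show "prods A B \<subseteq> F" using prods_subset_subring[OF subfieldE(1)] by auto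
  qed
  then show ?thesis unfolding compositum_def by simp
qed

end

section \<open>Linear disjointness\<close>


context algebraic_closure
begin

lemma finite_extension_props:
  assumes "set xs \<subseteq> carrier L"
  shows "subfield (finite_extension K xs) L" "K \<subseteq> finite_extension K xs"
    "set xs \<subseteq> finite_extension K xs" "finite_dimension K (finite_extension K xs)"
  using finite_extension_is_subfield[OF subfield_axioms assms] algebraic_extension assms
    finite_extension_incl[OF subfieldE(3)[OF subfield_axioms] assms]
    finite_extension_mem[OF subfieldE(1)[OF subfield_axioms] assms]
    finite_extension_finite_dimension(1)[OF subfield_axioms assms]
  by (auto simp del: finite_extension.simps)

text \<open>Both composita coincide, so comparing their degrees over \<open>K\<close> shows that a spanning list is a basis.\<close>
lemma linearly_disjoint_sym:
  assumes A: "subfield A L" "K \<subseteq> A" and B: "subfield B L" "K \<subseteq> B"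
    and ld: "linearly_disjoint K A B"
  shows "linearly_disjoint K B A"
  unfolding linearly_disjoint_def
proof (intro allI impI, elim conjE)
  fix us assume us: "set us \<subseteq> B" "(independent over K) us"
  note K = subfield_axioms
  have usc: "set us \<subseteq> carrier L" using us(1) subfieldE(3)[OF B(1)] by auto
  have "independent A us"
  proof (rule trivial_combine_imp_independent[OF A(1) usc])
    fix as assume as: "set as \<subseteq> A" "combine as us = \<zero>"
    have asc: "set as \<subseteq> carrier L" using as(1) subfieldE(3)[OF A(1)] by auto
    \<comment> \<open>One relation involves finitely many scalars, so degrees can be compared in
      K(as) and K(us), also when \<open>A\<close> and \<open>B\<close> have infinite degree over
      \<open>K\<close>.\<close>
    define V where "V = finite_extension K as"
    define W where "W = finite_extension K us"
    note Vp = finite_extension_props[OF asc, folded V_def]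
    note Wp = finite_extension_props[OF usc, folded W_def]
    have VA: "V \<subseteq> A" unfolding V_def
      using finite_extension_subring_incl[OF subfieldE(1)[OF A(1)] A(2) as(1)] .
    have WB: "W \<subseteq> B" unfolding W_def
      using finite_extension_subring_incl[OF subfieldE(1)[OF B(1)] B(2) us(1)] .
    obtain vs where vs: "independent K vs" "length vs = (dim over K) V" "Span K vs = V"
        "set vs \<subseteq> carrier L"
      using exists_base[OF K finite_dimensionE[OF K Vp(4)]] by blast
    have vsV: "set vs \<subseteq> V" using Span_base_incl[OF K vs(4)] vs(3) by simp
    \<comment> \<open>The degree count concerns whole bases, so \<open>us\<close> is completed to a
      basis of \<open>W\<close>.\<close>
    obtain ws where ws: "length (ws @ us) = (dim over K) W" "independent K (ws @ us)"
        "Span K (ws @ us) = W"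
      using complete_base[OF K finite_dimensionE[OF K Wp(4)], of us] us(2) Wp(3)
      unfolding over_def by blast
    have wusc: "set (ws @ us) \<subseteq> carrier L" using independent_in_carrier[OF ws(2)] .
    have "independent B vs" using ld vs(1) vsV VA unfolding linearly_disjoint_def over_def by blast
    then have iW: "independent W vs" using independent_mono[OF Wp(1) B(1) WB] by blast
    have eq: "Span W vs = Span V (ws @ us)"
    proof -
      have "Span W vs = prods W V"
        using prods_eq_Span[OF K Wp(1,2) vs(4)] vs(3) by simp
      also have "\<dots> = prods V W"
        using prods_commute subfieldE(3)[OF Wp(1)] subfieldE(3)[OF Vp(1)] by blast
      also have "\<dots> = Span V (ws @ us)"
        using prods_eq_Span[OF K Vp(1,2) wusc] ws(3) by simp
      finally show ?thesis .
    qed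
    have dW: "dimension ((dim over K) W) K W" and dV: "dimension ((dim over K) V) K V"
      using finite_dimensionE[OF K] Vp(4) Wp(4) by auto
    have d1: "dimension ((dim over K) W * length vs) K (Span W vs)"
      using telescopic_base[OF K Wp(1) dW dimensionI[OF Wp(1) iW refl]] .
    have fd: "finite_dimension V (Span V (ws @ us))"
      using Span_finite_dimension[OF Vp(1) wusc] .
    then obtain m where m: "dimension m V (Span V (ws @ us))" unfolding finite_dimension_def by blast
    have "dimension ((dim over K) V * m) K (Span V (ws @ us))"
      using telescopic_base[OF K Vp(1) dV m] .
    then have "(dim over K) W * length vs = (dim over K) V * m"
      using dimension_is_inj[OF K d1] eq by simp
    moreover have "(dim over K) V \<noteq> 0"
    proof
      assume "(dim over K) V = 0"
      then have "V = {\<zero>}" using dV dimension_zero[OF K] by metis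
      then show False using subringE(3)[OF subfieldE(1)[OF Vp(1)]] by simp
    qed
    ultimately have "m = length (ws @ us)" using vs(2) ws(1) by simp
    then have "independent V (ws @ us)"
      using independent_of_spanning_length[OF Vp(1) wusc] m by simp
    then have "independent V us" using independent_split(1)[OF Vp(1)] by blast
    then show "set (take (length us) as) \<subseteq> {\<zero>}"
      using independent_imp_trivial_combine[OF Vp(1)] as(2) Vp(3) by blast
  qed
  then show "(independent over A) us" unfolding over_def .
qed

text \<open>Coordinates over \<open>N1\<close> with respect to a \<open>K\<close>-independent list
  from \<open>N2\<close> are unique. An expansion of the same element over \<open>F\<close> may use
  another list, but both lists lie in the span of one common basis, where uniqueness forces the
  coordinates to agree. Membership in the compositum of \<open>F\<close> and \<open>N2\<close> can
  thus be read off coordinates.\<close>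

lemma linearly_disjoint_coords:
  assumes N2: "subfield N2 L" "K \<subseteq> N2" and N1: "subfield N1 L"
    and ld: "linearly_disjoint K N2 N1"
    and F: "subfield F L" "K \<subseteq> F" "F \<subseteq> N1"
    and us: "independent K us" "set us \<subseteq> N2"
    and ns: "set ns \<subseteq> N1" "length ns = length us"
    and z: "combine ns us \<in> prods F N2"
  shows "set ns \<subseteq> F"
proof -
  note K = subfield_axioms
  obtain ws where ws: "independent K ws" "set ws \<subseteq> N2" "combine ns us \<in> Span F ws"
    using prods_expansion[OF K F(1,2) N2 z] .
  have uwc: "set (us @ ws) \<subseteq> carrier L"
    using independent_in_carrier us(1) ws(1) by auto
  obtain m where m: "dimension m K (Span K (us @ ws))"
    using Span_finite_dimension[OF K uwc] unfolding finite_dimension_def by blast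
  have uin: "set us \<subseteq> Span K (us @ ws)" and win: "set ws \<subseteq> Span K (us @ ws)"
    using Span_base_incl[OF K uwc] by auto
  obtain vs where vs: "independent K (vs @ us)" "Span K (vs @ us) = Span K (us @ ws)"
    using complete_base[OF K m us(1) uin] by blast
  have vuc: "set (vs @ us) \<subseteq> carrier L" using independent_in_carrier[OF vs(1)] .
  have vN: "set (vs @ us) \<subseteq> N2"
    using Span_base_incl[OF K vuc] vs(2) Span_in_subfield[OF K N2, of "us @ ws"] us(2) ws(2) by auto
  have iN1: "independent N1 (vs @ us)"
    using ld vs(1) vN unfolding linearly_disjoint_def over_def by blast
  have "set ws \<subseteq> Span F (vs @ us)"
    using win vs(2) Span_mono_field[OF K F(1,2) vuc] by auto
  then have "combine ns us \<in> Span F (vs @ us)"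
    using mono_Span_subset[OF F(1) _ vuc] ws(3) by blast
  then obtain xs where xs: "set xs \<subseteq> F" "length xs = length (vs @ us)" "combine ns us = combine xs (vs @ us)"
    using Span_mem_iff_length_version[OF F(1) vuc] by blast
  \<comment> \<open>The coordinates \<open>ns\<close> are padded with zeros at the new basis vectors
    \<open>vs\<close>.\<close>
  define ys where "ys = replicate (length vs) \<zero> @ ns"
  have nsc: "set ns \<subseteq> carrier L" using ns(1) subfieldE(3)[OF N1] by auto
  have "combine ys (vs @ us) = combine (replicate (length vs) \<zero>) vs \<oplus> combine ns us"
    unfolding ys_def using combine_append[of "replicate (length vs) \<zero>" vs ns us] vuc nsc
    by (simp add: set_replicate_conv_if)
  then have ysc: "combine ys (vs @ us) = combine ns us"
    using combine_replicate[of vs] vuc nsc by auto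
  have ys: "set ys \<subseteq> N1" "length ys = length (vs @ us)"
    unfolding ys_def using ns subringE(2)[OF subfieldE(1)[OF N1]] by auto
  have "combine ys (vs @ us) \<in> Span N1 (vs @ us)"
    using Span_mem_iff_length_version[OF N1 vuc] ys by blast
  then have "ys = xs"
    using unique_decomposition[OF N1 iN1] ys xs F(3) ysc by (metis (no_types, lifting) order_trans)
  then show ?thesis using xs(1) unfolding ys_def by auto
qed

end

locale ld_fields = algebraic_closure +
  fixes N1 N2
  assumes N1: "subfield N1 L" "K \<subseteq> N1" and N2: "subfield N2 L" "K \<subseteq> N2"
    and ld: "linearly_disjoint K N1 N2"
begin

lemma ld': "linearly_disjoint K N2 N1"
  using linearly_disjoint_sym[OF N1 N2 ld] .

lemma swapped: "ld_fields L K N2 N1"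
  by (intro ld_fields.intro ld_fields_axioms.intro algebraic_closure_axioms N1 N2 ld')

text \<open>One coordinate vector of \<open>z\<close> over a \<open>K\<close>-independent list from
  \<open>B\<close> serves all indices, so its entries lie in every \<open>A i\<close> at once. The
  hypothesis has \<open>N2\<close> in place of a field depending on \<open>i\<close>, so that the
  two factors can be treated one after the other.\<close>

lemma Inter_prods_subset_left:
  assumes A: "\<And>i. i \<in> I \<Longrightarrow> subfield (A i) L \<and> K \<subseteq> A i \<and> A i \<subseteq> N1" and "I \<noteq> {}"
    and z: "z \<in> prods N1 B" "\<And>i. i \<in> I \<Longrightarrow> z \<in> prods (A i) N2"
    and B: "subfield B L" "K \<subseteq> B" "B \<subseteq> N2"
  shows "z \<in> prods (\<Inter>i\<in>I. A i) B"
proof -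
  obtain us where us: "independent K us" "set us \<subseteq> B" "z \<in> Span N1 us"
    using prods_expansion[OF subfield_axioms N1 B(1,2) z(1)] .
  obtain ns where ns: "set ns \<subseteq> N1" "length ns = length us" "z = combine ns us"
    using us Span_mem_iff_length_version[OF N1(1) independent_in_carrier[OF us(1)]] by blast
  have "set ns \<subseteq> A i" if "i \<in> I" for i
    by (rule linearly_disjoint_coords[OF N2 N1(1) ld' _ _ _ us(1) _ ns(1,2)])
      (use A[OF that] z(2)[OF that] us(2) B(3) ns(3) in auto)
  then have "set ns \<subseteq> (\<Inter>i\<in>I. A i)" by blast
  then show ?thesis using combine_in_prods[OF _ us(2)] ns(3) by blast
qed

lemma Inter_prods:
  assumes A: "\<And>i. i \<in> I \<Longrightarrow> subfield (A i) L \<and> K \<subseteq> A i \<and> A i \<subseteq> N1"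
    and B: "\<And>i. i \<in> I \<Longrightarrow> subfield (B i) L \<and> K \<subseteq> B i \<and> B i \<subseteq> N2" and "I \<noteq> {}"
  shows "(\<Inter>i\<in>I. prods (A i) (B i)) = prods (\<Inter>i\<in>I. A i) (\<Inter>i\<in>I. B i)"
proof
  show "prods (\<Inter>i\<in>I. A i) (\<Inter>i\<in>I. B i) \<subseteq> (\<Inter>i\<in>I. prods (A i) (B i))"
    by (intro INT_greatest prods_mono INT_lower)
  show "(\<Inter>i\<in>I. prods (A i) (B i)) \<subseteq> prods (\<Inter>i\<in>I. A i) (\<Inter>i\<in>I. B i)"
  proof
    fix z assume z: "z \<in> (\<Inter>i\<in>I. prods (A i) (B i))"
    interpret sw: ld_fields L K N2 N1 using swapped .
    have Ac: "A i \<subseteq> carrier L" and Bc: "B i \<subseteq> carrier L" if "i \<in> I" for i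
      using A[OF that] B[OF that] subfieldE(3) by blast+
    have Nc: "N1 \<subseteq> carrier L" "N2 \<subseteq> carrier L" using subfieldE(3) N1 N2 by auto
    have zA: "z \<in> prods (A i) N2" and zB: "z \<in> prods N1 (B i)" if "i \<in> I" for i
      using z that prods_mono[of "A i" "A i" "B i" N2] prods_mono[of "A i" N1 "B i" "B i"] A[OF that] B[OF that]
      by auto
    obtain i where i: "i \<in> I" using assms(3) by blast
    have "z \<in> prods N2 N1" using zA[OF i] prods_mono[of "A i" N1 N2 N2] A[OF i] prods_commute[OF Nc] by auto
    moreover have "z \<in> prods (B j) N1" if "j \<in> I" for j
      using zB[OF that] prods_commute[OF Nc(1) Bc[OF that]] by simp
    \<comment> \<open>The right factor is intersected first, with the two sides swapped and the left
      factor enlarged to \<open>N1\<close>; the result is the input for intersecting the left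
      factor.\<close>
    ultimately have "z \<in> prods (\<Inter>i\<in>I. B i) N1"
      using sw.Inter_prods_subset_left[of I B z N1] B assms(3) N1 by blast
    moreover have sB: "subfield (\<Inter>i\<in>I. B i) L" "K \<subseteq> (\<Inter>i\<in>I. B i)" "(\<Inter>i\<in>I. B i) \<subseteq> N2"
    proof -
      have "subring (\<Inter>(B ` I)) L"
        by (rule subring_Inter) (use B subfieldE(1) assms(3) in blast)+
      then show "subfield (\<Inter>i\<in>I. B i) L" using subring_over_is_subfield B by blast
      show "K \<subseteq> (\<Inter>i\<in>I. B i)" using B by blast
      show "(\<Inter>i\<in>I. B i) \<subseteq> N2" using B assms(3) by blast
    qed
    ultimately have "z \<in> prods N1 (\<Inter>i\<in>I. B i)"
      using prods_commute[OF subfieldE(3)[OF sB(1)] Nc(1)] by simp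
    then show "z \<in> prods (\<Inter>i\<in>I. A i) (\<Inter>i\<in>I. B i)"
      using Inter_prods_subset_left[of I A z "\<Inter>i\<in>I. B i"] A assms(3) zA sB by blast
  qed
qed

lemma Int_prods:
  assumes "subfield A L" "K \<subseteq> A" "A \<subseteq> N1" "subfield A' L" "K \<subseteq> A'" "A' \<subseteq> N1"
    and "subfield B L" "K \<subseteq> B" "B \<subseteq> N2" "subfield B' L" "K \<subseteq> B'" "B' \<subseteq> N2"
  shows "prods A B \<inter> prods A' B' = prods (A \<inter> A') (B \<inter> B')"
  using Inter_prods[of "UNIV :: bool set" "\<lambda>b. if b then A else A'" "\<lambda>b. if b then B else B'"] assms
  by (simp add: UNIV_bool Int_commute)

lemma prods_K:
  assumes "subfield A L" "K \<subseteq> A"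
  shows "prods A K = A" "prods K A = A"
proof -
  show "prods A K = A"
    using prods_incl(1)[OF subfieldE(1)[OF assms(1)] subfieldE(1)[OF subfield_axioms]]
      prods_subset_subring[OF subfieldE(1)[OF assms(1)] _ assms(2), of A] by auto
  then show "prods K A = A"
    using prods_commute[OF subfieldE(3)[OF assms(1)] subfieldE(3)[OF subfield_axioms]] by simp
qed

text \<open>\<open>N1\<close> is the compositum of \<open>N1\<close> and \<open>K\<close>, so the
  factorwise intersection consists of \<open>A\<close> and of \<open>B \<inter> K\<close>, which is
  \<open>K\<close>. A compositum thus determines its two factors.\<close>

lemma prods_Int_left:
  assumes "subfield A L" "K \<subseteq> A" "A \<subseteq> N1" "subfield B L" "K \<subseteq> B" "B \<subseteq> N2"
  shows "prods A B \<inter> N1 = A" "prods A B \<inter> N2 = B"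
proof -
  have K: "K \<subseteq> N1" "K \<subseteq> N2" using N1 N2 by auto
  show "prods A B \<inter> N1 = A"
    using Int_prods[OF assms(1-3) N1 subset_refl assms(4-6) subfield_axioms subset_refl K(2)]
      prods_K(1)[OF N1] prods_K(1)[OF assms(1,2)] assms(3,5) by (simp add: Int_absorb1 Int_absorb2)
  show "prods A B \<inter> N2 = B"
    using Int_prods[OF assms(1-3) subfield_axioms subset_refl K(1) assms(4-6) N2 subset_refl]
      prods_K(2)[OF N2] prods_K(2)[OF assms(4,5)] assms(2,6) by (simp add: Int_absorb1 Int_absorb2)
qed

text \<open>A \<open>K\<close>-basis of \<open>B\<close> stays independent over \<open>N1\<close>,
  hence over \<open>A\<close>, and so is an \<open>A\<close>-basis of the compositum; the tower law
  does the rest.\<close>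

lemma prods_dim:
  assumes A: "subfield A L" "K \<subseteq> A" "A \<subseteq> N1" "finite_dimension K A"
    and B: "subfield B L" "K \<subseteq> B" "B \<subseteq> N2" "finite_dimension K B"
  shows "finite_dimension K (prods A B)" "(dim over K) (prods A B) = (dim over K) A * (dim over K) B"
proof -
  note K = subfield_axioms
  obtain us where us: "set us \<subseteq> carrier L" "independent K us" "length us = (dim over K) B" "Span K us = B"
    using exists_base[OF K finite_dimensionE[OF K B(4)]] by blast
  have "set us \<subseteq> N2" using Span_base_incl[OF K us(1)] us(4) B(3) by auto
  then have "independent N1 us" using ld' us(2) unfolding linearly_disjoint_def over_def by blast
  then have "independent A us" using independent_mono[OF A(1) N1(1) A(3)] by blast
  then have d: "dimension ((dim over K) B) A (prods A B)"
    using dimension_independent[of A us] prods_eq_Span[OF K A(1,2) us(1)] us(3,4) by simp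
  have "dimension ((dim over K) A * (dim over K) B) K (prods A B)"
    using telescopic_base[OF K A(1) finite_dimensionE[OF K A(4)] d] .
  then show "finite_dimension K (prods A B)" "(dim over K) (prods A B) = (dim over K) A * (dim over K) B"
    using finite_dimensionI dimI[OF K] by auto
qed

end

section \<open>Frobenius exponents and derivatives\<close>


text \<open>Stands for the powers of the characteristic exponent. In a field of characteristic 0 the
  case x = y = 1 leaves only \<open>q = 1\<close>, so one argument covers all
  characteristics.\<close>

definition (in ring) frobenius_exponent :: "nat \<Rightarrow> bool"
  where "frobenius_exponent q \<longleftrightarrow> q > 0 \<and>
    (\<forall>x\<in>carrier R. \<forall>y\<in>carrier R. (x \<oplus> y) [^] q = x [^] q \<oplus> y [^] q)"

lemma (in cring) binomial:
  assumes "x \<in> carrier R" "y \<in> carrier R"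
  shows "(x \<oplus> y) [^] n = (\<Oplus>k\<in>{..n}. [(n choose k)] \<cdot> (x [^] k \<otimes> y [^] (n - k)))"
proof (induction n)
  case 0
  then show ?case by simp
next
  case (Suc n)
  define a b c where "a k = [(n choose k)] \<cdot> (x [^] Suc k \<otimes> y [^] (n - k))"
    and "b k = [(n choose k)] \<cdot> (x [^] k \<otimes> y [^] (Suc n - k))"
    and "c k = [(Suc n choose k)] \<cdot> (x [^] k \<otimes> y [^] (Suc n - k))" for k
  define t where "t k = [(n choose k)] \<cdot> (x [^] k \<otimes> y [^] (n - k))" for k
  have cl: "a k \<in> carrier R" "b k \<in> carrier R" "c k \<in> carrier R" "t k \<in> carrier R" for k
    unfolding a_def b_def c_def t_def using assms by auto
  have tx: "t k \<otimes> x = a k" for k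
  proof -
    have "t k \<otimes> x = [(n choose k)] \<cdot> ((x [^] k \<otimes> y [^] (n - k)) \<otimes> x)"
      unfolding t_def using assms by (simp add: add_pow_ldistr)
    also have "(x [^] k \<otimes> y [^] (n - k)) \<otimes> x = x [^] Suc k \<otimes> y [^] (n - k)"
      using assms by (simp add: m_ac)
    finally show ?thesis unfolding a_def .
  qed
  have ty: "t k \<otimes> y = b k" if "k \<le> n" for k
  proof -
    have "t k \<otimes> y = [(n choose k)] \<cdot> ((x [^] k \<otimes> y [^] (n - k)) \<otimes> y)"
      unfolding t_def using assms by (simp add: add_pow_ldistr)
    also have "(x [^] k \<otimes> y [^] (n - k)) \<otimes> y = x [^] k \<otimes> y [^] (Suc n - k)"
      using assms that by (simp add: m_assoc Suc_diff_le)
    finally show ?thesis unfolding b_def .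
  qed
  have "(x \<oplus> y) [^] Suc n = (\<Oplus>k\<in>{..n}. t k) \<otimes> (x \<oplus> y)"
    using Suc.IH unfolding t_def by simp
  also have "\<dots> = (\<Oplus>k\<in>{..n}. t k) \<otimes> x \<oplus> (\<Oplus>k\<in>{..n}. t k) \<otimes> y"
    using assms cl by (simp add: r_distr)
  also have "(\<Oplus>k\<in>{..n}. t k) \<otimes> x = (\<Oplus>k\<in>{..n}. a k)"
    using finsum_ldistr[of "{..n}" x t] assms cl tx by simp
  also have "(\<Oplus>k\<in>{..n}. t k) \<otimes> y = (\<Oplus>k\<in>{..n}. b k)"
    using finsum_ldistr[of "{..n}" y t] assms cl ty
    by (auto intro!: finsum_cong')
  \<comment> \<open>The added summand is 0 because n choose n + 1 is 0; with it the second sum can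
    be shifted by one and meets the first in Pascal's rule.\<close>
  also have "(\<Oplus>k\<in>{..n}. b k) = (\<Oplus>k\<in>{..Suc n}. b k)"
  proof -
    have "b (Suc n) = \<zero>" unfolding b_def using assms by (simp add: binomial_eq_0)
    then show ?thesis using cl finsum_Suc[of b n] by simp
  qed
  also have "\<dots> = (\<Oplus>k\<in>{..n}. b (Suc k)) \<oplus> b 0"
    using finsum_Suc2[of b n] cl by simp
  also have "(\<Oplus>k\<in>{..n}. a k) \<oplus> ((\<Oplus>k\<in>{..n}. b (Suc k)) \<oplus> b 0)
      = (\<Oplus>k\<in>{..n}. a k \<oplus> b (Suc k)) \<oplus> b 0"
    using cl by (simp add: finsum_addf a_assoc)
  also have "(\<Oplus>k\<in>{..n}. a k \<oplus> b (Suc k)) = (\<Oplus>k\<in>{..n}. c (Suc k))"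
  proof (rule finsum_cong')
    fix k
    have "a k \<oplus> b (Suc k) = [((n choose k) + (n choose Suc k))] \<cdot> (x [^] Suc k \<otimes> y [^] (n - k))"
      unfolding a_def b_def using assms by (simp add: add.nat_pow_mult)
    then show "a k \<oplus> b (Suc k) = c (Suc k)" unfolding c_def by simp
  qed (use cl in auto)
  also have "b 0 = c 0" unfolding b_def c_def by simp
  also have "(\<Oplus>k\<in>{..n}. c (Suc k)) \<oplus> c 0 = (\<Oplus>k\<in>{..Suc n}. c k)"
    using finsum_Suc2[of c n] cl by simp
  finally show ?case unfolding c_def .
qed

text \<open>The least positive annihilator \<open>p\<close> of 1 divides all others and is prime
  because there are no zero divisors. The clause on arbitrary \<open>c\<close> is made for the
  coefficients of a polynomial whose derivative vanishes.\<close>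

lemma (in domain) additive_order_prime:
  assumes "n > 0" "[(n::nat)] \<cdot> \<one> = \<zero>"
  obtains p :: nat where "Factorial_Ring.prime p" "\<And>i :: nat. \<And>c. \<lbrakk> c \<in> carrier R; [i] \<cdot> c = \<zero> \<rbrakk> \<Longrightarrow> c = \<zero> \<or> p dvd i"
    "[p] \<cdot> \<one> = \<zero>"
proof -
  define p where "p = (LEAST m::nat. m > 0 \<and> [m] \<cdot> \<one> = \<zero>)"
  have p: "p > 0" "[p] \<cdot> \<one> = \<zero>"
    using LeastI[of "\<lambda>m::nat. m > 0 \<and> [m] \<cdot> \<one> = \<zero>" n] assms unfolding p_def by auto
  have least: "p \<le> m" if "m > 0" "[m] \<cdot> \<one> = \<zero>" for m
    using Least_le[of "\<lambda>m::nat. m > 0 \<and> [m] \<cdot> \<one> = \<zero>" m] that unfolding p_def by auto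
  have mult: "[(i * j)] \<cdot> \<one> = ([i] \<cdot> \<one>) \<otimes> ([j] \<cdot> \<one>)" for i j :: nat
    by (simp add: add_pow_ldistr add.nat_pow_pow mult.commute)
  have dvd: "p dvd i" if "[i] \<cdot> \<one> = \<zero>" for i :: nat
  proof -
    have "\<zero> = [(p * (i div p) + i mod p)] \<cdot> \<one>" using that by simp
    also have "\<dots> = [(p * (i div p))] \<cdot> \<one> \<oplus> [(i mod p)] \<cdot> \<one>"
      by (simp only: add.nat_pow_mult one_closed)
    also have "\<dots> = [(i mod p)] \<cdot> \<one>" unfolding mult p(2) by simp
    finally have "[(i mod p)] \<cdot> \<one> = \<zero>" by simp
    then have "i mod p = 0" using least[of "i mod p"] p(1) mod_less_divisor[of p i] by linarith
    then show ?thesis by auto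
  qed
  have p1: "p \<noteq> 1" using p(2) by auto
  have "Factorial_Ring.prime p"
  proof (rule prime_natI)
    show "p \<ge> 2" using p(1) p1 by linarith
    fix i j assume "p dvd i * j"
    then obtain k where "i * j = p * k" by auto
    then have "([i] \<cdot> \<one>) \<otimes> ([j] \<cdot> \<one>) = \<zero>" using mult[of i j] mult[of p k] p(2) by simp
    then have "[i] \<cdot> \<one> = \<zero> \<or> [j] \<cdot> \<one> = \<zero>" using integral by auto
    then show "p dvd i \<or> p dvd j" using dvd by blast
  qed
  moreover have "c = \<zero> \<or> p dvd i" if "c \<in> carrier R" "[i] \<cdot> c = \<zero>" for i :: nat and c
  proof -
    have "([i] \<cdot> \<one>) \<otimes> c = \<zero>" using that by (simp add: add_pow_ldistr)
    then show ?thesis using integral[of "[i] \<cdot> \<one>" c] that dvd by auto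
  qed
  ultimately show thesis using that p(2) by blast
qed

lemma (in cring) frobenius_exponent_prime:
  assumes "Factorial_Ring.prime p" "[(p::nat)] \<cdot> \<one> = \<zero>"
  shows "frobenius_exponent p"
  unfolding frobenius_exponent_def
proof (intro conjI ballI)
  show "p > 0" using prime_gt_0_nat assms by blast
  fix x y assume xy: "x \<in> carrier R" "y \<in> carrier R"
  define t where "t k = [(p choose k)] \<cdot> (x [^] k \<otimes> y [^] (p - k))" for k
  have tc: "t k \<in> carrier R" for k unfolding t_def using xy by auto
  have t0: "t k = \<zero>" if "k \<in> {..p} - {0, p}" for k
  proof -
    have "p dvd (p choose k)" using dvd_choose_prime[of k p] assms(1) that by auto
    then obtain m where m: "p choose k = p * m" by auto
    have "[(p * m)] \<cdot> z = \<zero>" if z: "z \<in> carrier R" for z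
    proof -
      have "[(p * m)] \<cdot> z = [m] \<cdot> ([p] \<cdot> (\<one> \<otimes> z))" using z by (simp add: add.nat_pow_pow)
      also have "[p] \<cdot> (\<one> \<otimes> z) = ([p] \<cdot> \<one>) \<otimes> z" using z add_pow_ldistr[of \<one> z p] by simp
      finally show ?thesis using assms(2) z by simp
    qed
    then show ?thesis unfolding t_def m using xy by simp
  qed
  have "(x \<oplus> y) [^] p = (\<Oplus>k\<in>{..p}. t k)" unfolding t_def by (rule binomial[OF xy])
  also have "\<dots> = (\<Oplus>k\<in>{0, p}. t k)"
    by (rule add.finprod_mono_neutral_cong_right) (use tc t0 in auto)
  also have "\<dots> = t 0 \<oplus> t p" using \<open>p > 0\<close> tc by simp
  also have "\<dots> = x [^] p \<oplus> y [^] p" unfolding t_def using xy by (simp add: a_comm)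
  finally show "(x \<oplus> y) [^] p = x [^] p \<oplus> y [^] p" .
qed

lemma (in cring) frobenius_exponent_1: "frobenius_exponent 1"
  unfolding frobenius_exponent_def by simp

lemma (in cring) frobenius_exponent_mult:
  assumes "frobenius_exponent q" "frobenius_exponent r"
  shows "frobenius_exponent (q * r)"
  using assms unfolding frobenius_exponent_def by (auto simp flip: nat_pow_pow)

lemma (in domain) frobenius_hom:
  assumes "frobenius_exponent q"
  shows "ring_hom_ring R R (\<lambda>x. x [^] q)"
  by (rule ring_hom_ringI2[OF ring_axioms ring_axioms])
    (use assms in \<open>auto intro!: ring_hom_memI simp: frobenius_exponent_def nat_pow_distrib\<close>)

lemma (in field) frobenius_inj:
  assumes "frobenius_exponent q"
  shows "inj_on (\<lambda>x. x [^] q) (carrier R)"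
  using ring_hom_ring.img_is_subfield(1)[OF frobenius_hom[OF assms] carrier_is_subfield] by simp

section \<open>Formal derivatives of coefficient lists\<close>

context ring
begin

text \<open>Lists start with the leading coefficient, so the exponent of the head is the length of
  the tail. The result is not normalised: in positive characteristic it may start with zeros, and a
  nonempty list always becomes shorter by exactly one.\<close>

fun deriv :: "'a list \<Rightarrow> 'a list" where
  "deriv [] = []"
| "deriv (c # p) = (if p = [] then [] else ([(length p)] \<cdot> c) # deriv p)"

lemma length_deriv: "length (deriv p) = length p - 1"
  by (induction p) auto

lemma deriv_in_carrier: "set p \<subseteq> carrier R \<Longrightarrow> set (deriv p) \<subseteq> carrier R"
  by (induction p) auto

lemma deriv_in_subring:
  assumes "subring S R"
  shows "set p \<subseteq> S \<Longrightarrow> set (deriv p) \<subseteq> S"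
proof (induction p)
  case (Cons c p)
  have "[n] \<cdot> c \<in> S" for n :: nat
    by (induction n) (use Cons.prems subringE(2,7)[OF assms] in auto)
  then show ?case using Cons by auto
qed simp

lemma eval_deriv_Cons:
  assumes "set (c # p) \<subseteq> carrier R" "t \<in> carrier R"
  shows "eval (deriv (c # p)) t = ([(length p)] \<cdot> c) \<otimes> t [^] (length p - 1) \<oplus> eval (deriv p) t"
  using assms by (auto simp: length_deriv)

lemma eval_deriv_closed:
  "set p \<subseteq> carrier R \<Longrightarrow> t \<in> carrier R \<Longrightarrow> eval (deriv p) t \<in> carrier R"
  using eval_in_carrier deriv_in_carrier by blast

lemma eval_deriv_replicate:
  assumes "set p \<subseteq> carrier R" "t \<in> carrier R"
  shows "eval (deriv (replicate n \<zero> @ p)) t = eval (deriv p) t"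
proof (induction n)
  case (Suc n)
  have "set (\<zero> # replicate n \<zero> @ p) \<subseteq> carrier R" using assms by (auto simp: set_replicate_conv_if)
  then have "eval (deriv (\<zero> # replicate n \<zero> @ p)) t =
      ([(length (replicate n \<zero> @ p))] \<cdot> \<zero>) \<otimes> t [^] (length (replicate n \<zero> @ p) - 1)
      \<oplus> eval (deriv (replicate n \<zero> @ p)) t"
    using eval_deriv_Cons[OF _ assms(2)] by blast
  then show ?case using Suc eval_deriv_closed[OF assms] assms by simp
qed simp

text \<open>Stripping leading zeros may change the derivative as a list but not its values. As
  \<open>poly_add\<close> normalises its result, the rules for the derivative compare values at a
  point.\<close>

lemma eval_deriv_normalize:
  assumes "set p \<subseteq> carrier R" "t \<in> carrier R"
  shows "eval (deriv (normalize p)) t = eval (deriv p) t"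
  using eval_deriv_replicate[OF normalize_in_carrier[OF assms(1)] assms(2)] normalize_trick[of p] by metis

lemma eval_deriv_map2:
  assumes "length p = length q" "set p \<subseteq> carrier R" "set q \<subseteq> carrier R" "t \<in> carrier R"
  shows "eval (deriv (map2 (\<oplus>) p q)) t = eval (deriv p) t \<oplus> eval (deriv q) t"
  using assms(1-3)
proof (induction p q rule: list_induct2)
  case (Cons c p d q)
  have s: "set (map2 (\<oplus>) p q) \<subseteq> carrier R"
    using Cons.prems by (induction p q rule: list_induct2') auto
  have cl: "eval (deriv p) t \<in> carrier R" "eval (deriv q) t \<in> carrier R" "c \<in> carrier R" "d \<in> carrier R"
    using eval_deriv_closed assms(4) Cons.prems by auto
  define m where "m = t [^] (length q - 1)"
  have m: "m \<in> carrier R" unfolding m_def using assms by auto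
  have "eval (deriv (map2 (\<oplus>) (c # p) (d # q))) t
      = ([(length q)] \<cdot> (c \<oplus> d)) \<otimes> m \<oplus> eval (deriv (map2 (\<oplus>) p q)) t"
    using eval_deriv_Cons[of "c \<oplus> d" "map2 (\<oplus>) p q" t] s cl assms(4) Cons.hyps unfolding m_def by simp
  also have "\<dots> = (([(length q)] \<cdot> c) \<otimes> m \<oplus> ([(length q)] \<cdot> d) \<otimes> m) \<oplus> (eval (deriv p) t \<oplus> eval (deriv q) t)"
    using Cons cl m by (simp add: add.nat_pow_distrib l_distr)
  also have "\<dots> = (([(length q)] \<cdot> c) \<otimes> m \<oplus> eval (deriv p) t) \<oplus> (([(length q)] \<cdot> d) \<otimes> m \<oplus> eval (deriv q) t)"
    using cl m by (simp add: a_ac)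
  also have "\<dots> = eval (deriv (c # p)) t \<oplus> eval (deriv (d # q)) t"
    using eval_deriv_Cons[of c p t] eval_deriv_Cons[of d q t] Cons.prems Cons.hyps assms(4)
    unfolding m_def by simp
  finally show ?case .
qed simp

lemma eval_deriv_poly_add:
  assumes "set p \<subseteq> carrier R" "set q \<subseteq> carrier R" "t \<in> carrier R"
  shows "eval (deriv (poly_add p q)) t = eval (deriv p) t \<oplus> eval (deriv q) t"
proof -
  have main: "eval (deriv (poly_add p q)) t = eval (deriv p) t \<oplus> eval (deriv q) t"
    if "set p \<subseteq> carrier R" "set q \<subseteq> carrier R" "length q \<le> length p" for p q
  proof -
    define q' where "q' = replicate (length p - length q) \<zero> @ q"
    have q': "length p = length q'" "set q' \<subseteq> carrier R"
      unfolding q'_def using that by (auto simp: set_replicate_conv_if)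
    have s: "set (map2 (\<oplus>) p q') \<subseteq> carrier R"
      using that(1) q'(2) by (induction p q' rule: list_induct2') auto
    have "eval (deriv (poly_add p q)) t = eval (deriv (map2 (\<oplus>) p q')) t"
      using eval_deriv_normalize[OF s assms(3)] that(3) unfolding q'_def by simp
    also have "\<dots> = eval (deriv p) t \<oplus> eval (deriv q') t"
      using eval_deriv_map2[OF q'(1) that(1) q'(2) assms(3)] .
    finally show ?thesis unfolding q'_def using eval_deriv_replicate[OF that(2) assms(3)] by simp
  qed
  show ?thesis
  proof (cases "length q \<le> length p")
    case True
    then show ?thesis using main assms by blast
  next
    case False
    then have "eval (deriv (poly_add q p)) t = eval (deriv q) t \<oplus> eval (deriv p) t"
      using main[of q p] assms by simp
    then show ?thesis
      using poly_add_comm[OF assms(1,2)] a_comm eval_deriv_closed assms by simp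
  qed
qed

text \<open>Appending a zero multiplies by X, so this is the product rule for X p.\<close>

lemma eval_deriv_append_zero:
  assumes "set p \<subseteq> carrier R" "t \<in> carrier R"
  shows "eval (deriv (p @ [\<zero>])) t = eval (deriv p) t \<otimes> t \<oplus> eval p t"
  using assms(1)
proof (induction p)
  case (Cons c p)
  have cl: "eval (deriv p) t \<in> carrier R" "eval p t \<in> carrier R" "c \<in> carrier R"
    using eval_deriv_closed eval_in_carrier assms(2) Cons.prems by auto
  define m where "m = t [^] length p"
  have m: "m \<in> carrier R" unfolding m_def using assms by auto
  have "eval (deriv ((c # p) @ [\<zero>])) t = ([(length p + 1)] \<cdot> c) \<otimes> m \<oplus> eval (deriv (p @ [\<zero>])) t"
    using eval_deriv_Cons[of c "p @ [\<zero>]" t] Cons.prems assms(2) unfolding m_def by simp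
  also have "\<dots> = ([(length p)] \<cdot> c \<oplus> c) \<otimes> m \<oplus> (eval (deriv p) t \<otimes> t \<oplus> eval p t)"
    using Cons cl by simp
  also have "\<dots> = (([(length p)] \<cdot> c) \<otimes> m \<oplus> eval (deriv p) t \<otimes> t) \<oplus> (c \<otimes> m \<oplus> eval p t)"
    using cl m assms(2) by (simp add: l_distr a_ac)
  also have "([(length p)] \<cdot> c) \<otimes> m = (([(length p)] \<cdot> c) \<otimes> t [^] (length p - 1)) \<otimes> t"
    using cl assms(2) unfolding m_def by (cases p) (auto simp: m_assoc)
  also have "\<dots> \<oplus> eval (deriv p) t \<otimes> t = eval (deriv (c # p)) t \<otimes> t"
    using eval_deriv_Cons[of c p t] Cons.prems assms(2) cl by (simp add: l_distr)
  also have "c \<otimes> m \<oplus> eval p t = eval (c # p) t" unfolding m_def by simp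
  finally show ?case .
qed (use assms in simp)

end

context cring
begin

lemma eval_map_smult:
  assumes "set p \<subseteq> carrier R" "a \<in> carrier R" "t \<in> carrier R"
  shows "eval (map ((\<otimes>) a) p) t = a \<otimes> eval p t"
  using assms(1)
proof (induction p)
  case (Cons c p)
  have "eval p t \<in> carrier R" using Cons.prems assms(3) eval_in_carrier by simp
  then show ?case using Cons assms by (simp add: r_distr m_assoc)
qed (use assms in simp)

lemma deriv_map_smult:
  assumes "set p \<subseteq> carrier R" "a \<in> carrier R"
  shows "deriv (map ((\<otimes>) a) p) = map ((\<otimes>) a) (deriv p)"
  using assms by (induction p) (auto simp: add_pow_rdistr)

text \<open>The product rule for (X - a) q at the point a, where the terms containing the derivative
  of q cancel.\<close>

lemma eval_deriv_linear_mult: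
  assumes "set q \<subseteq> carrier R" "a \<in> carrier R"
  shows "eval (deriv (poly_mult [\<one>, \<ominus> a] q)) a = eval q a"
proof -
  define u v where "u = map ((\<otimes>) \<one>) q" and "v = map ((\<otimes>) (\<ominus> a)) q"
  have u: "u = q" unfolding u_def using assms(1) by (induction q) auto
  have v: "set v \<subseteq> carrier R" unfolding v_def using assms by auto
  have pv: "set (poly_add v []) \<subseteq> carrier R" using poly_add_in_carrier[OF v, of "[]"] by (simp del: poly_add.simps)
  have cl: "eval (deriv q) a \<in> carrier R" "eval q a \<in> carrier R"
    using eval_deriv_closed eval_in_carrier assms by auto
  have "poly_mult [\<one>, \<ominus> a] q = poly_add (u @ [\<zero>]) (poly_add v [])"
    unfolding u_def v_def by simp
  then have "eval (deriv (poly_mult [\<one>, \<ominus> a] q)) a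
      = eval (deriv (q @ [\<zero>])) a \<oplus> eval (deriv (poly_add v [])) a"
    using eval_deriv_poly_add[of "u @ [\<zero>]" "poly_add v []" a] assms pv u by simp
  also have "eval (deriv (poly_add v [])) a = eval (deriv v) a"
    using eval_deriv_poly_add[OF v _ assms(2), of "[]"] eval_deriv_closed[OF v assms(2)] by simp
  also have "\<dots> = \<ominus> a \<otimes> eval (deriv q) a"
    unfolding v_def using deriv_map_smult eval_map_smult deriv_in_carrier assms by simp
  also have "eval (deriv (q @ [\<zero>])) a = eval (deriv q) a \<otimes> a \<oplus> eval q a"
    using eval_deriv_append_zero[OF assms] .
  also have "eval (deriv q) a \<otimes> a \<oplus> eval q a \<oplus> \<ominus> a \<otimes> eval (deriv q) a = eval q a"
    using cl assms(2) by algebra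
  finally show ?thesis .
qed

end

text \<open>Writing f = (X - a) h, the derivative of f at a is h(a), and h still has the factor X -
  a.\<close>

lemma (in domain) eval_deriv_multiple_root:
  assumes "f \<in> carrier (poly_ring R)" "1 < count (roots f) a"
  shows "a \<in> carrier R" "eval f a = \<zero>" "eval (deriv f) a = \<zero>"
proof -
  interpret UP: domain "poly_ring R" using univ_poly_is_domain[OF carrier_is_subring] .
  have am: "alg_mult f a \<ge> 2" using alg_mult_eq_count_roots[OF assms(1)] assms(2) by simp
  then have "is_root f a" using alg_mult_gt_zero_iff_is_root[OF assms(1), of a] by simp
  then show a: "a \<in> carrier R" "eval f a = \<zero>" unfolding is_root_def by auto
  define l where "l = [\<one>, \<ominus> a]"
  have l: "l \<in> carrier (poly_ring R)"
    unfolding l_def using a(1) by (simp add: univ_poly_carrier[symmetric] polynomial_def)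
  have "(l [^]\<^bsub>poly_ring R\<^esub> (2::nat)) pdivides f"
    using le_alg_mult_imp_pdivides[OF a(1) assms(1) am] unfolding l_def .
  then obtain g where g: "g \<in> carrier (poly_ring R)" "f = (l [^]\<^bsub>poly_ring R\<^esub> (2::nat)) \<otimes>\<^bsub>poly_ring R\<^esub> g"
    unfolding pdivides_def factor_def by blast
  define h where "h = l \<otimes>\<^bsub>poly_ring R\<^esub> g"
  have h: "h \<in> carrier (poly_ring R)" unfolding h_def using l g by simp
  have "f = l \<otimes>\<^bsub>poly_ring R\<^esub> h"
    unfolding h_def using g l by (simp add: numeral_2_eq_2 UP.m_assoc)
  then have "f = poly_mult [\<one>, \<ominus> a] h" unfolding l_def by (simp add: univ_poly_mult)
  moreover have "set h \<subseteq> carrier R" "set g \<subseteq> carrier R"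
    using h g(1) polynomial_in_carrier[OF carrier_is_subring] by (auto simp: univ_poly_carrier[symmetric])
  moreover have "eval h a = eval l a \<otimes> eval g a"
    unfolding h_def using eval_poly_mult[of l g a] calculation(3) a(1)
    by (simp add: univ_poly_mult l_def)
  moreover have "eval l a = \<zero>" unfolding l_def using a(1) by (simp add: r_neg)
  ultimately show "eval (deriv f) a = \<zero>"
    using eval_deriv_linear_mult[of h a] a(1) eval_in_carrier[of g a] by simp
qed

section \<open>Conjugates and separable powers\<close>


lemma (in ring) normalize_eq_Nil_iff: "normalize p = [] \<longleftrightarrow> set p \<subseteq> {\<zero>}"
  by (induction p) auto

lemma (in ring) coeff_deriv_zero:
  "\<lbrakk> set f \<subseteq> carrier R; set (deriv f) \<subseteq> {\<zero>}; i < length f \<rbrakk> \<Longrightarrow> [i] \<cdot> coeff f i = \<zero>"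
proof (induction f)
  case (Cons c p)
  show ?case
  proof (cases "p = []")
    case True
    then have "i = 0" using Cons.prems by simp
    then show ?thesis by simp
  next
    case False
    then have "set (deriv p) \<subseteq> {\<zero>}" "[(length p)] \<cdot> c = \<zero>" using Cons.prems(2) by auto
    then show ?thesis using Cons.IH Cons.prems by (cases "i = length p") auto
  qed
qed simp

text \<open>\<open>g\<close> keeps every \<open>p\<close>-th coefficient, so its length is the
  number of multiples of \<open>p\<close> below \<open>length f\<close>. The remaining clauses keep
  the coefficients in \<open>K\<close> and make \<open>g\<close> nonzero when \<open>f\<close> is a
  minimal polynomial.\<close>

lemma (in ring) eval_contract:
  assumes "p > 0" and "set f \<subseteq> carrier R"
    and "\<And>i. \<lbrakk> i < length f; coeff f i \<noteq> \<zero> \<rbrakk> \<Longrightarrow> p dvd i"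
  shows "\<exists>g. set g \<subseteq> set f \<and> length g = (length f + (p - 1)) div p \<and>
    (f \<noteq> [] \<and> hd f \<noteq> \<zero> \<longrightarrow> g \<noteq> [] \<and> hd g = hd f) \<and>
    (\<forall>t\<in>carrier R. eval f t = eval g (t [^] p))"
  using assms(2,3)
proof (induction f)
  case Nil
  then show ?case using assms(1) by (intro exI[of _ "[]"]) auto
next
  case (Cons c f)
  have cf: "coeff (c # f) i = coeff f i" if "i < length f" for i using that by simp
  have "p dvd i" if "i < length f" "coeff f i \<noteq> \<zero>" for i
    using Cons.prems(2)[of i] that cf by auto
  then obtain g where g: "set g \<subseteq> set f" "length g = (length f + (p - 1)) div p"
      "\<And>t. t \<in> carrier R \<Longrightarrow> eval f t = eval g (t [^] p)"
    using Cons.IH Cons.prems(1) by (simp add: Bex_def) blast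
  have gc: "set g \<subseteq> carrier R" using g(1) Cons.prems(1) by auto
  show ?case
  \<comment> \<open>The head belongs to the exponent \<open>length f\<close>: it is kept if
    \<open>p\<close> divides this exponent and is 0 otherwise.\<close>
  proof (cases "p dvd length f")
    case True
    then obtain m where m: "length f = p * m" by auto
    have lg: "length g = m" unfolding g(2) m using assms(1) by (intro div_nat_eqI) auto
    have "(length (c # f) + (p - 1)) div p = Suc m" using m assms(1) by simp
    moreover have "eval (c # f) t = eval (c # g) (t [^] p)" if "t \<in> carrier R" for t
      using that g(3)[OF that] m lg by (simp add: nat_pow_pow)
    ultimately show ?thesis using g lg by (intro exI[of _ "c # g"]) auto
  next
    case False
    then have c: "c = \<zero>" using Cons.prems(2)[of "length f"] by auto
    have "(length f + p) div p = (length f + (p - 1)) div p"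
    proof -
      obtain r m where rm: "length f = p * m + r" "r < p" "r > 0"
        using False assms(1) by (metis dvd_eq_mod_eq_0 mod_less_divisor mult_div_mod_eq neq0_conv)
      have "(length f + p) div p = Suc m" using rm assms(1) by simp
      moreover have "(length f + (p - 1)) div p = Suc m"
        unfolding rm(1) using rm by (intro div_nat_eqI) auto
      ultimately show ?thesis by simp
    qed
    then have "(length (c # f) + (p - 1)) div p = length g" using assms(1) g(2) by simp
    moreover have "eval (c # f) t = eval g (t [^] p)" if "t \<in> carrier R" for t
      using c that g(3)[OF that] eval_in_carrier[OF gc, of "t [^] p"] by simp
    ultimately show ?thesis using g c by (intro exI[of _ g]) auto
  qed
qed

section \<open>Minimal polynomials and conjugates in the algebraic closure\<close>

context algebraic_closure
begin

definition conjugates :: "'a \<Rightarrow> 'a set"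
  where "conjugates x = {y \<in> carrier L. eval (Irr K x) y = \<zero>}"

abbreviation mult_free_min_poly :: "'a \<Rightarrow> bool"
  where "mult_free_min_poly x \<equiv> \<forall>y. count (roots (Irr K x)) y \<le> 1"

lemma Irr_props:
  assumes "x \<in> carrier L"
  shows "Irr K x \<in> carrier (K[X])" "Irr K x \<in> carrier (poly_ring L)" "set (Irr K x) \<subseteq> K"
    "Irr K x \<noteq> []" "hd (Irr K x) = \<one>" "eval (Irr K x) x = \<zero>" "degree (Irr K x) \<ge> 1"
    "pirreducible K (Irr K x)"
proof -
  note I = IrrE[OF subfield_axioms assms algebraic_extension[OF assms]]
  show "Irr K x \<in> carrier (K[X])" "eval (Irr K x) x = \<zero>" "hd (Irr K x) = \<one>" "pirreducible K (Irr K x)"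
    using I by auto
  show "Irr K x \<in> carrier (poly_ring L)"
    using carrier_polynomial_shell[OF subfieldE(1)[OF subfield_axioms] I(1)] .
  show "set (Irr K x) \<subseteq> K" using I(1) polynomial_incl by (simp add: univ_poly_carrier[symmetric])
  show d: "degree (Irr K x) \<ge> 1" using pirreducible_degree[OF subfield_axioms I(1,2)] .
  then show "Irr K x \<noteq> []" by auto
qed

lemma roots_Irr:
  assumes "x \<in> carrier L"
  shows "set_mset (roots (Irr K x)) = conjugates x" "size (roots (Irr K x)) = degree (Irr K x)"
    "finite (conjugates x)"
proof -
  note I = Irr_props[OF assms]
  show eq: "set_mset (roots (Irr K x)) = conjugates x"
    using roots_mem_iff_is_root[OF I(2)] I(4) unfolding conjugates_def is_root_def by auto
  show "size (roots (Irr K x)) = degree (Irr K x)"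
    using roots_over_subfield[OF I(1)] unfolding splitted_def .
  show "finite (conjugates x)" using eq finite_set_mset by metis
qed

text \<open>The minimal polynomial splits, so the multiplicities add up to its degree, and the
  number of distinct roots falls short of it by exactly the surplus multiplicities. Separability
  becomes an equality of numbers, which injective maps can transport.\<close>

lemma mult_free_iff_card_conjugates:
  assumes "x \<in> carrier L"
  shows "mult_free_min_poly x \<longleftrightarrow> card (conjugates x) = degree (Irr K x)"
    "card (conjugates x) \<le> degree (Irr K x)"
proof -
  define M where "M = roots (Irr K x)"
  have M: "set_mset M = conjugates x" "size M = degree (Irr K x)"
    using roots_Irr[OF assms] unfolding M_def by auto
  have size: "size M = card (conjugates x) + (\<Sum>y\<in>conjugates x. count M y - 1)"
  proof -
    have "size M = (\<Sum>y\<in>conjugates x. count M y)" unfolding size_multiset_overloaded_eq M(1) ..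
    also have "\<dots> = (\<Sum>y\<in>conjugates x. 1 + (count M y - 1))"
      by (rule sum.cong[OF refl]) (simp add: M(1)[symmetric])
    finally show ?thesis by (simp only: sum.distrib) simp
  qed
  show "card (conjugates x) \<le> degree (Irr K x)" using size M(2) by simp
  have "mult_free_min_poly x \<longleftrightarrow> (\<forall>y\<in>conjugates x. count M y - 1 = 0)"
    unfolding M_def[symmetric] M(1)[symmetric] by (metis count_inI diff_is_0_eq zero_le_one)
  also have "\<dots> \<longleftrightarrow> (\<Sum>y\<in>conjugates x. count M y - 1) = 0"
    using roots_Irr(3)[OF assms] by simp
  finally show "mult_free_min_poly x \<longleftrightarrow> card (conjugates x) = degree (Irr K x)"
    using size M(2) by (auto simp only:)
qed

lemma self_conjugate: "x \<in> carrier L \<Longrightarrow> x \<in> conjugates x"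
  unfolding conjugates_def using Irr_props(6) by simp

lemma conjugates_in_carrier: "conjugates x \<subseteq> carrier L"
  unfolding conjugates_def by auto

lemma normalize_over_K:
  assumes "set P \<subseteq> K"
  shows "normalize P \<in> carrier (K[X])"
  using normalize_gives_polynomial[OF assms] by (simp add: univ_poly_carrier[symmetric])

lemma K_in_carrier: "K \<subseteq> carrier L"
  using subfieldE(3)[OF subfield_axioms] .

text \<open>The minimal polynomial divides the normalised list, and normalising does not change
  values. Admitting arbitrary lists \<open>P\<close> allows \<open>expand q P\<close> to be inserted
  directly.\<close>

lemma conjugate_root:
  assumes "x \<in> carrier L" "y \<in> conjugates x" "set P \<subseteq> K" "eval P x = \<zero>"
  shows "eval P y = \<zero>"
proof -
  have Pc: "set P \<subseteq> carrier L" using assms(3) K_in_carrier by auto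
  have "Irr K x pdivides (normalize P)"
    using Irr_minimal[OF subfield_axioms assms(1) algebraic_extension[OF assms(1)] normalize_over_K[OF assms(3)]]
      eval_normalize[OF Pc assms(1)] assms(4) by simp
  then have "eval (normalize P) y = \<zero>"
    using pdivides_imp_root_sharing[OF Irr_props(2)[OF assms(1)]] assms(2) unfolding conjugates_def by auto
  then show ?thesis using eval_normalize[OF Pc] assms(2) unfolding conjugates_def by simp
qed

lemma degree_Irr_le:
  assumes "x \<in> carrier L" "set P \<subseteq> K" "eval P x = \<zero>" "\<not> set P \<subseteq> {\<zero>}"
  shows "degree (Irr K x) \<le> length P - 1"
proof -
  have Pc: "set P \<subseteq> carrier L" using assms(2) K_in_carrier by auto
  have "Irr K x pdivides (normalize P)"
    using Irr_minimal[OF subfield_axioms assms(1) algebraic_extension[OF assms(1)] normalize_over_K[OF assms(2)]]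
      eval_normalize[OF Pc assms(1)] assms(3) by simp
  moreover have "normalize P \<noteq> []" using assms(4) normalize_eq_Nil_iff by simp
  ultimately have "degree (Irr K x) \<le> degree (normalize P)"
    using pdivides_imp_degree_le[OF subfieldE(1)[OF subfield_axioms] Irr_props(1)[OF assms(1)]
        normalize_over_K[OF assms(2)]] by blast
  then show ?thesis using normalize_length_le[of P] by linarith
qed

lemma Irr_conjugate:
  assumes "x \<in> carrier L" "y \<in> conjugates x"
  shows "Irr K y = Irr K x"
proof -
  have y: "y \<in> carrier L" "eval (Irr K x) y = \<zero>" using assms(2) unfolding conjugates_def by auto
  note X = Irr_props[OF assms(1)] and Y = Irr_props[OF y(1)]
  show ?thesis
    using minimal_polynomial_is_unique[OF subfield_axioms y(1) algebraic_extension[OF y(1)]] X Y y(2)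
    by blast
qed

lemma root_exists:
  assumes "c \<in> carrier L" "(q :: nat) > 0"
  obtains y where "y \<in> carrier L" "y [^] q = c"
proof -
  define P where "P = \<one> # replicate (q - 1) \<zero> @ [\<ominus> c]"
  have P: "P \<in> carrier (poly_ring L)" unfolding P_def using assms
    by (auto simp: univ_poly_carrier[symmetric] polynomial_def set_replicate_conv_if)
  have "size (roots P) = q"
    using roots_over_carrier[OF P] assms(2) unfolding splitted_def P_def by simp
  then have "roots P \<noteq> {#}" using assms(2) by auto
  then obtain y where "y \<in># roots P" by blast
  then have y: "y \<in> carrier L" "eval P y = \<zero>"
    using roots_mem_iff_is_root[OF P] unfolding is_root_def by auto
  have "eval (replicate (q - 1) \<zero> @ [\<ominus> c]) y = \<ominus> c"
    using eval_replicate[of "[\<ominus> c]" y "q - 1"] assms(1) y(1) by simp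
  then have "eval P y = y [^] q \<oplus> \<ominus> c" unfolding P_def using assms y by simp
  then have "y [^] q = c" using y assms(1) by (metis a_minus_def nat_pow_closed r_right_minus_eq)
  then show thesis using that y(1) by blast
qed

text \<open>If \<open>f = Irr K x\<close> has a multiple root, then \<open>f' = 0\<close>, so \<open>f(t) = g(t\<^sup>p)\<close> in characteristic \<open>p\<close>.\<close>
lemma inseparable_step:
  assumes x: "x \<in> carrier L" and "\<not> mult_free_min_poly x"
  obtains p where "frobenius_exponent p" "degree (Irr K (x [^] p)) < degree (Irr K x)"
    "\<And>y. \<lbrakk> y \<in> carrier L; y [^] p \<in> conjugates (x [^] p) \<rbrakk> \<Longrightarrow> y \<in> conjugates x"
proof -
  define f where "f = Irr K x"
  note I = Irr_props[OF x, folded f_def]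
  obtain a where "1 < count (roots f) a" using assms(2) unfolding f_def by (meson not_le)
  note a = eval_deriv_multiple_root[OF I(2) this]
  have "a \<in> conjugates x" unfolding conjugates_def using a(1,2) f_def by simp
  then have Irra: "Irr K a = f" using Irr_conjugate[OF x] f_def by simp
  \<comment> \<open>The derivative vanishes at \<open>a\<close>, whose minimal polynomial is
    \<open>f\<close>, but it is shorter than \<open>f\<close>; hence all its entries are 0.\<close>
  have dK: "set (deriv f) \<subseteq> K" using deriv_in_subring[OF subfieldE(1)[OF subfield_axioms] I(3)] .
  have d0: "set (deriv f) \<subseteq> {\<zero>}"
  proof (rule ccontr)
    assume "\<not> set (deriv f) \<subseteq> {\<zero>}"
    then have "degree f \<le> length (deriv f) - 1" using degree_Irr_le[OF a(1) dK a(3)] Irra by simp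
    then show False using I(7) length_deriv[of f] by linarith
  qed
  have fc: "set f \<subseteq> carrier L" using I(3) K_in_carrier by auto
  have co: "[i] \<cdot> coeff f i = \<zero>" if "i < length f" for i
    using coeff_deriv_zero[OF fc d0 that] .
  \<comment> \<open>The leading coefficient is 1, so its multiple by the degree can vanish only in
    positive characteristic.\<close>
  define n where "n = degree f"
  have "coeff f n = \<one>" unfolding n_def using lead_coeff_simp[OF I(4)] I(5) by simp
  then have n: "[n] \<cdot> \<one> = \<zero>" "n > 0" using co[of n] I(4,7) unfolding n_def by auto
  obtain p :: nat where p: "Factorial_Ring.prime p" "[p] \<cdot> \<one> = \<zero>"
      "\<And>(i :: nat) c. \<lbrakk> c \<in> carrier L; [i] \<cdot> c = \<zero> \<rbrakk> \<Longrightarrow> c = \<zero> \<or> p dvd i"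
    by (rule additive_order_prime[OF n(2,1)]) (rule that)
  have p1: "p > 1" using p(1) prime_gt_1_nat by blast
  have "p dvd i" if "i < length f" "coeff f i \<noteq> \<zero>" for i
    using p(3)[of "coeff f i" i] co that fc by auto
  then obtain g where g: "set g \<subseteq> set f" "length g = (length f + (p - 1)) div p"
      "hd g = \<one>" "g \<noteq> []" "\<And>t. t \<in> carrier L \<Longrightarrow> eval f t = eval g (t [^] p)"
    using eval_contract[of p f] p1 fc I(4,5) by auto
  have gK: "set g \<subseteq> K" using g(1) I(3) by auto
  have xp: "x [^] p \<in> carrier L" "eval g (x [^] p) = \<zero>" using x g(5)[OF x] I(6) by auto
  have g0: "\<not> set g \<subseteq> {\<zero>}" using g(3,4) hd_in_set[of g] by auto
  have "degree (Irr K (x [^] p)) \<le> length g - 1" using degree_Irr_le[OF xp(1) gK xp(2) g0] .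
  \<comment> \<open>The degree of \<open>g\<close> is the degree of \<open>f\<close> divided by
    \<open>p\<close>.\<close>
  moreover have "length g - 1 < degree f"
  proof -
    obtain m where m: "length f = Suc m" "m > 0" using I(7) by (cases "length f") auto
    have "length g = (m + p) div p" using g(2) m p1 by simp
    also have "\<dots> = m div p + 1" using p1 by simp
    finally have "length g - 1 = m div p" by simp
    moreover have "m div p < m" using m(2) p1 by simp
    ultimately show ?thesis using m by simp
  qed
  ultimately have deg: "degree (Irr K (x [^] p)) < degree (Irr K x)" unfolding f_def by linarith
  \<comment> \<open>Since f(t) = g(t^p), a root y^p of \<open>g\<close> gives a root y of
    \<open>f\<close>; and \<open>g\<close> vanishes at all conjugates of x^p.\<close>
  have "y \<in> conjugates x" if "y \<in> carrier L" "y [^] p \<in> conjugates (x [^] p)" for y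
    using conjugate_root[OF xp(1) that(2) gK xp(2)] g(5)[OF that(1)] that(1)
    unfolding conjugates_def f_def by simp
  then show thesis
    using that[of p] frobenius_exponent_prime[OF p(1,2)] deg by blast
qed

text \<open>The polynomial P(X^q) for \<open>q > 0\<close>. Each coefficient gets
  \<open>q - 1\<close> zeros in front of it, also the leading one, so the list is in general not
  normalised.\<close>

fun expand :: "nat \<Rightarrow> 'a list \<Rightarrow> 'a list" where
  "expand q P = concat (map (\<lambda>c. replicate (q - 1) \<zero> @ [c]) P)"

lemma expand_in_K: "set P \<subseteq> K \<Longrightarrow> set (expand q P) \<subseteq> K"
  using subringE(2)[OF subfieldE(1)[OF subfield_axioms]] by (auto simp: set_replicate_conv_if)

lemma eval_expand:
  assumes "set P \<subseteq> carrier L" "q > 0" "t \<in> carrier L"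
  shows "eval (expand q P) t = eval P (t [^] q)"
  using assms(1)
proof (induction P rule: rev_induct)
  case (snoc c P)
  have ec: "set (expand q P) \<subseteq> carrier L" "set (replicate (q - 1) \<zero> @ [c]) \<subseteq> carrier L"
    using snoc.prems by (auto simp: set_replicate_conv_if)
  have "eval (expand q (P @ [c])) t = eval (expand q P @ (replicate (q - 1) \<zero> @ [c])) t" by simp
  also have "\<dots> = eval (expand q P) t \<otimes> t [^] length (replicate (q - 1) \<zero> @ [c])
      \<oplus> eval (replicate (q - 1) \<zero> @ [c]) t"
    using eval_append[OF ec assms(3)] .
  also have "length (replicate (q - 1) \<zero> @ [c]) = q" using assms(2) by simp
  also have "eval (replicate (q - 1) \<zero> @ [c]) t = c"
    using eval_replicate[of "[c]" t "q - 1"] snoc.prems assms(3) by simp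
  also have "eval (expand q P) t = eval P (t [^] q)" using snoc by simp
  finally show ?case using eval_append_aux[of P c "t [^] q"] snoc.prems assms(3) by simp
qed simp

text \<open>Composed with X^q, the minimal polynomial of x^q has the root x and therefore all
  conjugates of x.\<close>

lemma conjugates_pow:
  assumes "x \<in> carrier L" "y \<in> conjugates x" "(q :: nat) > 0"
  shows "y [^] q \<in> conjugates (x [^] q)"
proof -
  define P where "P = Irr K (x [^] q)"
  have xq: "x [^] q \<in> carrier L" and y: "y \<in> carrier L"
    using assms conjugates_in_carrier by auto
  note I = Irr_props[OF xq, folded P_def]
  have Pc: "set P \<subseteq> carrier L" using I(3) K_in_carrier by auto
  have "eval (expand q P) x = \<zero>" using eval_expand[OF Pc assms(3,1)] I(6) by simp
  then have "eval (expand q P) y = \<zero>"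
    using conjugate_root[OF assms(1,2) expand_in_K[OF I(3)]] by simp
  then show ?thesis using eval_expand[OF Pc assms(3) y] y unfolding conjugates_def P_def by simp
qed

text \<open>Each application of \<open>inseparable_step\<close> lowers the degree, so iterating it
  ends at a separable power. The equivalence keeps the number of conjugates constant; the induction
  carries only its direction from powers to elements, as the other one is
  \<open>conjugates_pow\<close>.\<close>

lemma separable_power_exists:
  assumes "x \<in> carrier L"
  obtains q where "frobenius_exponent q" "mult_free_min_poly (x [^] q)"
    "\<And>y. y \<in> carrier L \<Longrightarrow> y \<in> conjugates x \<longleftrightarrow> y [^] q \<in> conjugates (x [^] q)"
proof -
  have "\<exists>q. frobenius_exponent q \<and> mult_free_min_poly (x [^] q) \<and>
    (\<forall>y\<in>carrier L. y [^] q \<in> conjugates (x [^] q) \<longrightarrow> y \<in> conjugates x)"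
    using assms
  proof (induction "degree (Irr K x)" arbitrary: x rule: less_induct)
    case less
    show ?case
    proof (cases "mult_free_min_poly x")
      case True
      then show ?thesis
        using less.prems frobenius_exponent_1 by (intro exI[of _ 1]) auto
    next
      case False
      obtain p where p: "frobenius_exponent p" "degree (Irr K (x [^] p)) < degree (Irr K x)"
          "\<And>y. \<lbrakk> y \<in> carrier L; y [^] p \<in> conjugates (x [^] p) \<rbrakk> \<Longrightarrow> y \<in> conjugates x"
        using inseparable_step[OF less.prems False] by blast
      obtain q where q: "frobenius_exponent q" "mult_free_min_poly ((x [^] p) [^] q)"
          "\<And>y. \<lbrakk> y \<in> carrier L; y [^] q \<in> conjugates ((x [^] p) [^] q) \<rbrakk> \<Longrightarrow> y \<in> conjugates (x [^] p)"
        using less.hyps[OF p(2)] less.prems by auto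
      have pp: "(y [^] p) [^] q = y [^] (p * q)" if "y \<in> carrier L" for y
        using nat_pow_pow[OF that] .
      show ?thesis
      proof (intro exI[of _ "p * q"] conjI ballI impI)
        show "frobenius_exponent (p * q)" using frobenius_exponent_mult p q by blast
        show "mult_free_min_poly (x [^] (p * q))" using q(2) unfolding pp[OF less.prems] .
        fix y assume "y \<in> carrier L" "y [^] (p * q) \<in> conjugates (x [^] (p * q))"
        then show "y \<in> conjugates x"
          using p(3)[of y] q(3)[of "y [^] p"] pp less.prems by simp
      qed
    qed
  qed
  then show thesis
    using that conjugates_pow[OF assms] unfolding frobenius_exponent_def by blast
qed

end

section \<open>The separable and the purely inseparable elements\<close>


context algebraic_closure
begin

text \<open>The separable closure of \<open>K\<close> in the ambient field; intersecting it with
  \<open>E\<close> will give the separable part of \<open>E\<close>.\<close>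

definition separables :: "'a set"
  where "separables = {x \<in> carrier L. mult_free_min_poly x}"

text \<open>Powers in \<open>K\<close> make closure under the field operations immediate;
  \<open>inseparables_iff_conjugates\<close> supplies the description by roots.\<close>

definition inseparables :: "'a set"
  where "inseparables = {x \<in> carrier L. \<exists>q. frobenius_exponent q \<and> x [^] q \<in> K}"

lemma subring_pow:
  assumes "subring S L" "x \<in> S"
  shows "x [^] (n :: nat) \<in> S"
  by (induction n) (use assms subringE(3,6)[OF assms(1)] in auto)

lemma simple_extension_props:
  assumes "x \<in> carrier L"
  shows "subfield (simple_extension K x) L" "K \<subseteq> simple_extension K x" "x \<in> simple_extension K x"
    "dimension (degree (Irr K x)) K (simple_extension K x)"
  using simple_extension_is_subfield[OF subfield_axioms assms] algebraic_extension[OF assms]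
    simple_extension_incl[OF K_in_carrier assms]
    simple_extension_mem[OF subfieldE(1)[OF subfield_axioms] assms]
    dimension_simple_extension[OF subfield_axioms assms] by auto

lemma subspace_eq:
  assumes "dimension n K E" "dimension n K F" "E \<subseteq> F"
  shows "E = F"
proof -
  obtain us where us: "set us \<subseteq> carrier L" "independent K us" "length us = n" "Span K us = E"
    using exists_base[OF subfield_axioms assms(1)] by blast
  then have "set us \<subseteq> F" using Span_base_incl[OF subfield_axioms us(1)] assms(3) by blast
  then show ?thesis
    using independent_length_eq_dimension[OF subfield_axioms assms(2) us(2)] us(3,4) by simp
qed

text \<open>The q-th powers of the conjugates of x are distinct conjugates of x^q, so x^q has at
  least as many conjugates as the degree of x. Its own degree is at most that of x, because it lies
  in K(x). Hence all these numbers agree, and so do the two fields.\<close>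

lemma separable_pow:
  assumes "x \<in> separables" "frobenius_exponent q"
  shows "simple_extension K (x [^] q) = simple_extension K x" "x [^] q \<in> separables"
    "degree (Irr K (x [^] q)) = degree (Irr K x)"
proof -
  have x: "x \<in> carrier L" "mult_free_min_poly x" using assms(1) unfolding separables_def by auto
  have q: "q > 0" using assms(2) unfolding frobenius_exponent_def by simp
  have xq: "x [^] q \<in> carrier L" using x by simp
  note X = simple_extension_props[OF x(1)] and Q = simple_extension_props[OF xq]
  have inc: "simple_extension K (x [^] q) \<subseteq> simple_extension K x"
    using simple_extension_subring_incl[OF subfieldE(1)[OF X(1)] X(2)]
      subring_pow[OF subfieldE(1)[OF X(1)] X(3)] by blast
  have le: "degree (Irr K (x [^] q)) \<le> degree (Irr K x)"
  proof -
    obtain us where us: "independent K us" "length us = degree (Irr K (x [^] q))"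
        "Span K us = simple_extension K (x [^] q)" "set us \<subseteq> carrier L"
      using exists_base[OF subfield_axioms Q(4)] by blast
    have "set us \<subseteq> simple_extension K x"
      using Span_base_incl[OF subfield_axioms us(4)] us(3) inc by blast
    then show ?thesis
      using independent_length_le_dimension[OF subfield_axioms X(4) us(1)] us(2) by simp
  qed
  have "inj_on (\<lambda>t. t [^] q) (conjugates x)"
    using frobenius_inj[OF assms(2)] conjugates_in_carrier inj_on_subset by blast
  then have "card (conjugates x) \<le> card (conjugates (x [^] q))"
    using card_inj_on_le[OF _ _ roots_Irr(3)[OF xq]] conjugates_pow[OF x(1) _ q] by blast
  then have "card (conjugates (x [^] q)) = degree (Irr K (x [^] q))"
    and deg: "degree (Irr K (x [^] q)) = degree (Irr K x)"
    using mult_free_iff_card_conjugates[OF x(1)] mult_free_iff_card_conjugates[OF xq] x(2) le by auto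
  then show "x [^] q \<in> separables" "degree (Irr K (x [^] q)) = degree (Irr K x)"
    unfolding separables_def using mult_free_iff_card_conjugates(1)[OF xq] xq by auto
  show "simple_extension K (x [^] q) = simple_extension K x"
    using subspace_eq[OF _ X(4) inc] Q(4) deg by simp
qed

lemma frobenius_zero: "frobenius_exponent q \<Longrightarrow> \<zero> [^] q = \<zero>"
  unfolding frobenius_exponent_def using nat_pow_zero by blast

lemma frobenius_combine:
  assumes "frobenius_exponent q" "set ks \<subseteq> carrier L" "set us \<subseteq> carrier L"
  shows "combine (map (\<lambda>x. x [^] q) ks) (map (\<lambda>x. x [^] q) us) = combine ks us [^] q"
  using ring_hom_ring.combine_hom[OF frobenius_hom[OF assms(1)] assms(2,3)] .

text \<open>\<open>K(us)\<close> is generated by the powers \<open>u\<^sup>q\<close>, so the \<open>q\<close>-th powers of a \<open>K\<close>-basis span it again.\<close>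
lemma independent_pow:
  assumes us: "set us \<subseteq> separables" and vs: "independent K vs" "set vs \<subseteq> finite_extension K us"
    and q: "frobenius_exponent q"
  shows "independent K (map (\<lambda>x. x [^] q) vs)"
proof -
  define h where "h = (\<lambda>x. x [^] q)"
  interpret h: ring_hom_ring L L h unfolding h_def using frobenius_hom[OF q] .
  note K = subfield_axioms
  have usc: "set us \<subseteq> carrier L" using us unfolding separables_def by auto
  define E where "E = finite_extension K us"
  note E = finite_extension_props[OF usc, folded E_def]
  have dE: "dimension ((dim over K) E) K E" using finite_dimensionE[OF K E(4)] .
  \<comment> \<open>The list is completed to a basis of \<open>E\<close>: its q-th powers then have
    the right length, so that spanning implies independence.\<close>
  obtain ws where ws: "length (ws @ vs) = (dim over K) E" "independent K (ws @ vs)" "Span K (ws @ vs) = E"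
    using complete_base[OF K dE vs(1)] vs(2) unfolding E_def over_def by blast
  define es where "es = ws @ vs"
  have es: "length es = (dim over K) E" "Span K es = E" "set es \<subseteq> carrier L"
    unfolding es_def using ws independent_in_carrier[OF ws(2)] by (simp_all del: Span.simps)
  have hes: "set (map h es) \<subseteq> carrier L" using es(3) by auto
  have hE: "subring (h ` E) L" using h.img_is_subring[OF subfieldE(1)[OF E(1)]] .
  have hK: "h k \<in> K" if "k \<in> K" for k
    unfolding h_def using subring_pow[OF subfieldE(1)[OF K] that] .
  have hspan: "h ` E \<subseteq> Span K (map h es)"
  proof
    fix y assume "y \<in> h ` E"
    then obtain e where e: "e \<in> Span K es" "y = h e" using es(2) by blast
    then obtain ks where ks: "set ks \<subseteq> K" "y = h (combine ks es)"
      unfolding Span_eq_combine_set[OF K es(3)] by blast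
    then have "y = combine (map h ks) (map h es)"
      unfolding h_def using frobenius_combine[OF q _ es(3)] K_in_carrier by auto
    moreover have "set (map h ks) \<subseteq> K" using ks(1) hK by auto
    ultimately show "y \<in> Span K (map h es)" using Span_eq_combine_set[OF K hes] by blast
  qed
  \<comment> \<open>\<open>S\<close> is K(E^q), a field because it is a ring above \<open>K\<close>.
    By \<open>separable_pow\<close> each generator u lies in K(u^q) and so in \<open>S\<close>,
    which gives \<open>E \<subseteq> S\<close>.\<close>
  define S where "S = prods K (h ` E)"
  have S: "subfield S L" "K \<subseteq> S" "h ` E \<subseteq> S"
    unfolding S_def using prods_is_subring[OF subfieldE(1)[OF K] hE] subring_over_is_subfield
      prods_incl[OF subfieldE(1)[OF K] hE] by auto
  have "set us \<subseteq> S"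
  proof
    fix u assume u: "u \<in> set us"
    then have uc: "u \<in> carrier L" and us': "u \<in> separables" using usc us by auto
    have "h u \<in> S" using S(3) E(3) u by auto
    then have "simple_extension K (h u) \<subseteq> S"
      using simple_extension_subring_incl[OF subfieldE(1)[OF S(1)] S(2)] by blast
    then show "u \<in> S"
      using separable_pow(1)[OF us' q] simple_extension_props(3)[OF uc] unfolding h_def by auto
  qed
  then have "E \<subseteq> S" unfolding E_def
    using finite_extension_subring_incl[OF subfieldE(1)[OF S(1)] S(2)] by blast
  also have "S \<subseteq> Span K (map h es)" unfolding S_def using prods_subset_Span[OF K hes hspan] .
  finally have "E \<subseteq> Span K (map h es)" .
  moreover have "Span K (map h es) \<subseteq> E"
  proof -
    have "h e \<in> E" if "e \<in> E" for e
      unfolding h_def using subring_pow[OF subfieldE(1)[OF E(1)] that] .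
    then have "set (map h es) \<subseteq> E" using Span_base_incl[OF K es(3)] es(2) by auto
    then show ?thesis using Span_in_subfield[OF K E(1,2)] by blast
  qed
  ultimately have "Span K (map h es) = E" by blast
  then have "independent K (map h es)"
    using independent_of_spanning_length[OF K hes] dE es(1) by simp
  then show ?thesis unfolding es_def h_def using independent_split(1)[OF K] by simp
qed

lemma exp_base_pow:
  assumes "x \<in> carrier L"
  shows "map (\<lambda>t. t [^] (q::nat)) (exp_base x n) = exp_base (x [^] q) n"
  unfolding exp_base_def using assms by (simp add: nat_pow_pow mult.commute)

lemma exp_base_in_subfield:
  assumes "subfield E L" "x \<in> E"
  shows "set (exp_base x n) \<subseteq> E"
  unfolding exp_base_def using subring_pow[OF subfieldE(1)[OF assms(1)] assms(2)] by auto

text \<open>Every element has a q-th root in the ambient field, which makes the map onto;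
  injectivity of q-th powers then keeps the number of conjugates unchanged.\<close>

lemma conjugates_pow_image:
  assumes "x \<in> carrier L" "frobenius_exponent q"
    and "\<And>y. y \<in> carrier L \<Longrightarrow> y \<in> conjugates x \<longleftrightarrow> y [^] q \<in> conjugates (x [^] q)"
  shows "conjugates (x [^] q) = (\<lambda>t. t [^] q) ` conjugates x"
    "card (conjugates (x [^] q)) = card (conjugates x)"
proof -
  have q: "q > 0" using assms(2) unfolding frobenius_exponent_def by simp
  show eq: "conjugates (x [^] q) = (\<lambda>t. t [^] q) ` conjugates x"
  proof
    show "(\<lambda>t. t [^] q) ` conjugates x \<subseteq> conjugates (x [^] q)"
      using conjugates_pow[OF assms(1) _ q] by blast
    show "conjugates (x [^] q) \<subseteq> (\<lambda>t. t [^] q) ` conjugates x"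
    proof
      fix z assume z: "z \<in> conjugates (x [^] q)"
      then have "z \<in> carrier L" using conjugates_in_carrier by blast
      then obtain y where "y \<in> carrier L" "y [^] q = z" using root_exists q by blast
      then show "z \<in> (\<lambda>t. t [^] q) ` conjugates x" using assms(3)[of y] z by blast
    qed
  qed
  have "inj_on (\<lambda>t. t [^] q) (conjugates x)"
    using frobenius_inj[OF assms(2)] conjugates_in_carrier inj_on_subset by blast
  then show "card (conjugates (x [^] q)) = card (conjugates x)" unfolding eq by (rule card_image)
qed

text \<open>Let d be the degree of z. The powers of z below d are independent, and by
  \<open>independent_pow\<close> so are their q-th powers; hence z^q has degree at least d. For a
  separable z^q this degree is its number of conjugates, which is also that of z.\<close>

lemma finite_extension_separable:
  assumes "set us \<subseteq> separables"
  shows "finite_extension K us \<subseteq> separables"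
proof
  fix z assume z: "z \<in> finite_extension K us"
  have usc: "set us \<subseteq> carrier L" using assms unfolding separables_def by auto
  note E = finite_extension_props[OF usc]
  have zc: "z \<in> carrier L" using subfieldE(3)[OF E(1)] z by blast
  obtain q where q: "frobenius_exponent q" "mult_free_min_poly (z [^] q)"
      "\<And>y. y \<in> carrier L \<Longrightarrow> y \<in> conjugates z \<longleftrightarrow> y [^] q \<in> conjugates (z [^] q)"
    using separable_power_exists[OF zc] by blast
  have zq: "z [^] q \<in> carrier L" using zc by simp
  define d where "d = degree (Irr K z)"
  have "independent K (exp_base z d)"
    unfolding d_def using exp_base_independent[OF subfield_axioms zc algebraic_extension[OF zc]] .
  then have "independent K (exp_base (z [^] q) d)"
    using independent_pow[OF assms _ exp_base_in_subfield[OF E(1) z] q(1)] exp_base_pow[OF zc] by metis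
  moreover have "set (exp_base (z [^] q) d) \<subseteq> simple_extension K (z [^] q)"
    using exp_base_in_subfield[OF simple_extension_props(1,3)[OF zq]] .
  ultimately have "length (exp_base (z [^] q) d) \<le> degree (Irr K (z [^] q))"
    using independent_length_le_dimension[OF subfield_axioms simple_extension_props(4)[OF zq]] by blast
  then have "d \<le> degree (Irr K (z [^] q))" unfolding exp_base_def by simp
  also have "\<dots> = card (conjugates z)"
    using mult_free_iff_card_conjugates(1)[OF zq] q(2) conjugates_pow_image(2)[OF zc q(1,3)] by simp
  finally show "z \<in> separables"
    using mult_free_iff_card_conjugates[OF zc] zc unfolding separables_def d_def by simp
qed

lemma K_separable: "K \<subseteq> separables"
proof
  fix k assume k: "k \<in> K"
  then have kc: "k \<in> carrier L" using K_in_carrier by auto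
  have P: "set [\<one>, \<ominus> k] \<subseteq> K" "eval [\<one>, \<ominus> k] k = \<zero>" "\<not> set [\<one>, \<ominus> k] \<subseteq> {\<zero>}"
    using k kc subringE(3,5)[OF subfieldE(1)[OF subfield_axioms]] by (auto simp: r_neg)
  have "degree (Irr K k) \<le> 1" using degree_Irr_le[OF kc P] by simp
  moreover have "card (conjugates k) \<ge> 1"
    using self_conjugate[OF kc] roots_Irr(3)[OF kc] by (metis One_nat_def Suc_leI card_gt_0_iff empty_iff)
  ultimately show "k \<in> separables"
    using mult_free_iff_card_conjugates[OF kc] kc unfolding separables_def by simp
qed

lemma separables_subfield: "subfield separables L"
proof (rule subring_over_is_subfield[OF _ K_separable])
  have two: "finite_extension K [x, y] \<subseteq> separables" "subfield (finite_extension K [x, y]) L"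
      "x \<in> finite_extension K [x, y]" "y \<in> finite_extension K [x, y]"
    if "x \<in> separables" "y \<in> separables" for x y
  proof -
    have c: "set [x, y] \<subseteq> carrier L" using that unfolding separables_def by auto
    show "finite_extension K [x, y] \<subseteq> separables" using finite_extension_separable[of "[x, y]"] that by auto
    show "subfield (finite_extension K [x, y]) L" "x \<in> finite_extension K [x, y]" "y \<in> finite_extension K [x, y]"
      using finite_extension_props[OF c] by (auto simp del: finite_extension.simps)
  qed
  show "subring separables L"
  proof (rule subringI)
    show "separables \<subseteq> carrier L" unfolding separables_def by auto
    show "\<one> \<in> separables" using K_separable subringE(3)[OF subfieldE(1)[OF subfield_axioms]] by auto
    show "\<ominus> x \<in> separables" if "x \<in> separables" for x
      using two(1)[OF that that] subringE(5)[OF subfieldE(1)[OF two(2)[OF that that]] two(3)[OF that that]] by (rule subsetD)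
    show "x \<otimes> y \<in> separables" if "x \<in> separables" "y \<in> separables" for x y
      using two(1)[OF that] subringE(6)[OF subfieldE(1)[OF two(2)[OF that]] two(3,4)[OF that]] by (rule subsetD)
    show "x \<oplus> y \<in> separables" if "x \<in> separables" "y \<in> separables" for x y
      using two(1)[OF that] subringE(7)[OF subfieldE(1)[OF two(2)[OF that]] two(3,4)[OF that]] by (rule subsetD)
  qed
qed

lemma K_inseparable: "K \<subseteq> inseparables"
proof
  fix k assume k: "k \<in> K"
  then have kc: "k \<in> carrier L" using K_in_carrier by auto
  then have "k [^] (1::nat) \<in> K" using k by simp
  then show "k \<in> inseparables" unfolding inseparables_def using frobenius_exponent_1 kc by blast
qed

lemma inseparables_subfield: "subfield inseparables L"
proof (rule subring_over_is_subfield[OF _ K_inseparable])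
  note SK = subfieldE(1)[OF subfield_axioms]
  \<comment> \<open>The product of the two exponents serves both elements, since powers of elements
    of \<open>K\<close> stay in \<open>K\<close>.\<close>
  have two: "\<exists>q. frobenius_exponent q \<and> x [^] q \<in> K \<and> y [^] q \<in> K"
    if xy: "x \<in> inseparables" "y \<in> inseparables" for x y
  proof -
    obtain q r where q: "frobenius_exponent q" "x [^] q \<in> K" and r: "frobenius_exponent r" "y [^] r \<in> K"
      using xy unfolding inseparables_def by auto
    have "x \<in> carrier L" "y \<in> carrier L" using xy unfolding inseparables_def by auto
    then have "x [^] (q * r) \<in> K" "y [^] (q * r) \<in> K"
      using subring_pow[OF SK q(2), of r] subring_pow[OF SK r(2), of q]
      by (simp_all add: nat_pow_pow mult.commute)
    then show ?thesis using frobenius_exponent_mult[OF q(1) r(1)] by blast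
  qed
  show "subring inseparables L"
  proof (rule subringI)
    show "inseparables \<subseteq> carrier L" unfolding inseparables_def by auto
    show "\<one> \<in> inseparables" using K_inseparable subringE(3)[OF SK] by auto
    show neg: "\<ominus> x \<in> inseparables" if x: "x \<in> inseparables" for x
    proof -
      obtain q where q: "frobenius_exponent q" "x [^] q \<in> K" and xc: "x \<in> carrier L"
        using x unfolding inseparables_def by auto
      interpret h: ring_hom_ring L L "\<lambda>t. t [^] q" using frobenius_hom[OF q(1)] .
      have "(\<ominus> x) [^] q \<in> K" using h.hom_a_inv[OF xc] subringE(5)[OF SK q(2)] by simp
      then show ?thesis using q(1) xc unfolding inseparables_def by auto
    qed
    fix x y assume xy: "x \<in> inseparables" "y \<in> inseparables"
    obtain q where q: "frobenius_exponent q" "x [^] q \<in> K" "y [^] q \<in> K"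
      using two[OF xy] by blast
    have c: "x \<in> carrier L" "y \<in> carrier L" using xy unfolding inseparables_def by auto
    have "(x \<otimes> y) [^] q \<in> K" using q(2,3) subringE(6)[OF SK] c by (simp add: nat_pow_distrib)
    moreover have "(x \<oplus> y) [^] q \<in> K"
      using q subringE(7)[OF SK] c unfolding frobenius_exponent_def by simp
    ultimately show "x \<otimes> y \<in> inseparables" "x \<oplus> y \<in> inseparables"
      using q(1) c unfolding inseparables_def by auto
  qed
qed

text \<open>If x^q lies in \<open>K\<close>, every conjugate of x has the same q-th power and equals
  x by injectivity. Conversely, if x has one conjugate, so has its separable power x^q, which
  therefore has degree 1 and lies in \<open>K\<close>.\<close>

lemma inseparables_iff_conjugates:
  assumes x: "x \<in> carrier L"
  shows "x \<in> inseparables \<longleftrightarrow> conjugates x = {x}"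
proof
  assume "x \<in> inseparables"
  then obtain q where q: "frobenius_exponent q" "x [^] q \<in> K" unfolding inseparables_def by auto
  have q0: "q > 0" using q(1) unfolding frobenius_exponent_def by simp
  define k where "k = x [^] q"
  have kc: "k \<in> carrier L" "\<ominus> k \<in> K"
    unfolding k_def using x q(2) subringE(5)[OF subfieldE(1)[OF subfield_axioms]] by auto
  define P where "P = expand q [\<one>, \<ominus> k]"
  have PK: "set P \<subseteq> K" unfolding P_def
    by (rule expand_in_K) (use kc subringE(3)[OF subfieldE(1)[OF subfield_axioms]] in auto)
  have eP: "eval P t = t [^] q \<oplus> \<ominus> k" if "t \<in> carrier L" for t
    unfolding P_def using eval_expand[of "[\<one>, \<ominus> k]" q t] q0 that kc by simp
  have "y = x" if y: "y \<in> conjugates x" for y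
  proof -
    have yc: "y \<in> carrier L" using y conjugates_in_carrier by auto
    have "eval P x = \<zero>" using eP[OF x] x unfolding k_def by (simp add: r_neg)
    then have "eval P y = \<zero>" using conjugate_root[OF x y PK] by simp
    then have "y [^] q = x [^] q"
      using eP[OF yc] yc kc(1) unfolding k_def by (metis a_minus_def nat_pow_closed r_right_minus_eq)
    then show ?thesis using frobenius_inj[OF q(1)] yc x by (auto dest: inj_onD)
  qed
  then show "conjugates x = {x}" using self_conjugate[OF x] by auto
next
  assume c: "conjugates x = {x}"
  obtain q where q: "frobenius_exponent q" "mult_free_min_poly (x [^] q)"
      "\<And>y. y \<in> carrier L \<Longrightarrow> y \<in> conjugates x \<longleftrightarrow> y [^] q \<in> conjugates (x [^] q)"
    using separable_power_exists[OF x] by blast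
  have xq: "x [^] q \<in> carrier L" using x by simp
  have "degree (Irr K (x [^] q)) = 1"
    using conjugates_pow_image(2)[OF x q(1,3)] mult_free_iff_card_conjugates(1)[OF xq] q(2) c by simp
  then have "dimension 1 K (simple_extension K (x [^] q))"
    using simple_extension_props(4)[OF xq] by simp
  then have "K = simple_extension K (x [^] q)"
    using subspace_eq[OF dimension_one[OF subfield_axioms] _ simple_extension_props(2)[OF xq]] by blast
  then show "x \<in> inseparables"
    using simple_extension_props(3)[OF xq] q(1) x unfolding inseparables_def by auto
qed

lemma prods_Int_separables:
  assumes A: "subfield A L" "K \<subseteq> A" and B: "subfield B L" "K \<subseteq> B"
  shows "prods A B \<inter> separables = prods (A \<inter> separables) (B \<inter> separables)"
proof
  note S = separables_subfield
  have sub: "subfield (C \<inter> separables) L" "K \<subseteq> C \<inter> separables" if "subfield C L" "K \<subseteq> C" for C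
    using subring_over_is_subfield[OF subring_inter[OF subfieldE(1)[OF that(1)] subfieldE(1)[OF S]]]
      that K_separable by auto
  define T where "T = prods (A \<inter> separables) (B \<inter> separables)"
  have T: "subfield T L" "K \<subseteq> T"
    unfolding T_def using prods_is_subfield[OF sub(1)[OF A] sub(1)[OF B] sub(2)[OF A]]
      prods_incl[OF subfieldE(1)[OF sub(1)[OF A]] subfieldE(1)[OF sub(1)[OF B]]] sub(2)[OF A] by auto
  have TS: "T \<subseteq> separables" unfolding T_def
    using prods_subset_subring[OF subfieldE(1)[OF S]] by blast
  show "prods (A \<inter> separables) (B \<inter> separables) \<subseteq> prods A B \<inter> separables"
    using TS prods_mono[of "A \<inter> separables" A "B \<inter> separables" B] unfolding T_def by auto
  have Ac: "A \<subseteq> carrier L" "B \<subseteq> carrier L" using subfieldE(3) A B by auto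
  have pw: "\<exists>q. frobenius_exponent q \<and> c [^] q \<in> C \<inter> separables"
    if "c \<in> C" "subfield C L" for c C
  proof -
    have c: "c \<in> carrier L" using subfieldE(3)[OF that(2)] that(1) by auto
    obtain q where q: "frobenius_exponent q" "mult_free_min_poly (c [^] q)"
      by (rule separable_power_exists[OF c], rule that)
    then have "c [^] q \<in> separables" using c unfolding separables_def by simp
    then show ?thesis
      using subring_pow[OF subfieldE(1)[OF that(2)] that(1), of q] q(1) by blast
  qed
  have main: "\<exists>q. frobenius_exponent q \<and> z [^] q \<in> T" if "z \<in> prods A B" for z
    using that
  proof induction
    case zero
    show ?case using frobenius_exponent_1 subringE(2)[OF subfieldE(1)[OF T(1)]]
      by (intro exI[of _ 1]) auto
  next
    case (step a b z)
    obtain q r s where q: "frobenius_exponent q" "a [^] q \<in> A \<inter> separables"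
      and r: "frobenius_exponent r" "b [^] r \<in> B \<inter> separables"
      and s: "frobenius_exponent s" "z [^] s \<in> T"
      using pw[OF step(1) A(1)] pw[OF step(2) B(1)] step.IH by blast
    have cl: "a \<in> carrier L" "b \<in> carrier L" "z \<in> carrier L"
      using step(1-3) Ac prods_in_carrier[OF Ac] by auto
    have T2: "A \<inter> separables \<subseteq> T" "B \<inter> separables \<subseteq> T"
      unfolding T_def using prods_incl[OF subfieldE(1)[OF sub(1)[OF A]] subfieldE(1)[OF sub(1)[OF B]]] by auto
    \<comment> \<open>A common exponent for the three elements: raising to the remaining factors
      stays inside \<open>T\<close>, and additivity of m-th powers then treats the whole
      sum.\<close>
    define m where "m = q * r * s"
    have m: "frobenius_exponent m" unfolding m_def using frobenius_exponent_mult q r s by blast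
    note TR = subfieldE(1)[OF T(1)]
    have "a [^] m = (a [^] q) [^] (r * s)" "b [^] m = (b [^] r) [^] (q * s)" "z [^] m = (z [^] s) [^] (q * r)"
      unfolding m_def using cl by (simp_all add: nat_pow_pow mult_ac)
    then have "a [^] m \<in> T" "b [^] m \<in> T" "z [^] m \<in> T"
      using subring_pow[OF TR] q(2) r(2) s(2) T2 by auto
    moreover have "(a \<otimes> b \<oplus> z) [^] m = a [^] m \<otimes> b [^] m \<oplus> z [^] m"
      using m cl unfolding frobenius_exponent_def by (simp add: nat_pow_distrib)
    ultimately show ?case using m subringE(6,7)[OF TR] by auto
  qed
  show "prods A B \<inter> separables \<subseteq> prods (A \<inter> separables) (B \<inter> separables)"
  proof
    fix z assume z: "z \<in> prods A B \<inter> separables"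
    then obtain q where q: "frobenius_exponent q" "z [^] q \<in> T" using main by blast
    have zc: "z \<in> carrier L" using z unfolding separables_def by auto
    have "simple_extension K (z [^] q) \<subseteq> T"
      using simple_extension_subring_incl[OF subfieldE(1)[OF T(1)] T(2) q(2)] .
    then show "z \<in> prods (A \<inter> separables) (B \<inter> separables)"
      using separable_pow(1)[OF _ q(1)] z simple_extension_props(3)[OF zc] unfolding T_def by auto
  qed
qed

text \<open>A relation with purely inseparable coefficients, raised to a suitable power q, has
  coefficients in \<open>K\<close>, while the q-th powers of the separable elements are still
  independent by \<open>independent_pow\<close>. So the coefficients have q-th power 0 and
  vanish.\<close>

lemma separables_inseparables_disjoint: "linearly_disjoint K separables inseparables"
  unfolding linearly_disjoint_def
proof (intro allI impI, elim conjE)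
  fix us assume us: "set us \<subseteq> separables" "(independent over K) us"
  have usc: "set us \<subseteq> carrier L" using us(1) unfolding separables_def by auto
  have "independent inseparables us"
  proof (rule trivial_combine_imp_independent[OF inseparables_subfield usc])
    fix cs assume cs: "set cs \<subseteq> inseparables" "combine cs us = \<zero>"
    have "\<exists>q. frobenius_exponent q \<and> (\<forall>c\<in>set cs. c [^] q \<in> K)"
      using cs(1)
    proof (induction cs)
      case Nil
      show ?case using frobenius_exponent_1 by auto
    next
      case (Cons c cs)
      then obtain q r where q: "frobenius_exponent q" "\<forall>c\<in>set cs. c [^] q \<in> K"
        and r: "frobenius_exponent r" "c [^] r \<in> K"
        unfolding inseparables_def by auto
      have "d [^] (q * r) \<in> K" if d: "d \<in> set (c # cs)" for d
      proof -
        have dc: "d \<in> carrier L" using Cons.prems d unfolding inseparables_def by auto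
        show ?thesis
        proof (cases "d = c")
          case True
          then show ?thesis using subring_pow[OF subfieldE(1)[OF subfield_axioms] r(2), of q] dc
            by (simp add: nat_pow_pow mult.commute)
        next
          case False
          then have "d [^] q \<in> K" using q(2) d by auto
          then show ?thesis using subring_pow[OF subfieldE(1)[OF subfield_axioms], of "d [^] q" r] dc
            by (simp add: nat_pow_pow)
        qed
      qed
      then show ?case using frobenius_exponent_mult[OF q(1) r(1)] by blast
    qed
    then obtain q where q: "frobenius_exponent q" "\<forall>c\<in>set cs. c [^] q \<in> K" by blast
    define h where "h = (\<lambda>x. x [^] q)"
    have csc: "set cs \<subseteq> carrier L" using cs(1) unfolding inseparables_def by auto
    have "combine (map h cs) (map h us) = \<zero>"
      unfolding h_def using frobenius_combine[OF q(1) csc usc] cs(2) frobenius_zero[OF q(1)] by simp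
    moreover have "independent K (map h us)"
      unfolding h_def using independent_pow[OF us(1) _ _ q(1)] us(2) finite_extension_props(3)[OF usc]
      unfolding over_def by blast
    moreover have "set (map h cs) \<subseteq> K" unfolding h_def using q(2) by auto
    ultimately have "set (take (length (map h us)) (map h cs)) \<subseteq> {\<zero>}"
      using independent_imp_trivial_combine[OF subfield_axioms] by blast
    then have "h c = \<zero>" if "c \<in> set (take (length us) cs)" for c using that by (auto simp: take_map)
    moreover have "c = \<zero>" if "c \<in> carrier L" "h c = \<zero>" for c
      using frobenius_inj[OF q(1)] that frobenius_zero[OF q(1)] unfolding h_def
      by (metis inj_onD zero_closed)
    ultimately show "set (take (length us) cs) \<subseteq> {\<zero>}" using csc set_take_subset[of "length us" cs] by blast
  qed
  then show "(independent over inseparables) us" unfolding over_def .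
qed

end

section \<open>Normal extensions\<close>


text \<open>Horner's scheme: the entries of \<open>Q\<close> are the intermediate values in the
  evaluation of \<open>P\<close> at \<open>a\<close>. Conversely each coefficient of
  \<open>P\<close> is one such value minus \<open>a\<close> times the preceding one, which proves
  the last clause.\<close>

lemma (in cring) synthetic_division:
  assumes N: "subring N R" and a: "a \<in> N"
  shows "set P \<subseteq> carrier R \<Longrightarrow> P \<noteq> [] \<Longrightarrow> \<exists>Q. length Q = length P - 1 \<and> set Q \<subseteq> carrier R \<and>
    (\<forall>t\<in>carrier R. eval P t = eval Q t \<otimes> (t \<ominus> a) \<oplus> eval P a) \<and>
    (set Q \<subseteq> N \<and> eval P a \<in> N \<longrightarrow> set P \<subseteq> N)"
proof (induction P rule: rev_induct)
  case (snoc c P)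
  have ac: "a \<in> carrier R" using a subringE(1)[OF N] by auto
  have c: "c \<in> carrier R" "set P \<subseteq> carrier R" using snoc.prems by auto
  show ?case
  proof (cases "P = []")
    case True
    then show ?thesis using c ac by (intro exI[of _ "[]"]) (auto simp: a_minus_def)
  next
    case False
    then obtain Q where Q: "length Q = length P - 1" "set Q \<subseteq> carrier R"
        "\<And>t. t \<in> carrier R \<Longrightarrow> eval P t = eval Q t \<otimes> (t \<ominus> a) \<oplus> eval P a"
        "set Q \<subseteq> N \<and> eval P a \<in> N \<longrightarrow> set P \<subseteq> N"
      using snoc.IH c(2) by blast
    define r where "r = eval P a"
    have r: "r \<in> carrier R" unfolding r_def using eval_in_carrier c ac by auto
    have P: "eval (P @ [c]) t = eval P t \<otimes> t \<oplus> c" if "t \<in> carrier R" for t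
      using eval_append_aux[OF c(2,1) that] .
    show ?thesis
    proof (intro exI[of _ "Q @ [r]"] conjI ballI impI)
      show "length (Q @ [r]) = length (P @ [c]) - 1" using Q(1) False by (cases P) auto
      show "set (Q @ [r]) \<subseteq> carrier R" using Q(2) r by auto
      fix t assume t: "t \<in> carrier R"
      define q where "q = eval Q t"
      have q: "q \<in> carrier R" unfolding q_def using eval_in_carrier[OF Q(2) t] .
      have "eval (P @ [c]) t = (q \<otimes> (t \<ominus> a) \<oplus> r) \<otimes> t \<oplus> c"
        using P[OF t] Q(3)[OF t] unfolding q_def r_def by simp
      also have "\<dots> = (q \<otimes> t \<oplus> r) \<otimes> (t \<ominus> a) \<oplus> (r \<otimes> a \<oplus> c)"
        using q r t ac c(1) by algebra
      also have "q \<otimes> t \<oplus> r = eval (Q @ [r]) t"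
        unfolding q_def using eval_append_aux[OF Q(2) r t] by simp
      also have "r \<otimes> a \<oplus> c = eval (P @ [c]) a" unfolding r_def using P[OF ac] by simp
      finally show "eval (P @ [c]) t = eval (Q @ [r]) t \<otimes> (t \<ominus> a) \<oplus> eval (P @ [c]) a" .
    next
      assume h: "set (Q @ [r]) \<subseteq> N \<and> eval (P @ [c]) a \<in> N"
      then have rN: "r \<in> N" and PN: "set P \<subseteq> N" using Q(4) unfolding r_def by auto
      have "(r \<otimes> a \<oplus> c) \<oplus> \<ominus> (r \<otimes> a) \<in> N"
        using h P[OF ac] rN a subringE(5,6,7)[OF N] unfolding r_def by simp
      moreover have "(r \<otimes> a \<oplus> c) \<oplus> \<ominus> (r \<otimes> a) = c" using r ac c(1) by algebra
      ultimately show "set (P @ [c]) \<subseteq> N" using PN by simp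
    qed
  qed
qed simp

text \<open>Newton interpolation. After division by X - a the quotient takes the values (P(t) -
  P(a)) / (t - a), again in \<open>N\<close>, at the remaining points; there is one point and one
  coefficient fewer. The coefficients of \<open>P\<close> then follow from
  \<open>synthetic_division\<close>.\<close>

lemma (in field) interpolation_coefficients:
  assumes N: "subfield N R"
  shows "\<lbrakk> set P \<subseteq> carrier R; T \<subseteq> N; finite T; length P \<le> card T; \<And>t. t \<in> T \<Longrightarrow> eval P t \<in> N \<rbrakk>
    \<Longrightarrow> set P \<subseteq> N"
proof (induction "length P" arbitrary: P T)
  case (Suc n)
  note SN = subfieldE(1)[OF N]
  have "T \<noteq> {}" using Suc.hyps(2) Suc.prems(4) by auto
  then obtain a where a: "a \<in> T" by blast
  have aN: "a \<in> N" and ac: "a \<in> carrier R" using a Suc.prems(2) subfieldE(3)[OF N] by auto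
  have "P \<noteq> []" using Suc.hyps(2) by auto
  then obtain Q where Q: "length Q = length P - 1" "set Q \<subseteq> carrier R"
      "\<And>t. t \<in> carrier R \<Longrightarrow> eval P t = eval Q t \<otimes> (t \<ominus> a) \<oplus> eval P a"
      "set Q \<subseteq> N \<and> eval P a \<in> N \<longrightarrow> set P \<subseteq> N"
    using synthetic_division[OF SN aN Suc.prems(1)] by blast
  have ev: "eval Q t \<in> N" if t: "t \<in> T - {a}" for t
  proof -
    have tN: "t \<in> N" and tc: "t \<in> carrier R" using t Suc.prems(2) subfieldE(3)[OF N] by auto
    define d where "d = t \<ominus> a"
    have "t \<oplus> \<ominus> a \<in> N" using subringE(7)[OF SN tN subringE(5)[OF SN aN]] .
    then have d: "d \<in> N" "d \<noteq> \<zero>" "d \<in> carrier R"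
      unfolding d_def a_minus_def[symmetric] using tc ac t by auto
    have q: "eval Q t \<in> carrier R" "eval P a \<in> carrier R"
      using eval_in_carrier[OF Q(2) tc] eval_in_carrier[OF Suc.prems(1) ac] by auto
    have "eval P t \<oplus> \<ominus> eval P a \<in> N"
      using Suc.prems(5) a t subringE(5,7)[OF SN] by auto
    moreover have "eval P t \<oplus> \<ominus> eval P a = d \<otimes> eval Q t"
      using Q(3)[OF tc] q d(3) unfolding d_def[symmetric] by (simp add: a_assoc r_neg m_comm)
    ultimately show ?thesis
      using subfield_m_inv_simprule[OF N, of d "eval Q t"] d q(1) by auto
  qed
  have "length Q \<le> card (T - {a})" using Q(1) Suc.prems(3,4) a by simp
  moreover have "n = length Q" using Q(1) Suc.hyps(2) by simp
  moreover have "T - {a} \<subseteq> N" "finite (T - {a})" using Suc.prems(2,3) by auto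
  ultimately have "set Q \<subseteq> N"
    using Suc.hyps(1)[of Q "T - {a}"] Q(2) ev by blast
  then show ?case using Q(4) Suc.prems(5)[OF a] by blast
qed simp

context algebraic_closure
begin

text \<open>Normality refers to the ring with carrier \<open>N\<close>, whereas roots are otherwise
  counted in the ambient field. The roots over \<open>N\<close> are the roots lying in
  \<open>N\<close>, with the same multiplicities; as \<open>p\<close> splits in the ambient field,
  their number is the degree exactly if none is missing.\<close>

lemma roots_in_subfield:
  assumes N: "subfield N L" "K \<subseteq> N" and p: "p \<in> carrier (K[X])" "p \<noteq> []"
  shows "ring.splitted (L\<lparr>carrier := N\<rparr>) p \<longleftrightarrow> set_mset (roots p) \<subseteq> N"
proof -
  interpret LN: field "L\<lparr>carrier := N\<rparr>" using subfield_iff(2)[OF N(1)] .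
  have eqN: "univ_poly (L\<lparr>carrier := N\<rparr>) = univ_poly L"
    using univ_poly_consistent[OF subfieldE(1)[OF N(1)]] .
  have pN: "p \<in> carrier (N[X])"
    using p(1) N(2) by (auto simp: univ_poly_carrier[symmetric] polynomial_def)
  have pL: "p \<in> carrier (poly_ring L)" using carrier_polynomial_shell[OF subfieldE(1)[OF N(1)] pN] .
  have pLN: "p \<in> carrier (poly_ring (L\<lparr>carrier := N\<rparr>))" using pN eqN by simp
  have pow: "l [^]\<^bsub>N[X]\<^esub> (n::nat) = l [^]\<^bsub>poly_ring L\<^esub> n" for l n
    by (induction n) (auto simp: univ_poly_mult univ_poly_one)
  \<comment> \<open>Multiplicity is defined by divisibility, which for polynomials over
    \<open>N\<close> means the same over \<open>N\<close> and over the ambient field.\<close>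
  have am: "LN.alg_mult p x = alg_mult p x" if x: "x \<in> N" for x
  proof -
    have xc: "x \<in> carrier L" using x subfieldE(3)[OF N(1)] by auto
    have neg: "\<ominus>\<^bsub>L\<lparr>carrier := N\<rparr>\<^esub> x = \<ominus> x"
    proof (rule LN.minus_equality)
      show "\<ominus> x \<oplus>\<^bsub>L\<lparr>carrier := N\<rparr>\<^esub> x = \<zero>\<^bsub>L\<lparr>carrier := N\<rparr>\<^esub>" using xc by (simp add: l_neg)
      show "x \<in> carrier (L\<lparr>carrier := N\<rparr>)" "\<ominus> x \<in> carrier (L\<lparr>carrier := N\<rparr>)"
        using x subringE(5)[OF subfieldE(1)[OF N(1)]] by auto
    qed
    have l: "[\<one>, \<ominus> x] \<in> carrier (N[X])"
      using x subringE(3,5)[OF subfieldE(1)[OF N(1)]]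
      by (auto simp: univ_poly_carrier[symmetric] polynomial_def)
    have "([\<one>, \<ominus> x] [^]\<^bsub>N[X]\<^esub> n) pdivides\<^bsub>L\<lparr>carrier := N\<rparr>\<^esub> p
        \<longleftrightarrow> ([\<one>, \<ominus> x] [^]\<^bsub>poly_ring L\<^esub> n) pdivides p" for n :: nat
    proof -
      have "[\<one>, \<ominus> x] [^]\<^bsub>N[X]\<^esub> n \<in> carrier (N[X])"
        using monoid.nat_pow_closed[OF univ_poly_is_monoid[OF subfieldE(1)[OF N(1)]] l] .
      then show ?thesis
        using pdivides_iff_shell[OF N(1) _ pN] pow eqN unfolding pdivides_def by simp
    qed
    then show ?thesis
      unfolding LN.alg_mult_def alg_mult_def using x xc p(2) neg eqN by simp
  qed
  have am': "LN.alg_mult p x = 0" if "x \<notin> N" for x unfolding LN.alg_mult_def using that by simp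
  have "count (LN.roots p) x = count (filter_mset (\<lambda>x. x \<in> N) (roots p)) x" for x
    using LN.alg_mult_eq_count_roots[OF pLN] alg_mult_eq_count_roots[OF pL] am[of x] am'[of x] by auto
  then have f: "LN.roots p = filter_mset (\<lambda>x. x \<in> N) (roots p)" by (intro multiset_eqI)
  have "LN.splitted p \<longleftrightarrow> size (filter_mset (\<lambda>x. x \<in> N) (roots p)) = size (roots p)"
    unfolding LN.splitted_def f using roots_over_subfield[OF p(1)] unfolding splitted_def by simp
  also have "\<dots> \<longleftrightarrow> filter_mset (\<lambda>x. x \<in> N) (roots p) = roots p"
    by (metis multiset_filter_subset mset_subset_size nat_less_le subset_mset.less_le)
  also have "\<dots> \<longleftrightarrow> set_mset (roots p) \<subseteq> N"
    by (auto simp: filter_mset_eq_conv)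
  finally show ?thesis .
qed

lemma normal_ext_conjugates:
  assumes "normal_ext K N" "x \<in> N"
  shows "conjugates x \<subseteq> N"
proof -
  have N: "subfield N L" "K \<subseteq> N" using assms(1) unfolding normal_ext_def by auto
  have x: "x \<in> carrier L" using assms(2) subfieldE(3)[OF N(1)] by auto
  note I = Irr_props[OF x]
  have "ring.splitted (L\<lparr>carrier := N\<rparr>) (Irr K x)"
    using assms I(1,6,8) unfolding normal_ext_def by blast
  then show ?thesis using roots_in_subfield[OF N I(1,4)] roots_Irr(1)[OF x] by simp
qed

lemma carrier_normal: "normal_ext K (carrier L)"
  unfolding normal_ext_def over_def
  using carrier_is_subfield K_in_carrier algebraic_extension roots_over_subfield by (simp add: over_def)

lemma Inter_normal:
  assumes "\<And>N. N \<in> \<N> \<Longrightarrow> normal_ext K N" "\<N> \<noteq> {}"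
  shows "normal_ext K (\<Inter>\<N>)"
proof -
  have N: "subfield N L" "K \<subseteq> N" if "N \<in> \<N>" for N
    using assms(1)[OF that] unfolding normal_ext_def by auto
  have "subring (\<Inter>\<N>) L" using subring_Inter[OF subfieldE(1)[OF N(1)] assms(2)] by blast
  moreover have KN: "K \<subseteq> \<Inter>\<N>" using N(2) by blast
  ultimately have SN: "subfield (\<Inter>\<N>) L" using subring_over_is_subfield by blast
  have "ring.splitted (L\<lparr>carrier := \<Inter>\<N>\<rparr>) p"
    if p: "p \<in> carrier (K[X])" "pirreducible K p" and x: "x \<in> \<Inter>\<N>" "eval p x = \<zero>" for p x
  proof -
    have p0: "p \<noteq> []" using pirreducible_degree[OF subfield_axioms p] by auto
    have "set_mset (roots p) \<subseteq> N" if "N \<in> \<N>" for N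
    proof -
      have "ring.splitted (L\<lparr>carrier := N\<rparr>) p"
        using assms(1)[OF that] p x that unfolding normal_ext_def by blast
      then show ?thesis using roots_in_subfield[OF N[OF that] p(1) p0] by simp
    qed
    then show ?thesis using roots_in_subfield[OF SN KN p(1) p0] by blast
  qed
  moreover have "(algebraic over K) x" if "x \<in> \<Inter>\<N>" for x
    using algebraic_extension subsetD[OF subfieldE(3)[OF SN] that] by simp
  ultimately show ?thesis unfolding normal_ext_def using SN KN by blast
qed

text \<open>Intersections of normal fields are normal, and the ambient field is one that contains
  \<open>E\<close>; hence the \<open>LEAST\<close> in the definition is attained by the intersection
  of all of them.\<close>

lemma normal_closure_props:
  assumes "E \<subseteq> carrier L"
  shows "E \<subseteq> normal_closure K E" "normal_ext K (normal_closure K E)"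
    "\<And>N. \<lbrakk> E \<subseteq> N; normal_ext K N \<rbrakk> \<Longrightarrow> normal_closure K E \<subseteq> N"
proof -
  define \<N> where "\<N> = {N. E \<subseteq> N \<and> normal_ext K N}"
  have "\<N> \<noteq> {}" unfolding \<N>_def using assms carrier_normal by blast
  then have n: "normal_ext K (\<Inter>\<N>)" using Inter_normal[of \<N>] unfolding \<N>_def by blast
  have "normal_closure K E = \<Inter>\<N>"
    unfolding normal_closure_def by (rule Least_equality) (use n in \<open>auto simp: \<N>_def\<close>)
  then show "E \<subseteq> normal_closure K E" "normal_ext K (normal_closure K E)"
    "\<And>N. \<lbrakk> E \<subseteq> N; normal_ext K N \<rbrakk> \<Longrightarrow> normal_closure K E \<subseteq> N"
    using n unfolding \<N>_def by auto
qed

lemma Int_subfield: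
  assumes "subfield A L" "K \<subseteq> A" "subfield B L" "K \<subseteq> B"
  shows "subfield (A \<inter> B) L" "K \<subseteq> A \<inter> B"
  using subring_over_is_subfield[OF subring_inter[OF subfieldE(1)[OF assms(1)] subfieldE(1)[OF assms(3)]]]
    assms by auto

text \<open>The \<open>GREATEST\<close> is attained because the separable elements form a field, so
  that the intersection is itself a candidate.\<close>

lemma max_separable_eq:
  assumes "subfield E L" "K \<subseteq> E"
  shows "max_separable K E = E \<inter> separables"
  unfolding max_separable_def
proof (rule Greatest_equality)
  show "E \<inter> separables \<subseteq> E \<and> separable_ext K (E \<inter> separables)"
    using Int_subfield[OF assms separables_subfield K_separable] algebraic_extension
    unfolding separable_ext_def separables_def by (auto simp: over_def)
  fix F assume "F \<subseteq> E \<and> separable_ext K F"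
  then show "F \<subseteq> E \<inter> separables"
    using subfieldE(3) unfolding separable_ext_def separables_def by blast
qed

text \<open>The definition asks for a single root, which \<open>inseparables_iff_conjugates\<close>
  translates into a power in \<open>K\<close>.\<close>

lemma max_purely_inseparable_eq:
  assumes "subfield E L" "K \<subseteq> E"
  shows "max_purely_inseparable K E = E \<inter> inseparables"
  unfolding max_purely_inseparable_def
proof (rule Greatest_equality)
  have i: "x \<in> inseparables \<longleftrightarrow> set_mset (roots (Irr K x)) = {x}" if "x \<in> carrier L" for x
    using inseparables_iff_conjugates[OF that] roots_Irr(1)[OF that] by simp
  have ic: "inseparables \<subseteq> carrier L" unfolding inseparables_def by auto
  have "(algebraic over K) x \<and> set_mset (roots (Irr K x)) = {x}" if "x \<in> E \<inter> inseparables" for x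
    using that i[of x] ic algebraic_extension[of x] by blast
  then show "E \<inter> inseparables \<subseteq> E \<and> purely_inseparable_ext K (E \<inter> inseparables)"
    using Int_subfield[OF assms inseparables_subfield K_inseparable]
    unfolding purely_inseparable_ext_def by blast
  fix F assume F: "F \<subseteq> E \<and> purely_inseparable_ext K F"
  then have FL: "F \<subseteq> carrier L" using subfieldE(3) unfolding purely_inseparable_ext_def by blast
  show "F \<subseteq> E \<inter> inseparables"
  proof
    fix x assume x: "x \<in> F"
    then have "set_mset (roots (Irr K x)) = {x}" using F unfolding purely_inseparable_ext_def by simp
    then show "x \<in> E \<inter> inseparables" using i[of x] x FL F by auto
  qed
qed

text \<open>
  With \<open>y = x\<^sup>q\<close> separable, \<open>y = \<Sum>k\<^sub>j y\<^sup>q\<^sup>j\<close> yields \<open>x = \<Sum>c\<^sub>j y\<^sup>j\<close> for the \<open>q\<close>-th roots \<open>c\<^sub>j\<close> of the \<open>k\<^sub>j\<close>. The same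
  relation holds for all conjugates of \<open>x\<close>, so interpolation puts the \<open>c\<^sub>j\<close> into \<open>N\<close>.
\<close>
lemma normal_decomposition:
  assumes N: "normal_ext K N"
  shows "N \<subseteq> prods (N \<inter> inseparables) (N \<inter> separables)"
proof
  fix x assume xN: "x \<in> N"
  have Nf: "subfield N L" "K \<subseteq> N" using N unfolding normal_ext_def by auto
  have x: "x \<in> carrier L" using xN subfieldE(3)[OF Nf(1)] by auto
  obtain q where q: "frobenius_exponent q" "mult_free_min_poly (x [^] q)"
      "\<And>y. y \<in> carrier L \<Longrightarrow> y \<in> conjugates x \<longleftrightarrow> y [^] q \<in> conjugates (x [^] q)"
    by (rule separable_power_exists[OF x], rule that)
  have q0: "q > 0" using q(1) unfolding frobenius_exponent_def by simp
  define h where "h = (\<lambda>t. t [^] q)"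
  interpret h: ring_hom_ring L L h unfolding h_def using frobenius_hom[OF q(1)] .
  define y where "y = h x"
  have y: "y \<in> carrier L" "y \<in> separables" "y \<in> N" "mult_free_min_poly y"
    unfolding y_def h_def separables_def using x q(2) subring_pow[OF subfieldE(1)[OF Nf(1)] xN] by auto
  define d where "d = degree (Irr K y)"
  have hy: "h y \<in> carrier L" using y(1) by simp
  have "independent K (exp_base y d)"
    unfolding d_def using exp_base_independent[OF subfield_axioms y(1) algebraic_extension[OF y(1)]] .
  moreover have "set (exp_base y d) \<subseteq> finite_extension K [y]"
    using exp_base_in_subfield[of "finite_extension K [y]" y d] finite_extension_props[of "[y]"] y(1)
    by (simp del: finite_extension.simps)
  ultimately have ind: "independent K (exp_base (h y) d)"
    using independent_pow[of "[y]" "exp_base y d" q] y(2) q(1) exp_base_pow[OF y(1)] unfolding h_def by simp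
  have ext: "simple_extension K (h y) = simple_extension K y"
    using separable_pow(1)[OF y(2) q(1)] unfolding h_def .
  \<comment> \<open>y^q generates the same field as y, so its first d powers form a basis too; this
    gives y coordinates \<open>ks\<close> in \<open>K\<close> with respect to powers of y^q.\<close>
  have "Span K (exp_base (h y) d) = simple_extension K y"
  proof -
    have "set (exp_base (h y) d) \<subseteq> simple_extension K y"
      using exp_base_in_subfield[OF simple_extension_props(1,3)[OF hy]] ext by auto
    moreover have "length (exp_base (h y) d) = d" unfolding exp_base_def by simp
    ultimately show ?thesis
      using independent_length_eq_dimension[OF subfield_axioms simple_extension_props(4)[OF y(1)] ind]
      unfolding d_def by blast
  qed
  then have "y \<in> Span K (exp_base (h y) d)" using simple_extension_props(3)[OF y(1)] by simp
  then obtain ks where ks: "set ks \<subseteq> K" "length ks = d" "y = combine ks (exp_base (h y) d)"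
    using Span_mem_iff_length_version[OF subfield_axioms exp_base_closed[OF hy]]
    by (auto simp: exp_base_def)
  have ye: "eval ks (h y) = y" using ks combine_eq_eval[of ks "h y"] by simp
  define cs where "cs = map (\<lambda>k. SOME c. c \<in> carrier L \<and> h c = k) ks"
  have cs1: "(SOME c. c \<in> carrier L \<and> h c = k) \<in> carrier L \<and> h (SOME c. c \<in> carrier L \<and> h c = k) = k"
    if "k \<in> set ks" for k
  proof (rule someI_ex)
    have "k \<in> carrier L" using that ks(1) K_in_carrier by auto
    then show "\<exists>c. c \<in> carrier L \<and> h c = k" unfolding h_def using root_exists[OF _ q0] by metis
  qed
  have cs: "set cs \<subseteq> carrier L" "map h cs = ks" "length cs = d"
    unfolding cs_def using cs1 ks(2) by (auto simp: map_idI)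
  have hinj: "s = t" if "s \<in> carrier L" "t \<in> carrier L" "h s = h t" for s t
    using frobenius_inj[OF q(1)] that unfolding h_def by (auto dest: inj_onD)
  have ev: "eval cs (h z) = z" if z: "z \<in> conjugates x" for z
  proof -
    have zc: "z \<in> carrier L" using z conjugates_in_carrier by auto
    have hz: "h z \<in> carrier L" "h z \<in> conjugates y"
      unfolding h_def y_def using zc q(3)[OF zc] z by auto
    \<comment> \<open>Read as a polynomial, \<open>ks\<close> satisfies ks(y^q) = y. So P = ks(X^q)
      - X vanishes at y and at its conjugate \<open>h z\<close>; extracting q-th roots from the
      relation for \<open>h z\<close> gives the one for z.\<close>
    define P where "P = poly_add (expand q ks) [\<ominus> \<one>, \<zero>]"
    have "set [\<ominus> \<one>, \<zero>] \<subseteq> K"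
      using subringE(2,3)[OF subfieldE(1)[OF subfield_axioms]]
        subringE(5)[OF subfieldE(1)[OF subfield_axioms], of \<one>] by simp
    then have PK: "set P \<subseteq> K"
      unfolding P_def
      using polynomial_incl[OF poly_add_is_polynomial[OF subfieldE(1)[OF subfield_axioms] expand_in_K[OF ks(1)]]]
      by blast
    have ksc: "set ks \<subseteq> carrier L" using ks(1) K_in_carrier by auto
    have eP: "eval P t = eval ks (h t) \<oplus> \<ominus> t" if t: "t \<in> carrier L" for t
    proof -
      have "set (expand q ks) \<subseteq> carrier L" using expand_in_K[OF ks(1), of q] K_in_carrier by blast
      then have "eval P t = eval (expand q ks) t \<oplus> eval [\<ominus> \<one>, \<zero>] t"
        unfolding P_def using eval_poly_add[of "expand q ks" "[\<ominus> \<one>, \<zero>]" t] t by simp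
      then show ?thesis using eval_expand[OF ksc q0 t] t unfolding h_def by (simp add: l_minus)
    qed
    have "eval P y = \<zero>" using eP[OF y(1)] ye y(1) by (simp add: r_neg)
    then have "eval P (h z) = \<zero>" using conjugate_root[OF y(1) hz(2) PK] by simp
    then have "eval ks (h (h z)) = h z"
      using eP[OF hz(1)] hz(1) eval_in_carrier[OF ksc, of "h (h z)"]
      by (metis a_minus_def h.hom_closed r_right_minus_eq)
    moreover have "h (eval cs (h z)) = eval ks (h (h z))"
      using h.eval_hom'[OF hz(1) cs(1)] cs(2) by simp
    ultimately show ?thesis using hinj[OF eval_in_carrier[OF cs(1) hz(1)] zc] by simp
  qed
  have hc: "h ` conjugates x = conjugates y" "card (conjugates y) = d"
    using conjugates_pow_image(1)[OF x q(1,3)] mult_free_iff_card_conjugates(1)[OF y(1)] y(4)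
    unfolding h_def y_def d_def by auto
  have "set cs \<subseteq> N"
  \<comment> \<open>\<open>cs\<close> has \<open>d\<close> coefficients, and at the \<open>d\<close>
    distinct conjugates of \<open>y\<close> its values are conjugates of \<open>x\<close>, all of
    which lie in \<open>N\<close>.\<close>
  proof (rule interpolation_coefficients[OF Nf(1) cs(1), of "conjugates y"])
    show "conjugates y \<subseteq> N" using normal_ext_conjugates[OF N y(3)] .
    show "finite (conjugates y)" using roots_Irr(3)[OF y(1)] .
    show "length cs \<le> card (conjugates y)" using hc(2) cs(3) by simp
    show "eval cs t \<in> N" if t: "t \<in> conjugates y" for t
    proof -
      obtain z where z: "z \<in> conjugates x" "t = h z" using t hc(1) by blast
      then show ?thesis using ev[OF z(1)] normal_ext_conjugates[OF N xN] by auto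
    qed
  qed
  moreover have "set cs \<subseteq> inseparables"
  proof
    fix c assume c: "c \<in> set cs"
    have "h c \<in> K" using c cs(2) ks(1) by auto
    then show "c \<in> inseparables" using c cs(1) q(1) unfolding inseparables_def h_def by blast
  qed
  moreover have "x = combine cs (exp_base y d)"
    using ev[OF self_conjugate[OF x]] combine_eq_eval[of cs y] cs(3) unfolding y_def by simp
  moreover have "set (exp_base y d) \<subseteq> N \<inter> separables"
    using exp_base_in_subfield[OF Nf(1) y(3)] exp_base_in_subfield[OF separables_subfield y(2)] by blast
  ultimately show "x \<in> prods (N \<inter> inseparables) (N \<inter> separables)"
    using combine_in_prods[of cs "N \<inter> inseparables"] by blast
qed

end

section \<open>Isomorphisms between composita\<close>


locale ld_normal_fields = ld_fields +
  assumes N1_normal: "normal_ext K N1" and N2_normal: "normal_ext K N2"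
begin

lemma prods_Int_inseparables:
  assumes A: "subfield A L" "K \<subseteq> A" "A \<subseteq> N1" and B: "subfield B L" "K \<subseteq> B" "B \<subseteq> N2"
  shows "prods A B \<inter> inseparables = prods (A \<inter> inseparables) (B \<inter> inseparables)"
proof
  note I = inseparables_subfield K_inseparable and S = separables_subfield K_separable
  note NI1 = Int_subfield[OF N1 I] and NI2 = Int_subfield[OF N2 I]
  note NS1 = Int_subfield[OF N1 S] and NS2 = Int_subfield[OF N2 S]
  show "prods (A \<inter> inseparables) (B \<inter> inseparables) \<subseteq> prods A B \<inter> inseparables"
    using prods_subset_subring[OF subfieldE(1)[OF I(1)], of "A \<inter> inseparables" "B \<inter> inseparables"]
      prods_mono[of "A \<inter> inseparables" A "B \<inter> inseparables" B] by auto
  \<comment> \<open>\<open>P\<close> and \<open>Q\<close> are the fields called I and S in the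
    overview.\<close>
  define P Q where "P = prods (N1 \<inter> inseparables) (N2 \<inter> inseparables)"
    and "Q = prods (N1 \<inter> separables) (N2 \<inter> separables)"
  have P: "subfield P L" "K \<subseteq> P" "N1 \<inter> inseparables \<subseteq> P" "N2 \<inter> inseparables \<subseteq> P" "P \<subseteq> inseparables"
    unfolding P_def using prods_is_subfield[OF NI1(1) NI2(1) NI1(2)]
      prods_incl[OF subfieldE(1)[OF NI1(1)] subfieldE(1)[OF NI2(1)]] NI1(2)
      prods_subset_subring[OF subfieldE(1)[OF I(1)], of "N1 \<inter> inseparables" "N2 \<inter> inseparables"]
    by auto
  have Q: "subfield Q L" "N1 \<inter> separables \<subseteq> Q" "N2 \<inter> separables \<subseteq> Q" "Q \<subseteq> separables"
    unfolding Q_def using prods_is_subfield[OF NS1(1) NS2(1) NS1(2)]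
      prods_incl[OF subfieldE(1)[OF NS1(1)] subfieldE(1)[OF NS2(1)]]
      prods_subset_subring[OF subfieldE(1)[OF S(1)], of "N1 \<inter> separables" "N2 \<inter> separables"]
    by auto
  have "N1 \<subseteq> prods P Q" "N2 \<subseteq> prods P Q"
    using normal_decomposition[OF N1_normal] normal_decomposition[OF N2_normal]
      prods_mono[OF P(3) Q(2)] prods_mono[OF P(4) Q(3)] by blast+
  then have "prods N1 N2 \<subseteq> prods P Q"
    using prods_subset_subring[OF prods_is_subring[OF subfieldE(1)[OF P(1)] subfieldE(1)[OF Q(1)]]] by blast
  also have "\<dots> \<subseteq> prods P separables" using prods_mono[OF subset_refl Q(4)] .
  finally have sub: "prods A B \<subseteq> prods P separables" using prods_mono[OF A(3) B(3)] by blast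
  \<comment> \<open>With respect to the list [1] the only coordinate of \<open>z\<close> is
    \<open>z\<close> itself, so \<open>linearly_disjoint_coords\<close> puts \<open>z\<close> into
    \<open>P\<close>.\<close>
  have one: "independent K [\<one>]" "set [\<one>] \<subseteq> separables"
    using subringE(3)[OF subfieldE(1)[OF S(1)]] by (auto intro!: li_Cons)
  show "prods A B \<inter> inseparables \<subseteq> prods (A \<inter> inseparables) (B \<inter> inseparables)"
  proof
    fix z assume z: "z \<in> prods A B \<inter> inseparables"
    then have zc: "z \<in> carrier L" unfolding inseparables_def by auto
    have "combine [z] [\<one>] = z" using zc by simp
    then have "set [z] \<subseteq> P"
      using linearly_disjoint_coords[OF S I(1) separables_inseparables_disjoint P(1,2,5) one, of "[z]"] z sub
      by auto
    then have "z \<in> prods A B \<inter> prods (N1 \<inter> inseparables) (N2 \<inter> inseparables)" using z unfolding P_def by auto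
    also have "\<dots> = prods (A \<inter> (N1 \<inter> inseparables)) (B \<inter> (N2 \<inter> inseparables))"
      using Int_prods[OF A NI1 _ B NI2] by blast
    also have "\<dots> = prods (A \<inter> inseparables) (B \<inter> inseparables)"
      using A(3) B(3) by (simp add: Int_assoc[symmetric] Int_absorb2)
    finally show "z \<in> prods (A \<inter> inseparables) (B \<inter> inseparables)" .
  qed
qed

end

context algebraic_closure
begin

lemma K_isos_iff:
  assumes "subfield E L" "subfield F L"
  shows "h \<in> K_isos K E F \<longleftrightarrow> h \<in> extensional E \<and>
    (\<forall>x\<in>E. \<forall>y\<in>E. h (x \<otimes> y) = h x \<otimes> h y \<and> h (x \<oplus> y) = h x \<oplus> h y) \<and>
    h \<one> = \<one> \<and> bij_betw h E F \<and> (\<forall>k\<in>K. h k = k)"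
  unfolding K_isos_def ring_iso_def ring_hom_def by (auto simp: bij_betw_apply)

lemma K_isosD:
  assumes "subfield E L" "subfield F L" "h \<in> K_isos K E F"
  shows "h \<in> extensional E" "\<And>x y. \<lbrakk> x \<in> E; y \<in> E \<rbrakk> \<Longrightarrow> h (x \<otimes> y) = h x \<otimes> h y"
    "\<And>x y. \<lbrakk> x \<in> E; y \<in> E \<rbrakk> \<Longrightarrow> h (x \<oplus> y) = h x \<oplus> h y" "h \<one> = \<one>" "bij_betw h E F"
    "\<And>k. k \<in> K \<Longrightarrow> h k = k" "h ` E = F" "inj_on h E" "\<And>x. x \<in> E \<Longrightarrow> h x \<in> F" "h \<zero> = \<zero>"
  using assms(3)[unfolded K_isos_iff[OF assms(1,2)]] subringE(2)[OF subfieldE(1)[OF subfield_axioms]]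
  by (auto simp: bij_betw_def)

lemma K_isos_combine:
  assumes E: "subfield E L" and F: "subfield F L" and h: "h \<in> K_isos K E F"
    and "set as \<subseteq> E" "set bs \<subseteq> E"
  shows "h (combine as bs) = combine (map h as) (map h bs)"
  using assms(4,5)
proof (induction as bs rule: combine.induct)
  case (1 a as b bs)
  note sub = subringE(6,7)[OF subfieldE(1)[OF E]]
  have "combine as bs \<in> E"
    using combine_in_prods[of as E bs E] prods_subset_subring[OF subfieldE(1)[OF E]] 1 by auto
  then show ?case using 1 sub K_isosD(2,3)[OF E F h] by simp
qed (use K_isosD(10)[OF E F h] in auto)

text \<open>Fixing \<open>K\<close>, the map \<open>h\<close> commutes with the evaluation of
  \<open>Irr K x\<close>. Together with \<open>normal_ext_conjugates\<close> this keeps images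
  inside normal fields.\<close>

lemma K_isos_conjugate:
  assumes E: "subfield E L" "K \<subseteq> E" and F: "subfield F L" and h: "h \<in> K_isos K E F" and x: "x \<in> E"
  shows "h x \<in> conjugates x"
proof -
  note SE = subfieldE(1)[OF E(1)]
  have c: "x \<in> carrier L" "h x \<in> carrier L"
    using x subfieldE(3)[OF E(1)] subfieldE(3)[OF F] K_isosD(9)[OF E(1) F h x] by auto
  have pw: "h (x [^] (n::nat)) = h x [^] n" for n
    by (induction n) (use K_isosD(2,4)[OF E(1) F h] subring_pow[OF SE x] x in auto)
  have ev: "h (eval P x) = eval P (h x)" if "set P \<subseteq> K" for P
  proof -
    have "h (eval P x) = h (combine P (exp_base x (length P)))" by (simp add: combine_eq_eval)
    also have "\<dots> = combine (map h P) (map h (exp_base x (length P)))"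
      using K_isos_combine[OF E(1) F h] that E(2) exp_base_in_subfield[OF E(1) x] by blast
    also have "map h P = P" using that K_isosD(6)[OF E(1) F h] by (auto intro: map_idI)
    also have "map h (exp_base x (length P)) = exp_base (h x) (length P)"
      unfolding exp_base_def using pw by simp
    finally show ?thesis by (simp add: combine_eq_eval)
  qed
  have "eval (Irr K x) (h x) = h \<zero>" using ev[OF Irr_props(3)[OF c(1)]] Irr_props(6)[OF c(1)] by simp
  then show ?thesis using c(2) K_isosD(10)[OF E(1) F h] unfolding conjugates_def by simp
qed

lemma K_isos_image_subfield:
  assumes T: "subfield T L" and F: "subfield F L" and h: "h \<in> K_isos K T F"
    and E: "subfield E L" "K \<subseteq> E" "E \<subseteq> T"
  shows "subfield (h ` E) L" "restrict h E \<in> K_isos K E (h ` E)" "K \<subseteq> h ` E"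
proof -
  note D = K_isosD[OF T F h] and SE = subringE[OF subfieldE(1)[OF E(1)]]
  show Kh: "K \<subseteq> h ` E" using D(6) E(2) by (metis image_eqI subset_iff)
  have neg: "\<ominus> h x = h (\<ominus> x)" if x: "x \<in> E" for x
  proof -
    have c: "x \<in> carrier L" "\<ominus> x \<in> E" using x subfieldE(3)[OF E(1)] SE(5) by auto
    have hc: "h x \<in> carrier L" "h (\<ominus> x) \<in> carrier L" using D(9) E(3) x c subfieldE(3)[OF F] by blast+
    have "h (\<ominus> x) \<oplus> h x = h (\<ominus> x \<oplus> x)" using D(3)[OF subsetD[OF E(3) c(2)] subsetD[OF E(3) x]] by simp
    then have "h (\<ominus> x) \<oplus> h x = \<zero>" using D(10) c(1) by (simp add: l_neg)
    then show ?thesis using minus_equality hc by blast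
  qed
  have "subring (h ` E) L"
  proof (rule subringI)
    show "h ` E \<subseteq> carrier L" using D(9) E(3) subfieldE(3)[OF F] by blast
    show "\<one> \<in> h ` E" using D(4) SE(3) by (metis image_eqI)
    show "\<ominus> y \<in> h ` E" if y: "y \<in> h ` E" for y using y neg SE(5) by auto
    fix u v assume "u \<in> h ` E" "v \<in> h ` E"
    then obtain x y where xy: "x \<in> E" "y \<in> E" "u = h x" "v = h y" by auto
    then have "u \<otimes> v = h (x \<otimes> y)" "u \<oplus> v = h (x \<oplus> y)" using D(2,3)[of x y] subsetD[OF E(3)] by auto
    then show "u \<otimes> v \<in> h ` E" "u \<oplus> v \<in> h ` E" using SE(6,7) xy by auto
  qed
  then show sf: "subfield (h ` E) L" using subring_over_is_subfield Kh by blast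
  show "restrict h E \<in> K_isos K E (h ` E)"
    unfolding K_isos_iff[OF E(1) sf]
    using D(2,3,4,6) E(2,3) SE(3,6,7) inj_on_subset[OF D(8) E(3)]
    by (auto simp: bij_betw_def inj_on_def subset_iff)
qed

end

context ld_fields
begin

text \<open>A \<open>K\<close>-basis of \<open>G\<close> is an \<open>E\<close>-basis of the first
  compositum, and its image under \<open>g\<close> is an \<open>F1\<close>-basis of the second;
  \<open>h\<close> applies \<open>f\<close> to the coordinates. Bijectivity is then visible in
  coordinates, whereas multiplicativity is checked on products of one element from each
  factor.\<close>

lemma K_isos_extend:
  assumes E: "subfield E L" "K \<subseteq> E" "E \<subseteq> N1" and F1: "subfield F1 L" "K \<subseteq> F1" "F1 \<subseteq> N1"
    and G: "subfield G L" "K \<subseteq> G" "G \<subseteq> N2" "finite_dimension K G"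
    and F2: "subfield F2 L" "K \<subseteq> F2" "F2 \<subseteq> N2"
    and f: "f \<in> K_isos K E F1" and g: "g \<in> K_isos K G F2"
  shows "\<exists>h\<in>K_isos K (prods E G) (prods F1 F2). (\<forall>x\<in>E. h x = f x) \<and> (\<forall>y\<in>G. h y = g y)"
proof -
  note KK = subfield_axioms
  note fD = K_isosD[OF E(1) F1(1) f] and gD = K_isosD[OF G(1) F2(1) g]
  have Ec: "E \<subseteq> carrier L" and Gc: "G \<subseteq> carrier L" and F1c: "F1 \<subseteq> carrier L" and F2c: "F2 \<subseteq> carrier L"
    using subfieldE(3) E G F1 F2 by auto
  note T = prods_is_subfield[OF E(1) G(1) E(2)] and U = prods_is_subfield[OF F1(1) F2(1) F1(2)]
  obtain us where us: "set us \<subseteq> carrier L" "independent K us" "Span K us = G"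
    using exists_base[OF KK finite_dimensionE[OF KK G(4)]] by blast
  have usG: "set us \<subseteq> G" using Span_base_incl[OF KK us(1)] us(3) by simp
  define vs where "vs = map g us"
  have vsF: "set vs \<subseteq> F2" unfolding vs_def using gD(9) usG by auto
  then have vsc: "set vs \<subseteq> carrier L" using F2c by auto
  have gc: "g (combine ks us) = combine ks vs" if "set ks \<subseteq> K" for ks
  proof -
    have "map g ks = ks" using that gD(6) by (auto intro: map_idI)
    then show ?thesis
      using K_isos_combine[OF G(1) F2(1) g _ usG, of ks] that G(2) unfolding vs_def by auto
  qed
  have vsS: "Span K vs = F2"
  proof -
    have "Span K vs = g ` Span K us"
      unfolding Span_eq_combine_set[OF KK vsc] Span_eq_combine_set[OF KK us(1)] using gc by force
    then show ?thesis using us(3) gD(7) by simp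
  qed
  have ind: "independent A Ws" if "independent K Ws" "set Ws \<subseteq> N2" "subfield A L" "A \<subseteq> N1" for A Ws
    using ld' that independent_mono[OF that(3) N1(1) that(4)] unfolding linearly_disjoint_def over_def by blast
  have vsK: "independent K vs"
  proof (rule trivial_combine_imp_independent[OF KK vsc])
    fix ks assume ks: "set ks \<subseteq> K" "combine ks vs = \<zero>"
    have "g (combine ks us) = g \<zero>" using gc[OF ks(1)] ks(2) gD(10) by simp
    moreover have "combine ks us \<in> G" using ks(1) us(3) Span_eq_combine_set[OF KK us(1)] by blast
    ultimately have "combine ks us = \<zero>"
      using gD(8) subringE(2)[OF subfieldE(1)[OF G(1)]] by (auto dest: inj_onD)
    then show "set (take (length vs) ks) \<subseteq> {\<zero>}"
      using independent_imp_trivial_combine[OF KK us(2) ks(1)] unfolding vs_def by simp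
  qed
  have iE: "independent E us" using ind[OF us(2) _ E(1,3)] usG G(3) by blast
  have iF: "independent F1 vs" using ind[OF vsK _ F1(1,3)] vsF F2(3) by blast
  have TS: "prods E G = Span E us" using prods_eq_Span[OF KK E(1,2) us(1)] us(3) by simp
  have US: "prods F1 F2 = Span F1 vs" using prods_eq_Span[OF KK F1(1,2) vsc] vsS by simp
  define co where "co x = (THE cs. set cs \<subseteq> E \<and> length cs = length us \<and> x = combine cs us)" for x
  have co: "set (co x) \<subseteq> E \<and> length (co x) = length us \<and> x = combine (co x) us" if "x \<in> prods E G" for x
    unfolding co_def by (rule theI') (use unique_decomposition[OF E(1) iE] that TS in blast)
  have co_eq: "co (combine cs us) = cs" if "set cs \<subseteq> E" "length cs = length us" for cs
    unfolding co_def
  proof (rule the_equality)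
    have "combine cs us \<in> Span E us" using that Span_mem_iff_length_version[OF E(1) us(1)] by blast
    then show "ds = cs" if "set ds \<subseteq> E \<and> length ds = length us \<and> combine cs us = combine ds us" for ds
      using unique_decomposition[OF E(1) iE] that \<open>set cs \<subseteq> E\<close> \<open>length cs = length us\<close> by blast
  qed (use that in auto)
  define h where "h = restrict (\<lambda>x. combine (map f (co x)) vs) (prods E G)"
  have hcomb: "h (combine cs us) = combine (map f cs) vs" if "set cs \<subseteq> E" "length cs = length us" for cs
  proof -
    have "combine cs us \<in> prods E G" unfolding TS
      using that Span_mem_iff_length_version[OF E(1) us(1)] by blast
    then show ?thesis unfolding h_def using co_eq[OF that] by simp
  qed
  have hadd: "h (x \<oplus> y) = h x \<oplus> h y" if xy: "x \<in> prods E G" "y \<in> prods E G" for x y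
  proof -
    define cs ds where "cs = co x" and "ds = co y"
    have cs: "set cs \<subseteq> E" "length cs = length us" "x = combine cs us"
      and ds: "set ds \<subseteq> E" "length ds = length us" "y = combine ds us"
      using co xy unfolding cs_def ds_def by auto
    have len: "length cs = length ds" using cs(2) ds(2) by simp
    have s: "set (map2 (\<oplus>) cs ds) \<subseteq> E"
      using len cs(1) ds(1) subringE(7)[OF subfieldE(1)[OF E(1)]] by (induction cs ds rule: list_induct2) auto
    have m: "map f (map2 (\<oplus>) cs ds) = map2 (\<oplus>) (map f cs) (map f ds)"
      using len cs(1) ds(1) fD(3) by (induction cs ds rule: list_induct2) auto
    have fcs: "set (map f cs) \<subseteq> carrier L" "set (map f ds) \<subseteq> carrier L" using cs ds fD(9) F1c by auto
    have "x \<oplus> y = combine (map2 (\<oplus>) cs ds) us"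
      using combine_add[of cs us ds] cs ds Ec us(1) by auto
    then have "h (x \<oplus> y) = combine (map2 (\<oplus>) (map f cs) (map f ds)) vs"
      using hcomb[OF s] cs(2) ds(2) m by simp
    also have "\<dots> = combine (map f cs) vs \<oplus> combine (map f ds) vs"
      using combine_add[of "map f cs" vs "map f ds"] cs(2) ds(2) fcs vsc unfolding vs_def by simp
    finally show ?thesis using hcomb cs ds by simp
  qed
  \<comment> \<open>The coordinates of \<open>b\<close> lie in \<open>K\<close> and are fixed by
    \<open>f\<close>, so e b goes to f(e) g(b). This formula no longer mentions the basis and gives
    multiplicativity without structure constants.\<close>
  have hsmult: "h (e \<otimes> b) = f e \<otimes> g b" if e: "e \<in> E" and b: "b \<in> G" for e b
  proof -
    obtain ks where ks: "set ks \<subseteq> K" "length ks = length us" "b = combine ks us"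
      using b us(3) Span_mem_iff_length_version[OF KK us(1)] by blast
    have kE: "set (map ((\<otimes>) e) ks) \<subseteq> E"
      using ks(1) E(2) e subringE(6)[OF subfieldE(1)[OF E(1)]] by auto
    have kc: "set ks \<subseteq> carrier L" using ks(1) K_in_carrier by auto
    have ec: "e \<in> carrier L" "f e \<in> carrier L" using e Ec fD(9) F1c by auto
    have "e \<otimes> b = combine (map ((\<otimes>) e) ks) us"
      using combine_r_distr[OF kc us(1)] ec(1) ks(3) by blast
    then have "h (e \<otimes> b) = combine (map f (map ((\<otimes>) e) ks)) vs" using hcomb[OF kE] ks(2) by simp
    also have "map f (map ((\<otimes>) e) ks) = map ((\<otimes>) (f e)) ks"
      unfolding map_map
      using fD(2)[OF e] fD(6) ks(1) E(2) by (intro map_cong refl) (simp add: subset_iff)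
    also have "combine (map ((\<otimes>) (f e)) ks) vs = f e \<otimes> combine ks vs"
      using combine_r_distr[OF kc vsc] ec(2) by metis
    finally show ?thesis using gc[OF ks(1)] ks(3) by simp
  qed
  have one: "\<one> \<in> E" "\<one> \<in> G" using subringE(3) subfieldE(1) E G by auto
  have hf: "h x = f x" if x: "x \<in> E" for x
  proof -
    have "x \<in> carrier L" "f x \<in> carrier L" using x Ec fD(9) F1c by auto
    then show ?thesis using hsmult[OF x one(2)] gD(4) by simp
  qed
  have hg: "h y = g y" if y: "y \<in> G" for y
  proof -
    have "y \<in> carrier L" "g y \<in> carrier L" using y Gc gD(9) F2c by auto
    then show ?thesis using hsmult[OF one(1) y] fD(4) by simp
  qed
  have pc: "prods E G \<subseteq> carrier L" using subfieldE(3)[OF T] .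
  have himg: "h x \<in> prods F1 F2" if x: "x \<in> prods E G" for x
  proof -
    have "set (map f (co x)) \<subseteq> F1" using co[OF x] fD(9) by auto
    then have "combine (map f (co x)) vs \<in> Span F1 vs" unfolding Span_eq_combine_set[OF F1(1) vsc] by blast
    then show ?thesis unfolding US h_def using x by simp
  qed
  have h0: "h \<zero> = \<zero>" using hf[of \<zero>] fD(10) subringE(2)[OF subfieldE(1)[OF E(1)]] by simp
  have uc: "prods F1 F2 \<subseteq> carrier L" using subfieldE(3)[OF U] .
  note TR = subringE[OF subfieldE(1)[OF T]]
  \<comment> \<open>Here the left argument is a single product and the induction runs over the right
    one; \<open>hmult\<close> then runs over the left one.\<close>
  have hmult1: "h ((e \<otimes> b) \<otimes> y) = h (e \<otimes> b) \<otimes> h y"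
    if e: "e \<in> E" and b: "b \<in> G" and y: "y \<in> prods E G" for e b y
    using y
  proof induction
    case zero
    have "e \<otimes> b \<in> carrier L" "h (e \<otimes> b) \<in> carrier L"
      using e b Ec Gc himg prods_single[OF Ec Gc e b] uc by auto
    then show ?case using h0 by simp
  next
    case (step a' b' z)
    have eb: "e \<otimes> b \<in> prods E G" "a' \<otimes> b' \<in> prods E G"
      using prods_single[OF Ec Gc] e b step by auto
    have c: "e \<in> carrier L" "b \<in> carrier L" "a' \<in> carrier L" "b' \<in> carrier L" "z \<in> carrier L"
      using e b step(1-3) Ec Gc pc by auto
    have hc: "h (e \<otimes> b) \<in> carrier L" "h (a' \<otimes> b') \<in> carrier L" "h z \<in> carrier L"
      using himg eb step(3) uc by auto
    have fc: "f e \<in> carrier L" "g b \<in> carrier L" "f a' \<in> carrier L" "g b' \<in> carrier L"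
      using e b step(1,2) fD(9) gD(9) F1c F2c by auto
    have ea: "e \<otimes> a' \<in> E" "b \<otimes> b' \<in> G"
      using subringE(6)[OF subfieldE(1)[OF E(1)] e step(1)] subringE(6)[OF subfieldE(1)[OF G(1)] b step(2)] by auto
    have split: "(e \<otimes> b) \<otimes> (a' \<otimes> b' \<oplus> z) = (e \<otimes> a') \<otimes> (b \<otimes> b') \<oplus> (e \<otimes> b) \<otimes> z"
      using c by algebra
    have "h ((e \<otimes> b) \<otimes> (a' \<otimes> b' \<oplus> z)) = h ((e \<otimes> a') \<otimes> (b \<otimes> b')) \<oplus> h ((e \<otimes> b) \<otimes> z)"
      unfolding split by (rule hadd[OF prods_single[OF Ec Gc ea] TR(6)[OF eb(1) step(3)]])
    also have "h ((e \<otimes> a') \<otimes> (b \<otimes> b')) = (f e \<otimes> f a') \<otimes> (g b \<otimes> g b')"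
      using hsmult[OF ea] fD(2)[OF e step(1)] gD(2)[OF b step(2)] by simp
    also have "\<dots> = (f e \<otimes> g b) \<otimes> (f a' \<otimes> g b')" using fc by (simp add: m_ac)
    also have "\<dots> = h (e \<otimes> b) \<otimes> h (a' \<otimes> b')" using hsmult[OF e b] hsmult[OF step(1,2)] by simp
    also have "h ((e \<otimes> b) \<otimes> z) = h (e \<otimes> b) \<otimes> h z" by (rule step.IH)
    also have "h (e \<otimes> b) \<otimes> h (a' \<otimes> b') \<oplus> h (e \<otimes> b) \<otimes> h z = h (e \<otimes> b) \<otimes> (h (a' \<otimes> b') \<oplus> h z)"
      using hc by (simp add: r_distr)
    also have "h (a' \<otimes> b') \<oplus> h z = h (a' \<otimes> b' \<oplus> z)" using hadd[OF eb(2) step(3)] by simp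
    finally show ?case .
  qed
  have hmult: "h (x \<otimes> y) = h x \<otimes> h y" if x: "x \<in> prods E G" and y: "y \<in> prods E G" for x y
    using x
  proof induction
    case zero
    have "y \<in> carrier L" "h y \<in> carrier L" using y pc himg uc by auto
    then show ?case using h0 by simp
  next
    case (step a b z)
    have ab: "a \<otimes> b \<in> prods E G" using prods_single[OF Ec Gc step(1,2)] .
    have c: "a \<otimes> b \<in> carrier L" "z \<in> carrier L" "y \<in> carrier L"
      "h (a \<otimes> b) \<in> carrier L" "h z \<in> carrier L" "h y \<in> carrier L"
      using ab step(3) y pc himg uc by auto
    have "h ((a \<otimes> b \<oplus> z) \<otimes> y) = h ((a \<otimes> b) \<otimes> y \<oplus> z \<otimes> y)" using c by (simp add: l_distr)
    also have "\<dots> = h ((a \<otimes> b) \<otimes> y) \<oplus> h (z \<otimes> y)"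
      using hadd TR(6)[OF ab y] TR(6)[OF step(3) y] by blast
    also have "\<dots> = h (a \<otimes> b) \<otimes> h y \<oplus> h z \<otimes> h y" using hmult1[OF step(1,2) y] step.IH by simp
    also have "\<dots> = (h (a \<otimes> b) \<oplus> h z) \<otimes> h y" using c by (simp add: l_distr)
    also have "h (a \<otimes> b) \<oplus> h z = h (a \<otimes> b \<oplus> z)" using hadd[OF ab step(3)] by simp
    finally show ?case .
  qed
  have inj: "inj_on h (prods E G)"
  proof (rule inj_onI)
    fix x y assume xy: "x \<in> prods E G" "y \<in> prods E G" "h x = h y"
    note cx = co[OF xy(1)] and cy = co[OF xy(2)]
    have lists: "set (map f (co x)) \<subseteq> F1" "length (map f (co x)) = length vs"
      "set (map f (co y)) \<subseteq> F1" "length (map f (co y)) = length vs"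
      using cx cy fD(9) unfolding vs_def by auto
    have "combine (map f (co x)) vs = combine (map f (co y)) vs" using xy unfolding h_def by simp
    moreover have "combine (map f (co x)) vs \<in> Span F1 vs"
      using lists(1,2) Span_mem_iff_length_version[OF F1(1) vsc] by blast
    ultimately have "map f (co x) = map f (co y)"
      using unique_decomposition[OF F1(1) iF] lists by blast
    moreover have "inj_on f (set (co x) \<union> set (co y))" using inj_on_subset[OF fD(8)] cx cy by simp
    ultimately have "co x = co y" using inj_on_map_eq_map by blast
    then show "x = y" using cx cy by metis
  qed
  have surj: "h ` prods E G = prods F1 F2"
  proof
    show "h ` prods E G \<subseteq> prods F1 F2" using himg by blast
    show "prods F1 F2 \<subseteq> h ` prods E G"
    proof
      fix z assume "z \<in> prods F1 F2"
      then obtain ds where ds: "set ds \<subseteq> F1" "length ds = length vs" "z = combine ds vs"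
        unfolding US using Span_mem_iff_length_version[OF F1(1) vsc] by blast
      define cs where "cs = map (inv_into E f) ds"
      have cs: "set cs \<subseteq> E" "length cs = length us" "map f cs = ds"
        unfolding cs_def using ds(1,2) fD(7) inv_into_into[of _ f E] f_inv_into_f[of _ f E]
        by (auto simp: vs_def intro!: map_idI)
      have "z = h (combine cs us)" using hcomb[OF cs(1,2)] cs(3) ds(3) by simp
      moreover have "combine cs us \<in> prods E G" unfolding TS
        using cs(1,2) Span_mem_iff_length_version[OF E(1) us(1)] by blast
      ultimately show "z \<in> h ` prods E G" by blast
    qed
  qed
  have "h k = k" if "k \<in> K" for k using hf[OF subsetD[OF E(2) that]] fD(6)[OF that] by simp
  moreover have "h \<one> = \<one>" using hf[OF one(1)] fD(4) by simp
  moreover have "h \<in> extensional (prods E G)" unfolding h_def by simp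
  ultimately have "h \<in> K_isos K (prods E G) (prods F1 F2)"
    unfolding K_isos_iff[OF T U] using hmult hadd inj surj by (simp add: bij_betw_def)
  then show ?thesis using hf hg by blast
qed

end

section \<open>General normal magnifications\<close>


context algebraic_closure
begin

lemma iso_subfieldsD:
  assumes "subfield E L" "K \<subseteq> E" "F \<in> iso_subfields K T E"
  shows "subfield F L" "F \<subseteq> T" "K \<subseteq> F" "\<exists>h. h \<in> K_isos K E F"
proof -
  show F: "subfield F L" "F \<subseteq> T" and h: "\<exists>h. h \<in> K_isos K E F"
    using assms(3) unfolding iso_subfields_def by auto
  show "K \<subseteq> F"
    using h K_isosD(6,9)[OF assms(1) F(1)] assms(2) by (metis subset_iff)
qed


lemma self_in_iso_subfields:
  assumes "subfield E L" "K \<subseteq> E" "E \<subseteq> T"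
  shows "E \<in> iso_subfields K T E"
proof -
  have "restrict (\<lambda>x. x) E \<in> K_isos K E E"
    unfolding K_isos_iff[OF assms(1,1)]
    using assms(2) subringE(3,6,7)[OF subfieldE(1)[OF assms(1)]] by (auto simp: bij_betw_def)
  then show ?thesis using assms unfolding iso_subfields_def by blast
qed

lemma compositum_subfield:
  assumes "\<And>F. F \<in> \<F> \<Longrightarrow> subfield F L \<and> K \<subseteq> F \<and> F \<subseteq> T" "\<F> \<noteq> {}" "subfield T L"
  shows "subfield (compositum \<F>) L" "K \<subseteq> compositum \<F>" "compositum \<F> \<subseteq> T"
    "\<And>F. F \<in> \<F> \<Longrightarrow> F \<subseteq> compositum \<F>"
    "\<And>S. \<lbrakk> subfield S L; \<And>F. F \<in> \<F> \<Longrightarrow> F \<subseteq> S \<rbrakk> \<Longrightarrow> compositum \<F> \<subseteq> S"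
proof -
  have c: "\<Union>\<F> \<subseteq> carrier L" using assms(1) subfieldE(3) by blast
  note g = generate_fieldE[OF c refl, folded compositum_def]
  show "subfield (compositum \<F>) L" "\<And>F. F \<in> \<F> \<Longrightarrow> F \<subseteq> compositum \<F>" using g by auto
  then show "K \<subseteq> compositum \<F>" using assms(1,2) by blast
  show m: "compositum \<F> \<subseteq> S" if "subfield S L" "\<And>F. F \<in> \<F> \<Longrightarrow> F \<subseteq> S" for S
    using g(3)[OF that(1)] that(2) by blast
  show "compositum \<F> \<subseteq> T" using m[OF assms(3)] assms(1) by blast
qed

lemma subfield_finite_dimension:
  assumes "finite_dimension K T" "subfield F L" "K \<subseteq> F" "F \<subseteq> T"
  shows "finite_dimension K F"
  using subalbegra_incl_imp_finite_dimension[OF subfield_axioms assms(1) subfield_is_subalgebra[OF assms(2,3)] assms(4)] .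

lemma dim_tower:
  assumes "finite_dimension K T" "subfield T L" "subfield F L" "K \<subseteq> F" "F \<subseteq> T"
  shows "(dim over K) T = (dim over K) F * (dim over F) T"
proof -
  obtain us where us: "set us \<subseteq> carrier L" "Span K us = T"
    using exists_base[OF subfield_axioms finite_dimensionE[OF subfield_axioms assms(1)]] by blast
  have "set us \<subseteq> T" using Span_base_incl[OF subfield_axioms us(1)] us(2) by simp
  then have "Span F us = T"
    using Span_in_subfield[OF assms(3,2,5)] Span_mono_field[OF subfield_axioms assms(3,4) us(1)] us(2) by blast
  then have "finite_dimension F T" using Span_finite_dimension[OF assms(3) us(1)] by simp
  then show ?thesis
    using telescopic_base_dim(2)[OF subfield_axioms assms(3) subfield_finite_dimension[OF assms(1,3-5)]] by blast
qed

lemma K_in_prods: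
  assumes "subfield A L" "subfield B L" "K \<subseteq> A"
  shows "K \<subseteq> prods A B"
  using prods_incl(1)[OF subfieldE(1)[OF assms(1)] subfieldE(1)[OF assms(2)]] assms(3) by blast

lemma dim_pos:
  assumes "finite_dimension K F" "subfield F L"
  shows "(dim over K) F > 0"
proof (rule ccontr)
  assume "\<not> (dim over K) F > 0"
  then have "dimension 0 K F" using finite_dimensionE[OF subfield_axioms assms(1)] by simp
  then have "F = {\<zero>}" by (rule dimension_zero[OF subfield_axioms])
  then show False using subringE(3)[OF subfieldE(1)[OF assms(2)]] by simp
qed

end

text \<open>\<open>M\<close>, \<open>M2\<close>, \<open>E\<close>, \<open>G\<close> play the parts
  of M, J', L, J, because the letter \<open>L\<close> denotes the ambient field here.
  \<open>N1\<close> and \<open>N2\<close> may be any normal, linearly disjoint fields around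
  \<open>M\<close> and \<open>M2\<close>, which allows \<open>aut_number_prods\<close> to
  reinstantiate the locale with smaller fields.\<close>

locale magnification = ld_normal_fields +
  fixes M M2 E G
  assumes M: "subfield M L" "K \<subseteq> M" "M \<subseteq> N1" "finite_dimension K M"
    and M2: "subfield M2 L" "K \<subseteq> M2" "M2 \<subseteq> N2" "finite_dimension K M2"
    and E: "subfield E L" "K \<subseteq> E" "E \<subseteq> M"
    and G: "subfield G L" "K \<subseteq> G" "G \<subseteq> M2"
begin

lemma EN: "E \<subseteq> N1" and GN: "G \<subseteq> N2"
  using E G M M2 by auto

lemma E_finite: "finite_dimension K E" and G_finite: "finite_dimension K G"
  using subfield_finite_dimension[OF M(4) E] subfield_finite_dimension[OF M2(4) G] by auto

lemma EG: "subfield (prods E G) L" "K \<subseteq> prods E G" "E \<subseteq> prods E G" "G \<subseteq> prods E G"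
  using prods_is_subfield[OF E(1) G(1) E(2)] prods_incl[OF subfieldE(1)[OF E(1)] subfieldE(1)[OF G(1)]] E(2)
  by auto

lemma K_isos_image:
  assumes F: "subfield F L" "F \<subseteq> prods M M2" and h: "h \<in> K_isos K (prods E G) F"
  shows "h ` E \<subseteq> M" "h ` G \<subseteq> M2" "F = prods (h ` E) (h ` G)"
proof -
  note D = K_isosD[OF EG(1) F(1) h]
  have "h x \<in> N1" if "x \<in> E" for x
    using K_isos_conjugate[OF EG(1,2) F(1) h, of x] normal_ext_conjugates[OF N1_normal, of x] that EN EG(3) by blast
  then show "h ` E \<subseteq> M"
    using prods_Int_left(1)[OF M(1-3) M2(1-3)] D(9) F(2) EG(3) by blast
  have "h x \<in> N2" if "x \<in> G" for x
    using K_isos_conjugate[OF EG(1,2) F(1) h, of x] normal_ext_conjugates[OF N2_normal, of x] that GN EG(4) by blast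
  then show "h ` G \<subseteq> M2"
    using prods_Int_left(2)[OF M(1-3) M2(1-3)] D(9) F(2) EG(4) by blast
  note hE = K_isos_image_subfield[OF EG(1) F(1) h E(1,2) EG(3)]
  note hG = K_isos_image_subfield[OF EG(1) F(1) h G(1,2) EG(4)]
  show "F = prods (h ` E) (h ` G)"
  proof
    show "prods (h ` E) (h ` G) \<subseteq> F"
      using prods_subset_subring[OF subfieldE(1)[OF F(1)], of "h ` E" "h ` G"] D(9) EG(3,4) by blast
    have "h z \<in> prods (h ` E) (h ` G)" if "z \<in> prods E G" for z
      using that
    proof induction
      case zero
      show ?case using D(10) by (simp add: prods.zero)
    next
      case (step a b z)
      have "a \<in> prods E G" "b \<in> prods E G" using step EG(3,4) by auto
      then have "h (a \<otimes> b \<oplus> z) = h a \<otimes> h b \<oplus> h z"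
        using D(2,3) step(3) subringE(6)[OF subfieldE(1)[OF EG(1)]] by auto
      then show ?case using step by (simp add: prods.step)
    qed
    then show "F \<subseteq> prods (h ` E) (h ` G)" using D(7) by blast
  qed
qed

lemma iso_subfields_prods:
  "iso_subfields K (prods M M2) (prods E G) =
    (\<lambda>(A, B). prods A B) ` (iso_subfields K M E \<times> iso_subfields K M2 G)"
proof
  show "iso_subfields K (prods M M2) (prods E G) \<subseteq>
      (\<lambda>(A, B). prods A B) ` (iso_subfields K M E \<times> iso_subfields K M2 G)"
  proof
    fix F assume "F \<in> iso_subfields K (prods M M2) (prods E G)"
    then obtain h where F: "subfield F L" "F \<subseteq> prods M M2" and h: "h \<in> K_isos K (prods E G) F"
      unfolding iso_subfields_def by blast
    note im = K_isos_image[OF F h]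
    have "h ` E \<in> iso_subfields K M E" "h ` G \<in> iso_subfields K M2 G"
      using K_isos_image_subfield(1,2)[OF EG(1) F(1) h E(1,2) EG(3)]
        K_isos_image_subfield(1,2)[OF EG(1) F(1) h G(1,2) EG(4)] im unfolding iso_subfields_def by auto
    then show "F \<in> (\<lambda>(A, B). prods A B) ` (iso_subfields K M E \<times> iso_subfields K M2 G)"
      using im(3) by auto
  qed
  show "(\<lambda>(A, B). prods A B) ` (iso_subfields K M E \<times> iso_subfields K M2 G) \<subseteq>
      iso_subfields K (prods M M2) (prods E G)"
  proof clarify
    fix A B assume AB: "A \<in> iso_subfields K M E" "B \<in> iso_subfields K M2 G"
    note A = iso_subfieldsD[OF E(1,2) AB(1)] and B = iso_subfieldsD[OF G(1,2) AB(2)]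
    obtain f g where f: "f \<in> K_isos K E A" and g: "g \<in> K_isos K G B" using A(4) B(4) by blast
    have "\<exists>h. h \<in> K_isos K (prods E G) (prods A B)"
      using K_isos_extend[OF E(1,2) EN A(1,3) _ G(1,2) GN G_finite B(1,3) _ f g] A(2) B(2) M(3) M2(3) by blast
    then show "prods A B \<in> iso_subfields K (prods M M2) (prods E G)"
      using prods_is_subfield[OF A(1) B(1) A(3)] prods_mono[OF A(2) B(2)] unfolding iso_subfields_def by blast
  qed
qed

text \<open>Intersecting the compositum with \<open>N1\<close> and with \<open>N2\<close> recovers
  the two factors.\<close>

lemma prods_inj: "inj_on (\<lambda>(A, B). prods A B) (iso_subfields K M E \<times> iso_subfields K M2 G)"
proof (rule inj_onI, clarify)
  fix A B A' B' assume AB: "A \<in> iso_subfields K M E" "B \<in> iso_subfields K M2 G"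
    "A' \<in> iso_subfields K M E" "B' \<in> iso_subfields K M2 G" "prods A B = prods A' B'"
  have p: "prods C D \<inter> N1 = C" "prods C D \<inter> N2 = D"
    if "C \<in> iso_subfields K M E" "D \<in> iso_subfields K M2 G" for C D
    using prods_Int_left iso_subfieldsD(1-3)[OF E(1,2) that(1)] iso_subfieldsD(1-3)[OF G(1,2) that(2)] M(3) M2(3)
    by auto
  show "A = A' \<and> B = B'" using p[OF AB(1,2)] p[OF AB(3,4)] AB(5) by simp
qed

lemma card_iso_subfields:
  "card (iso_subfields K (prods M M2) (prods E G)) = card (iso_subfields K M E) * card (iso_subfields K M2 G)"
  unfolding iso_subfields_prods card_image[OF prods_inj] by (rule card_cartesian_product)

text \<open>\<open>E\<close> and \<open>G\<close> are among their own conjugates, so the default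
  value 0 of the indicia never arises.\<close>

lemma iso_subfields_nonempty: "iso_subfields K M E \<noteq> {}" "iso_subfields K M2 G \<noteq> {}"
  "iso_subfields K (prods M M2) (prods E G) \<noteq> {}"
  using self_in_iso_subfields[OF E] self_in_iso_subfields[OF G] unfolding iso_subfields_prods by auto

lemma iso_subfield_props:
  "A \<in> iso_subfields K M E \<Longrightarrow> subfield A L \<and> K \<subseteq> A \<and> A \<subseteq> M"
  "B \<in> iso_subfields K M2 G \<Longrightarrow> subfield B L \<and> K \<subseteq> B \<and> B \<subseteq> M2"
  using iso_subfieldsD(1-3)[OF E(1,2)] iso_subfieldsD(1-3)[OF G(1,2)] by auto

text \<open>With \<open>t\<close> the identity or \<open>max_separable K\<close> this covers both
  intersection indicia. Pairs (A, B) serve as indices, and each factor then runs through its own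
  family because the other family is nonempty.\<close>

lemma Inter_family:
  assumes A: "\<And>F. F \<in> iso_subfields K M E \<Longrightarrow> subfield (t F) L \<and> K \<subseteq> t F \<and> t F \<subseteq> M"
    and B: "\<And>F. F \<in> iso_subfields K M2 G \<Longrightarrow> subfield (t F) L \<and> K \<subseteq> t F \<and> t F \<subseteq> M2"
    and t: "\<And>A B. \<lbrakk> A \<in> iso_subfields K M E; B \<in> iso_subfields K M2 G \<rbrakk> \<Longrightarrow> t (prods A B) = prods (t A) (t B)"
  shows "(dim over K) (\<Inter>F\<in>iso_subfields K (prods M M2) (prods E G). t F) =
    (dim over K) (\<Inter>F\<in>iso_subfields K M E. t F) * (dim over K) (\<Inter>F\<in>iso_subfields K M2 G. t F)"
proof -
  let ?I = "iso_subfields K M E \<times> iso_subfields K M2 G"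
  note ne = iso_subfields_nonempty
  have "(\<Inter>F\<in>iso_subfields K (prods M M2) (prods E G). t F) = (\<Inter>i\<in>?I. prods (t (fst i)) (t (snd i)))"
    unfolding iso_subfields_prods using t by (auto simp: INT_iff)
  also have "\<dots> = prods (\<Inter>i\<in>?I. t (fst i)) (\<Inter>i\<in>?I. t (snd i))"
  proof (rule Inter_prods)
    fix i assume i: "i \<in> ?I"
    show "subfield (t (fst i)) L \<and> K \<subseteq> t (fst i) \<and> t (fst i) \<subseteq> N1"
      using A[of "fst i"] mem_Times_iff[THEN iffD1, OF i] by (simp add: subset_trans[OF _ M(3)])
    show "subfield (t (snd i)) L \<and> K \<subseteq> t (snd i) \<and> t (snd i) \<subseteq> N2"
      using B[of "snd i"] mem_Times_iff[THEN iffD1, OF i] by (simp add: subset_trans[OF _ M2(3)])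
  qed (use ne in auto)
  also have "(\<Inter>i\<in>?I. t (fst i)) = (\<Inter>F\<in>iso_subfields K M E. t F)" using ne by auto
  also have "(\<Inter>i\<in>?I. t (snd i)) = (\<Inter>F\<in>iso_subfields K M2 G. t F)" using ne by auto
  finally have eq: "(\<Inter>F\<in>iso_subfields K (prods M M2) (prods E G). t F) =
      prods (\<Inter>F\<in>iso_subfields K M E. t F) (\<Inter>F\<in>iso_subfields K M2 G. t F)" .
  have sub: "subfield (\<Inter>F\<in>\<F>. t F) L \<and> K \<subseteq> (\<Inter>F\<in>\<F>. t F) \<and> (\<Inter>F\<in>\<F>. t F) \<subseteq> T"
    if h: "\<And>F. F \<in> \<F> \<Longrightarrow> subfield (t F) L \<and> K \<subseteq> t F \<and> t F \<subseteq> T" and n: "\<F> \<noteq> {}" for \<F> T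
  proof -
    have "subring (\<Inter>(t ` \<F>)) L"
      by (rule subring_Inter) (use h n subfieldE(1) in blast)+
    moreover have "K \<subseteq> (\<Inter>F\<in>\<F>. t F)" using h by blast
    moreover have "(\<Inter>F\<in>\<F>. t F) \<subseteq> T" using h n by blast
    ultimately show ?thesis using subring_over_is_subfield by blast
  qed
  have a: "subfield (\<Inter>F\<in>iso_subfields K M E. t F) L \<and> K \<subseteq> (\<Inter>F\<in>iso_subfields K M E. t F)
      \<and> (\<Inter>F\<in>iso_subfields K M E. t F) \<subseteq> M"
    by (rule sub[OF A ne(1)])
  have b: "subfield (\<Inter>F\<in>iso_subfields K M2 G. t F) L \<and> K \<subseteq> (\<Inter>F\<in>iso_subfields K M2 G. t F)
      \<and> (\<Inter>F\<in>iso_subfields K M2 G. t F) \<subseteq> M2"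
    by (rule sub[OF B ne(2)])
  have fa: "finite_dimension K (\<Inter>F\<in>iso_subfields K M E. t F)"
    and fb: "finite_dimension K (\<Inter>F\<in>iso_subfields K M2 G. t F)"
    using subfield_finite_dimension[OF M(4)] subfield_finite_dimension[OF M2(4)] a b by blast+
  show ?thesis
    unfolding eq by (rule prods_dim(2)) (use a b fa fb M(3) M2(3) in auto)
qed

text \<open>Stated for the same two choices of \<open>t\<close>. Both sides are generated by all
  \<open>t A\<close> and \<open>t B\<close>: each of these lies in a product with some partner from
  the other, nonempty family.\<close>

lemma compositum_family:
  assumes A: "\<And>F. F \<in> iso_subfields K M E \<Longrightarrow> subfield (t F) L \<and> K \<subseteq> t F \<and> t F \<subseteq> M"
    and B: "\<And>F. F \<in> iso_subfields K M2 G \<Longrightarrow> subfield (t F) L \<and> K \<subseteq> t F \<and> t F \<subseteq> M2"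
    and t: "\<And>A B. \<lbrakk> A \<in> iso_subfields K M E; B \<in> iso_subfields K M2 G \<rbrakk> \<Longrightarrow> t (prods A B) = prods (t A) (t B)"
  shows "compositum (t ` iso_subfields K (prods M M2) (prods E G)) =
    prods (compositum (t ` iso_subfields K M E)) (compositum (t ` iso_subfields K M2 G))" (is "?C = prods ?P ?Q")
proof -
  note ne = iso_subfields_nonempty
  have h1: "\<And>F. F \<in> t ` iso_subfields K M E \<Longrightarrow> subfield F L \<and> K \<subseteq> F \<and> F \<subseteq> M" using A by blast
  have h2: "\<And>F. F \<in> t ` iso_subfields K M2 G \<Longrightarrow> subfield F L \<and> K \<subseteq> F \<and> F \<subseteq> M2" using B by blast
  have n1: "t ` iso_subfields K M E \<noteq> {}" and n2: "t ` iso_subfields K M2 G \<noteq> {}" using ne by auto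
  note P = compositum_subfield[of "t ` iso_subfields K M E", OF h1 n1 M(1)]
    and Q = compositum_subfield[of "t ` iso_subfields K M2 G", OF h2 n2 M2(1)]
  have img: "t ` iso_subfields K (prods M M2) (prods E G) =
      {prods (t A) (t B) | A B. A \<in> iso_subfields K M E \<and> B \<in> iso_subfields K M2 G}"
    unfolding iso_subfields_prods using t by (force simp: image_iff)
  have PQ: "subfield (prods ?P ?Q) L" using prods_is_subfield[OF P(1) Q(1) P(2)] .
  have h3: "subfield F L \<and> K \<subseteq> F \<and> F \<subseteq> prods ?P ?Q"
    if "F \<in> t ` iso_subfields K (prods M M2) (prods E G)" for F
  proof -
    obtain A' B' where AB: "A' \<in> iso_subfields K M E" "B' \<in> iso_subfields K M2 G" "F = prods (t A') (t B')"
      using \<open>F \<in> t ` _\<close> unfolding img by blast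
    note a = A[OF AB(1)] and b = B[OF AB(2)]
    have "subfield F L" unfolding AB(3) using prods_is_subfield[of "t A'" "t B'"] a b by simp
    moreover have "K \<subseteq> F" unfolding AB(3) using K_in_prods[of "t A'" "t B'"] a b by simp
    moreover have "F \<subseteq> prods ?P ?Q" unfolding AB(3)
    proof (rule prods_mono)
      show "t A' \<subseteq> ?P" using P(4) AB(1) by blast
      show "t B' \<subseteq> ?Q" using Q(4) AB(2) by blast
    qed
    ultimately show ?thesis by blast
  qed
  have n3: "t ` iso_subfields K (prods M M2) (prods E G) \<noteq> {}" using ne by auto
  note C = compositum_subfield[of "t ` iso_subfields K (prods M M2) (prods E G)", OF h3 n3 PQ]
  show ?thesis
  proof
    show "?C \<subseteq> prods ?P ?Q" by (rule C(3))
    have m: "t A' \<subseteq> ?C" "t B' \<subseteq> ?C"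
      if AB: "A' \<in> iso_subfields K M E" "B' \<in> iso_subfields K M2 G" for A' B'
    proof -
      have "prods (t A') (t B') \<in> t ` iso_subfields K (prods M M2) (prods E G)"
        unfolding img using AB by blast
      then have "prods (t A') (t B') \<subseteq> ?C" using C(4) by simp
      then show "t A' \<subseteq> ?C" "t B' \<subseteq> ?C"
        using prods_incl[of "t A'" "t B'"] subfieldE(1)[of "t A'"] subfieldE(1)[of "t B'"] A[OF AB(1)] B[OF AB(2)]
        by auto
    qed
    obtain A' B' where AB: "A' \<in> iso_subfields K M E" "B' \<in> iso_subfields K M2 G" using ne by blast
    have "F \<subseteq> ?C" if "F \<in> t ` iso_subfields K M E" for F
      using that m(1)[OF _ AB(2)] by (elim imageE) simp
    then have "?P \<subseteq> ?C" using P(5)[OF _ C(1)] by simp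
    moreover have "F \<subseteq> ?C" if "F \<in> t ` iso_subfields K M2 G" for F
      using that m(2)[OF AB(1)] by (elim imageE) simp
    then have "?Q \<subseteq> ?C" using Q(5)[OF _ C(1)] by simp
    ultimately show "prods ?P ?Q \<subseteq> ?C" using prods_subset_subring[OF subfieldE(1)[OF C(1)]] by blast
  qed
qed

text \<open>An automorphism is determined by its restrictions to the two factors, as these generate
  the compositum, and every pair of automorphisms occurs by \<open>K_isos_extend\<close>.\<close>

lemma aut_number_prods: "aut_number K (prods E G) = aut_number K E * aut_number K G"
proof -
  \<comment> \<open>With \<open>E\<close> and \<open>G\<close> in the place of \<open>M\<close> and
    \<open>M2\<close>, \<open>K_isos_image\<close> says that an automorphism of the compositum maps
    each factor into itself.\<close>
  interpret self: magnification L K N1 N2 E G E G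
    by (intro magnification.intro ld_normal_fields_axioms magnification_axioms.intro
        E(1,2) G(1,2) EN GN E_finite G_finite subset_refl)
  define r where "r h = (restrict h E, restrict h G)" for h :: "'a \<Rightarrow> 'a"
  have img: "h ` E = E \<and> h ` G = G" if h: "h \<in> K_isos K (prods E G) (prods E G)" for h
  proof -
    note im = self.K_isos_image[OF EG(1) subset_refl h]
    note hE = K_isos_image_subfield[OF EG(1) EG(1) h E(1,2) EG(3)]
    note hG = K_isos_image_subfield[OF EG(1) EG(1) h G(1,2) EG(4)]
    \<comment> \<open>The images are the whole factors, since both pairs of factors are cut out of
      the same compositum by \<open>N1\<close> and \<open>N2\<close>.\<close>
    have "prods E G \<inter> N1 = h ` E" "prods E G \<inter> N2 = h ` G"
      using prods_Int_left[of "h ` E" "h ` G"] im hE(1,3) hG(1,3) EN GN by auto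
    then show ?thesis using prods_Int_left[OF E(1,2) EN G(1,2) GN] by simp
  qed
  have "bij_betw r (K_isos K (prods E G) (prods E G)) (K_isos K E E \<times> K_isos K G G)"
    unfolding bij_betw_def
  proof
    show "inj_on r (K_isos K (prods E G) (prods E G))"
    proof (rule inj_onI)
      fix h h' assume h: "h \<in> K_isos K (prods E G) (prods E G)" and h': "h' \<in> K_isos K (prods E G) (prods E G)"
        and "r h = r h'"
      then have eq: "restrict h E = restrict h' E" "restrict h G = restrict h' G" unfolding r_def by auto
      note D = K_isosD[OF EG(1) EG(1) h] and D' = K_isosD[OF EG(1) EG(1) h']
      have e: "h x = h' x" if "x \<in> E" for x using fun_cong[OF eq(1), of x] that by simp
      have g: "h x = h' x" if "x \<in> G" for x using fun_cong[OF eq(2), of x] that by simp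
      have "h z = h' z" if "z \<in> prods E G" for z
        using that
      proof induction
        case zero
        show ?case using D(10) D'(10) by simp
      next
        case (step a b z)
        have ab: "a \<in> prods E G" "b \<in> prods E G" using step EG(3,4) by auto
        then have "a \<otimes> b \<in> prods E G" using subringE(6)[OF subfieldE(1)[OF EG(1)]] by blast
        then show ?case using D(2,3) D'(2,3) ab step e g by simp
      qed
      then show "h = h'" using D(1) D'(1) by (intro extensionalityI[of _ "prods E G"]) auto
    qed
    show "r ` K_isos K (prods E G) (prods E G) = K_isos K E E \<times> K_isos K G G"
    proof
      show "r ` K_isos K (prods E G) (prods E G) \<subseteq> K_isos K E E \<times> K_isos K G G"
      proof
        fix p assume "p \<in> r ` K_isos K (prods E G) (prods E G)"
        then obtain h where h: "h \<in> K_isos K (prods E G) (prods E G)" "p = r h" by blast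
        show "p \<in> K_isos K E E \<times> K_isos K G G"
          using K_isos_image_subfield(2)[OF EG(1) EG(1) h(1) E(1,2) EG(3)]
            K_isos_image_subfield(2)[OF EG(1) EG(1) h(1) G(1,2) EG(4)] img[OF h(1)] h(2) unfolding r_def by auto
      qed
      show "K_isos K E E \<times> K_isos K G G \<subseteq> r ` K_isos K (prods E G) (prods E G)"
      proof clarify
        fix f g assume f: "f \<in> K_isos K E E" and g: "g \<in> K_isos K G G"
        obtain h where h: "h \<in> K_isos K (prods E G) (prods E G)" "\<And>x. x \<in> E \<Longrightarrow> h x = f x"
            "\<And>y. y \<in> G \<Longrightarrow> h y = g y"
          using K_isos_extend[OF E(1,2) EN E(1,2) EN G(1,2) GN G_finite G(1,2) GN f g] by blast
        have "restrict h E = f" "restrict h G = g"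
          using h(2,3) K_isosD(1)[OF E(1) E(1) f] K_isosD(1)[OF G(1) G(1) g]
          by (auto simp: restrict_def extensional_def)
        then show "(f, g) \<in> r ` K_isos K (prods E G) (prods E G)" using h(1) unfolding r_def by force
      qed
    qed
  qed
  then show ?thesis
    unfolding aut_number_def using bij_betw_same_card card_cartesian_product by metis
qed

lemma max_separable_prods:
  assumes "subfield A L" "K \<subseteq> A" "subfield B L" "K \<subseteq> B"
  shows "max_separable K (prods A B) = prods (max_separable K A) (max_separable K B)"
proof -
  have "K \<subseteq> prods A B" using prods_incl(1)[OF subfieldE(1)[OF assms(1)] subfieldE(1)[OF assms(3)]] assms(2) by blast
  then show ?thesis
    using max_separable_eq[OF prods_is_subfield[OF assms(1,3,2)]] max_separable_eq[OF assms(1,2)]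
      max_separable_eq[OF assms(3,4)] prods_Int_separables[OF assms] by simp
qed

lemma max_separable_subfield:
  assumes "subfield A L" "K \<subseteq> A"
  shows "subfield (max_separable K A) L" "K \<subseteq> max_separable K A" "max_separable K A \<subseteq> A"
  using Int_subfield[OF assms separables_subfield K_separable] max_separable_eq[OF assms] by auto

text \<open>By the tower law the degree over the separable part is a quotient of two degrees over
  \<open>K\<close>, and both of these multiply; the positive degree of the separable part is
  cancelled at the end.\<close>

lemma multi_aut_number_prods:
  "multi_aut_number K (prods E G) = multi_aut_number K E * multi_aut_number K G"
proof -
  define S where "S = max_separable K"
  note SE = max_separable_subfield[OF E(1,2), folded S_def] and SG = max_separable_subfield[OF G(1,2), folded S_def]
  note SEG = max_separable_subfield[OF EG(1,2), folded S_def]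
  have fS: "finite_dimension K (S E)" "finite_dimension K (S G)"
    using subfield_finite_dimension[OF E_finite SE] subfield_finite_dimension[OF G_finite SG] by auto
  have f: "finite_dimension K (prods E G)" and d: "(dim over K) (prods E G) = (dim over K) E * (dim over K) G"
    using prods_dim[OF E(1,2) EN E_finite G(1,2) GN G_finite] by auto
  have SN: "S E \<subseteq> N1" "S G \<subseteq> N2" using SE(3) SG(3) EN GN by auto
  have dS: "(dim over K) (S (prods E G)) = (dim over K) (S E) * (dim over K) (S G)"
    using prods_dim(2)[OF SE(1,2) SN(1) fS(1) SG(1,2) SN(2) fS(2)]
      max_separable_prods[OF E(1,2) G(1,2)] unfolding S_def by simp
  have t: "(dim over K) E = (dim over K) (S E) * (dim over (S E)) E"
    "(dim over K) G = (dim over K) (S G) * (dim over (S G)) G"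
    "(dim over K) (prods E G) = (dim over K) (S (prods E G)) * (dim over (S (prods E G))) (prods E G)"
    using dim_tower[OF E_finite E(1) SE] dim_tower[OF G_finite G(1) SG] dim_tower[OF f EG(1) SEG] by auto
  have p: "(dim over K) (S E) > 0" "(dim over K) (S G) > 0"
    using dim_pos[OF fS(1) SE(1)] dim_pos[OF fS(2) SG(1)] by auto
  have "(dim over (S (prods E G))) (prods E G) = (dim over (S E)) E * (dim over (S G)) G"
  proof -
    let ?c = "(dim over K) (S E) * (dim over K) (S G)"
    have "?c * (dim over (S (prods E G))) (prods E G) = (dim over K) E * (dim over K) G"
      using t(3) unfolding d dS by simp
    also have "\<dots> = ((dim over K) (S E) * (dim over (S E)) E) * ((dim over K) (S G) * (dim over (S G)) G)"
      using t(1,2) by simp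
    also have "\<dots> = ?c * ((dim over (S E)) E * (dim over (S G)) G)" by (simp only: mult_ac)
    finally show ?thesis using p by (metis mult_left_cancel mult_pos_pos less_numeral_extra(3))
  qed
  then show ?thesis unfolding multi_aut_number_def aut_number_prods S_def by (simp add: mult_ac)
qed

lemma multiplicativity:
  shows "root_capacity K (prods M M2) (prods E G) = root_capacity K M E * root_capacity K M2 G"
    and "multiroot_capacity K (prods M M2) (prods E G) = multiroot_capacity K M E * multiroot_capacity K M2 G"
    and "intersection_indicium K (prods M M2) (prods E G) =
      intersection_indicium K M E * intersection_indicium K M2 G"
    and "intersection_normal_indicium K (prods M M2) (prods E G) =
      intersection_normal_indicium K M E * intersection_normal_indicium K M2 G"
    and "compositum_indicium K (prods M M2) (prods E G) =
      compositum_indicium K M E * compositum_indicium K M2 G"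
    and "compositum_normal_indicium K (prods M M2) (prods E G) =
      compositum_normal_indicium K M E * compositum_normal_indicium K M2 G"
    and "inseparable_compositum_indicium K (prods M M2) (prods E G) =
      inseparable_compositum_indicium K M E * inseparable_compositum_indicium K M2 G"
proof -
  note ne = iso_subfields_nonempty
  show "root_capacity K (prods M M2) (prods E G) = root_capacity K M E * root_capacity K M2 G"
    unfolding root_capacity_def card_iso_subfields aut_number_prods by (simp add: mult_ac)
  show "multiroot_capacity K (prods M M2) (prods E G) = multiroot_capacity K M E * multiroot_capacity K M2 G"
    unfolding multiroot_capacity_def card_iso_subfields multi_aut_number_prods by (simp add: mult_ac)
  have s1: "subfield (max_separable K F) L \<and> K \<subseteq> max_separable K F \<and> max_separable K F \<subseteq> M"
    if "F \<in> iso_subfields K M E" for F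
    using max_separable_subfield[of F] iso_subfield_props(1)[OF that] by auto
  have s2: "subfield (max_separable K F) L \<and> K \<subseteq> max_separable K F \<and> max_separable K F \<subseteq> M2"
    if "F \<in> iso_subfields K M2 G" for F
    using max_separable_subfield[of F] iso_subfield_props(2)[OF that] by auto
  have s3: "max_separable K (prods A B) = prods (max_separable K A) (max_separable K B)"
    if "A \<in> iso_subfields K M E" "B \<in> iso_subfields K M2 G" for A B
    using max_separable_prods iso_subfield_props(1)[OF that(1)] iso_subfield_props(2)[OF that(2)] by blast
  have comp: "subfield (compositum (t ` iso_subfields K M E)) L \<and> K \<subseteq> compositum (t ` iso_subfields K M E) \<and>
      compositum (t ` iso_subfields K M E) \<subseteq> M \<and> finite_dimension K (compositum (t ` iso_subfields K M E))"
    if "\<And>F. F \<in> iso_subfields K M E \<Longrightarrow> subfield (t F) L \<and> K \<subseteq> t F \<and> t F \<subseteq> M" for t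
  proof -
    have "\<And>F. F \<in> t ` iso_subfields K M E \<Longrightarrow> subfield F L \<and> K \<subseteq> F \<and> F \<subseteq> M"
      and "t ` iso_subfields K M E \<noteq> {}" using that ne(1) by auto
    note c = compositum_subfield(1-3)[OF this M(1)]
    show ?thesis using c subfield_finite_dimension[OF M(4) c] by blast
  qed
  have comp2: "subfield (compositum (t ` iso_subfields K M2 G)) L \<and> K \<subseteq> compositum (t ` iso_subfields K M2 G) \<and>
      compositum (t ` iso_subfields K M2 G) \<subseteq> M2 \<and> finite_dimension K (compositum (t ` iso_subfields K M2 G))"
    if "\<And>F. F \<in> iso_subfields K M2 G \<Longrightarrow> subfield (t F) L \<and> K \<subseteq> t F \<and> t F \<subseteq> M2" for t
  proof -
    have "\<And>F. F \<in> t ` iso_subfields K M2 G \<Longrightarrow> subfield F L \<and> K \<subseteq> F \<and> F \<subseteq> M2"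
      and "t ` iso_subfields K M2 G \<noteq> {}" using that ne(2) by auto
    note c = compositum_subfield(1-3)[OF this M2(1)]
    show ?thesis using c subfield_finite_dimension[OF M2(4) c] by blast
  qed
  show "intersection_indicium K (prods M M2) (prods E G) =
      intersection_indicium K M E * intersection_indicium K M2 G"
    unfolding intersection_indicium_def using ne Inter_family[of "max_separable K", OF s1 s2 s3] by simp
  show "intersection_normal_indicium K (prods M M2) (prods E G) =
      intersection_normal_indicium K M E * intersection_normal_indicium K M2 G"
    unfolding intersection_normal_indicium_def
    using ne Inter_family[of "\<lambda>F. F", OF iso_subfield_props refl] by simp
  have dimc: "(dim over K) (prods P Q) = (dim over K) P * (dim over K) Q"
    if "subfield P L \<and> K \<subseteq> P \<and> P \<subseteq> M \<and> finite_dimension K P"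
      "subfield Q L \<and> K \<subseteq> Q \<and> Q \<subseteq> M2 \<and> finite_dimension K Q" for P Q
    using prods_dim(2)[of P Q] that M(3) M2(3) by auto
  show "compositum_indicium K (prods M M2) (prods E G) =
      compositum_indicium K M E * compositum_indicium K M2 G"
    unfolding compositum_indicium_def
    using ne compositum_family[of "max_separable K", OF s1 s2 s3] dimc[OF comp[OF s1] comp2[OF s2]] by simp
  \<comment> \<open>The last two quantities depend only on the compositum of all conjugates as a
    field, so that field is factored first.\<close>
  define P Q where "P = compositum (iso_subfields K M E)" and "Q = compositum (iso_subfields K M2 G)"
  have P: "subfield P L \<and> K \<subseteq> P \<and> P \<subseteq> M \<and> finite_dimension K P"
    and Q: "subfield Q L \<and> K \<subseteq> Q \<and> Q \<subseteq> M2 \<and> finite_dimension K Q"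
    using comp[of "\<lambda>F. F"] comp2[of "\<lambda>F. F"] iso_subfield_props unfolding P_def Q_def by auto
  have PQ: "compositum (iso_subfields K (prods M M2) (prods E G)) = prods P Q"
    using compositum_family[of "\<lambda>F. F", OF iso_subfield_props refl] unfolding P_def Q_def by simp
  show "compositum_normal_indicium K (prods M M2) (prods E G) =
      compositum_normal_indicium K M E * compositum_normal_indicium K M2 G"
    unfolding compositum_normal_indicium_def PQ using ne dimc[OF P Q] unfolding P_def Q_def by simp
  have PQf: "subfield (prods P Q) L" "K \<subseteq> prods P Q"
    using prods_is_subfield[of P Q] K_in_prods[of P Q] P Q by auto
  have I: "subfield (F \<inter> inseparables) L \<and> K \<subseteq> F \<inter> inseparables \<and> F \<inter> inseparables \<subseteq> T \<and>
      finite_dimension K (F \<inter> inseparables)"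
    if "subfield F L \<and> K \<subseteq> F \<and> F \<subseteq> T \<and> finite_dimension K F" for F T
  proof -
    note i = Int_subfield[of F inseparables, OF _ _ inseparables_subfield K_inseparable]
    then show ?thesis using that subfield_finite_dimension[of F "F \<inter> inseparables"] by auto
  qed
  have "max_purely_inseparable K (prods P Q) = prods (P \<inter> inseparables) (Q \<inter> inseparables)"
    unfolding max_purely_inseparable_eq[OF PQf]
    by (rule prods_Int_inseparables) (use P Q M(3) M2(3) in blast)+
  moreover have "max_purely_inseparable K P = P \<inter> inseparables" "max_purely_inseparable K Q = Q \<inter> inseparables"
    using max_purely_inseparable_eq P Q by auto
  ultimately show "inseparable_compositum_indicium K (prods M M2) (prods E G) =
      inseparable_compositum_indicium K M E * inseparable_compositum_indicium K M2 G"
    unfolding inseparable_compositum_indicium_def PQ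
    using ne dimc[OF I[OF P] I[OF Q]] unfolding P_def Q_def by simp
qed

end

theorem proposition3p8:
  fixes \<Omega> :: "('a, 'b) ring_scheme" and K L L' M M' J J' :: "'a set"
  assumes "algebraic_closure \<Omega> K"
    and "ring.finite_ext \<Omega> K L'" and "ring.finite_ext \<Omega> K M'" and "L' \<subseteq> M'"
    and "ring.general_normal_magnification \<Omega> K M' M J'"
    and "ring.general_normal_magnification \<Omega> K L' L J"
    and "L \<subseteq> M" and "J \<subseteq> J'"
  shows "ring.root_capacity \<Omega> K M' L' =
           ring.root_capacity \<Omega> K M L * ring.root_capacity \<Omega> K J' J \<and>
         ring.multiroot_capacity \<Omega> K M' L' =
           ring.multiroot_capacity \<Omega> K M L * ring.multiroot_capacity \<Omega> K J' J \<and>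
         ring.intersection_indicium \<Omega> K M' L' =
           ring.intersection_indicium \<Omega> K M L * ring.intersection_indicium \<Omega> K J' J \<and>
         ring.intersection_normal_indicium \<Omega> K M' L' =
           ring.intersection_normal_indicium \<Omega> K M L * ring.intersection_normal_indicium \<Omega> K J' J \<and>
         ring.compositum_indicium \<Omega> K M' L' =
           ring.compositum_indicium \<Omega> K M L * ring.compositum_indicium \<Omega> K J' J \<and>
         ring.compositum_normal_indicium \<Omega> K M' L' =
           ring.compositum_normal_indicium \<Omega> K M L * ring.compositum_normal_indicium \<Omega> K J' J \<and>
         ring.inseparable_compositum_indicium \<Omega> K M' L' =
           ring.inseparable_compositum_indicium \<Omega> K M L * ring.inseparable_compositum_indicium \<Omega> K J' J"
proof -
  interpret algebraic_closure \<Omega> K by (rule assms(1))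
  have M: "subfield M \<Omega>" "K \<subseteq> M" "finite_dimension K M"
    and J': "subfield J' \<Omega>" "K \<subseteq> J'" "finite_dimension K J'"
    and ld: "linearly_disjoint K (normal_closure K M) (normal_closure K J')"
    and M': "compositum {M, J'} = M'"
    using assms(5) unfolding general_normal_magnification_def finite_ext_def by (auto simp: over_def)
  have L: "subfield L \<Omega>" "K \<subseteq> L" and J: "subfield J \<Omega>" "K \<subseteq> J" and L': "compositum {L, J} = L'"
    using assms(6) unfolding general_normal_magnification_def finite_ext_def by auto
  note nM = normal_closure_props(1,2)[OF subfieldE(3)[OF M(1)]]
    and nJ = normal_closure_props(1,2)[OF subfieldE(3)[OF J'(1)]]
  \<comment> \<open>From here on \<open>L\<close> is the field of the theorem and the ambient field
    is \<open>\<Omega>\<close>; in the locales above \<open>L\<close> was the ambient field.\<close>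
  interpret magnification \<Omega> K "normal_closure K M" "normal_closure K J'" M J' L J
  proof (intro magnification.intro ld_normal_fields.intro ld_fields.intro)
    show "algebraic_closure \<Omega> K" by (rule assms(1))
    show "ld_fields_axioms \<Omega> K (normal_closure K M) (normal_closure K J')"
      by (rule ld_fields_axioms.intro) (use nM(2) nJ(2) ld in \<open>auto simp: normal_ext_def\<close>)
    show "ld_normal_fields_axioms \<Omega> K (normal_closure K M) (normal_closure K J')"
      by (rule ld_normal_fields_axioms.intro) (use nM(2) nJ(2) in auto)
    show "magnification_axioms \<Omega> K (normal_closure K M) (normal_closure K J') M J' L J"
      by (rule magnification_axioms.intro) (use M J' L J nM(1) nJ(1) assms(7,8) in auto)
  qed
  have "M' = prods M J'" "L' = prods L J"
    using compositum_eq_prods[OF M(1) J'(1) M(2)] compositum_eq_prods[OF L(1) J(1) L(2)] M' L' by auto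
  then show ?thesis using multiplicativity by simp
qed

end
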